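(* Let $n\ge 2$, let $d$ be a positive divisor of $n$, let $\Sigma_d$ be embedded diagonally in $\Sigma_n$, and let $G$ be a transitive subgroup of $\Sigma_d$. Let $C_{\Sigma_d}(G)$ be the centralizer of $G$ in $\Sigma_d$. There is a homotopy equivalence $$|\Pi_n|^G\simeq \left(C_{\Sigma_d}(G)^{\frac nd}\right)_+\wedge_{C_{\Sigma_d}(G)}\Sigma\left(|\Pi_d|^G*|\Pi_{\frac nd}|\right).$$
   Context: $\Pi_n$ is the poset of partitions of $\{1,\dots,n\}$ other than the one-block partition and the partition into singletons, ordered by refinement, with the natural $\Sigma_n$-action; $|\Pi_n|$ is the geometric realization of its order complex. The diagonal embedding $\Sigma_d\hookrightarrow(\Sigma_d)^{n/d}\hookrightarrow\Sigma_n$ is given by $\sigma(i+(j-1)d)=\sigma(i)+(j-1)d$ for $1\le i\le d$, $1\le j\le n/d$; $G\subset\Sigma_d$ acts on $|\Pi_n|$ through this embedding. $*$ denotes join and $\Sigma X=S^0*X$ denotes unreduced suspension. The group $C_{\Sigma_d}(G)$ acts on $|\Pi_d|^G$ through the action of $\Sigma_d$ on $|\Pi_d|$, acts trivially on $|\Pi_{n/d}|$ and on the suspension coordinate, and sits in $C_{\Sigma_d}(G)^{n/d}$ as the diagonal; the suspension is pointed by one of its cone points. For a pointed $H$-space $X$ and $H\subset K$, $K_+\wedge_HX$ is the induced pointed $K$-space, i.e. a wedge of copies of $X$ indexed by $K/H$. Conventions: $|\Pi_2|=\emptyset=S^{-1}$ is the unit for join. $|\Pi_1|$ is regarded as $S^{-2}$,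 meaning that $S^m*|\Pi_1|:=S^{m-1}$ for $m\ge0$ (so $S^0*|\Pi_1|*X=X$); thus for $d=1$ and for $d=n$ the right-hand side reduces to $|\Pi_n|$ and to $|\Pi_n|^G$, respectively. *)

theory Defs
  imports
    "HOL-Analysis.Analysis"
    "HOL-Algebra.Product_Groups"
    "HOL-Algebra.Sym_Groups"
begin

definition order_complex :: "('a \<Rightarrow> 'a \<Rightarrow> bool) \<Rightarrow> 'a set \<Rightarrow> 'a set set" where
  "order_complex r P =
     {S. S \<subseteq> P \<and> S \<noteq> {} \<and> finite S \<and> Complete_Partial_Order.chain r S}"

text \<open>
  Points are given by barycentric coordinates. For a finite complex \<^term>\<open>K\<close>, the only case used
  below, the topology of pointwise convergence is the usual one on the realization.
\<close>

definition geometric_realization :: "'a set set \<Rightarrow> ('a \<Rightarrow> real) topology" where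
  "geometric_realization K =
     subtopology (powertop_real UNIV)
       {t. (\<forall>v. 0 \<le> t v) \<and> {v. t v \<noteq> 0} \<in> K \<and> sum t {v. t v \<noteq> 0} = 1}"

definition fixed_points :: "'g set \<Rightarrow> ('g \<Rightarrow> 'x \<Rightarrow> 'x) \<Rightarrow> 'x topology \<Rightarrow> 'x topology" where
  "fixed_points G act X = subtopology X {x. \<forall>g\<in>G. act g x = x}"

definition partition_poset :: "nat \<Rightarrow> nat set set set" where
  "partition_poset n =
     {P. partition_on {1..n} P \<and> P \<noteq> {{1..n}} \<and> P \<noteq> (\<lambda>i. {i}) ` {1..n}}"

definition partition_complex :: "nat \<Rightarrow> (nat set set \<Rightarrow> real) topology" where
  "partition_complex n =
     geometric_realization (order_complex (refines {1..n}) (partition_poset n))"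

text \<open>
  A permutation sends a partition \<open>P\<close> to the partition consisting of the images of the blocks of
  \<open>P\<close>, and the realization carries the linear extension of this action: the coordinate of the
  point \<open>\<sigma> t\<close> at the vertex \<open>P\<close> is the coordinate of \<open>t\<close> at the vertex \<open>\<sigma>\<close>-inverse applied to \<open>P\<close>.
\<close>

definition perm_act :: "(nat \<Rightarrow> nat) \<Rightarrow> (nat set set \<Rightarrow> real) \<Rightarrow> nat set set \<Rightarrow> real" where
  "perm_act \<sigma> t = (\<lambda>P. t ((\<lambda>B. inv_into UNIV \<sigma> ` B) ` P))"

text \<open>
  The element \<open>i + (j - 1) * d\<close> with \<open>1 \<le> i \<le> d\<close> and \<open>1 \<le> j \<le> n div d\<close> is sent to
  \<open>\<sigma> i + (j - 1) * d\<close>.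
\<close>

definition diagonal_embedding :: "nat \<Rightarrow> nat \<Rightarrow> (nat \<Rightarrow> nat) \<Rightarrow> nat \<Rightarrow> nat" where
  "diagonal_embedding d n \<sigma> =
     (\<lambda>k. if k \<in> {1..n} then \<sigma> ((k - 1) mod d + 1) + ((k - 1) div d) * d else k)"

text \<open>
  The join of \<open>X\<close> and \<open>Y\<close> is the double mapping cylinder of the projections of \<open>X \<times> Y\<close>, that is the
  quotient of the disjoint union of \<open>X\<close>, \<open>X \<times> [0,1] \<times> Y\<close> and \<open>Y\<close> in which \<open>(x, 0, y)\<close> is
  identified with \<open>x\<close> and \<open>(x, 1, y)\<close> with \<open>y\<close>. In particular the empty space is a unit. The
  datatype lists the equivalence classes: \<open>Join_Mid x t y\<close> is only used for \<open>0 < t < 1\<close>.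
\<close>

datatype ('a, 'b) join_pt = Join_Left 'a | Join_Mid 'a real 'b | Join_Right 'b

definition join_segment :: "'a \<times> real \<times> 'b \<Rightarrow> ('a, 'b) join_pt" where
  "join_segment = (\<lambda>(x, t, y).
     if t = 0 then Join_Left x else if t = 1 then Join_Right y else Join_Mid x t y)"

definition join_points :: "'a set \<Rightarrow> 'b set \<Rightarrow> ('a, 'b) join_pt set" where
  "join_points A B =
     Join_Left ` A \<union> join_segment ` (A \<times> {0..1} \<times> B) \<union> Join_Right ` B"

definition join_space :: "'a topology \<Rightarrow> 'b topology \<Rightarrow> ('a, 'b) join_pt topology" where
  "join_space X Y = topology (\<lambda>U.
     U \<subseteq> join_points (topspace X) (topspace Y) \<and>
     openin X {x \<in> topspace X. Join_Left x \<in> U} \<and>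
     openin (prod_topology X (prod_topology (top_of_set {0..1}) Y))
       {p \<in> topspace X \<times> {0..1} \<times> topspace Y. join_segment p \<in> U} \<and>
     openin Y {y \<in> topspace Y. Join_Right y \<in> U})"

lemma istopology_preimage:
  "istopology (\<lambda>U. openin X {x \<in> topspace X. f x \<in> U})"
proof -
  have "{x \<in> topspace X. f x \<in> S \<inter> T} = {x \<in> topspace X. f x \<in> S} \<inter> {x \<in> topspace X. f x \<in> T}"
    for S T by blast
  moreover have "{x \<in> topspace X. f x \<in> \<Union>\<K>} = \<Union>((\<lambda>U. {x \<in> topspace X. f x \<in> U}) ` \<K>)" for \<K>
    by blast
  ultimately show ?thesis
    unfolding istopology_def by (metis (no_types, lifting) imageE openin_Int openin_Union)
qed

lemma openin_join_space:
  "openin (join_space X Y) U \<longleftrightarrow>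
     U \<subseteq> join_points (topspace X) (topspace Y) \<and>
     openin X {x \<in> topspace X. Join_Left x \<in> U} \<and>
     openin (prod_topology X (prod_topology (top_of_set {0..1}) Y))
       {p \<in> topspace X \<times> {0..1} \<times> topspace Y. join_segment p \<in> U} \<and>
     openin Y {y \<in> topspace Y. Join_Right y \<in> U}"
proof -
  have conj: "istopology (\<lambda>U. P U \<and> Q U)" if "istopology P" "istopology Q"
    for P Q :: "('a, 'b) join_pt set \<Rightarrow> bool"
    using that unfolding istopology_def by (simp add: Ball_def subset_iff)
  have "istopology (\<lambda>U. U \<subseteq> join_points (topspace X) (topspace Y))"
    unfolding istopology_def by blast
  moreover note istopology_preimage[of X Join_Left]
  moreover have "istopology (\<lambda>U. openin (prod_topology X (prod_topology (top_of_set {0..1}) Y))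
       {p \<in> topspace X \<times> {0..1} \<times> topspace Y. join_segment p \<in> U})"
    using istopology_preimage[of "prod_topology X (prod_topology (top_of_set {0..1}) Y)" join_segment]
    by simp
  moreover note istopology_preimage[of Y Join_Right]
  ultimately have "istopology (\<lambda>U.
     U \<subseteq> join_points (topspace X) (topspace Y) \<and>
     openin X {x \<in> topspace X. Join_Left x \<in> U} \<and>
     openin (prod_topology X (prod_topology (top_of_set {0..1}) Y))
       {p \<in> topspace X \<times> {0..1} \<times> topspace Y. join_segment p \<in> U} \<and>
     openin Y {y \<in> topspace Y. Join_Right y \<in> U})"
    by (intro conj)
  then show ?thesis
    unfolding join_space_def by (simp add: topology_inverse')
qed

lemma topspace_join_space:
  "topspace (join_space X Y) = join_points (topspace X) (topspace Y)"
proof -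
  let ?J = "join_points (topspace X) (topspace Y)"
  have *: "{x \<in> topspace X. Join_Left x \<in> ?J} = topspace X"
    "{p \<in> topspace X \<times> {0..1} \<times> topspace Y. join_segment p \<in> ?J}
       = topspace (prod_topology X (prod_topology (top_of_set {0..1}) Y))"
    "{y \<in> topspace Y. Join_Right y \<in> ?J} = topspace Y"
    unfolding join_points_def topspace_prod_topology topspace_euclidean_subtopology by blast+
  have "openin (join_space X Y) ?J"
    unfolding openin_join_space * by (intro conjI openin_topspace subset_refl)
  then show ?thesis
    by (meson openin_join_space openin_subset openin_topspace subset_antisym)
qed

definition sphere0 :: "int topology" where
  "sphere0 = discrete_topology {-1, 1}"

definition quotient_topology :: "'a topology \<Rightarrow> ('a \<Rightarrow> 'b) \<Rightarrow> 'b topology" where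
  "quotient_topology X q =
     topology (\<lambda>U. U \<subseteq> q ` topspace X \<and> openin X {x \<in> topspace X. q x \<in> U})"

lemma openin_quotient_topology:
  "openin (quotient_topology X q) U \<longleftrightarrow>
     U \<subseteq> q ` topspace X \<and> openin X {x \<in> topspace X. q x \<in> U}"
proof -
  have "istopology (\<lambda>U. U \<subseteq> q ` topspace X \<and> openin X {x \<in> topspace X. q x \<in> U})"
    using istopology_preimage[of X q] unfolding istopology_def by blast
  then show ?thesis
    unfolding quotient_topology_def by (simp add: topology_inverse')
qed

lemma topspace_quotient_topology: "topspace (quotient_topology X q) = q ` topspace X"
proof -
  have "{x \<in> topspace X. q x \<in> q ` topspace X} = topspace X"
    by blast
  then have "openin (quotient_topology X q) (q ` topspace X)"
    unfolding openin_quotient_topology by simp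
  then show ?thesis
    by (meson openin_quotient_topology openin_subset openin_topspace subset_antisym)
qed

lemma quotient_map_quotient_topology: "quotient_map X (quotient_topology X q) q"
  unfolding quotient_map_def topspace_quotient_topology by (simp add: openin_quotient_topology)

text \<open>
  For a group homomorphism \<open>\<iota>\<close> from \<open>H\<close> to \<open>K\<close> and an \<open>H\<close>-space \<open>X\<close>, the space
  \<open>K\<^sub>+ \<and>\<^sub>H X\<close> is the quotient of \<open>K \<times> X\<close> by the relation that identifies \<open>(k \<iota>(h), x)\<close> with
  \<open>(k, h x)\<close> and all points of \<open>K \<times> B\<close> with each other. Here \<open>B = {b}\<close> if \<open>X\<close> has the
  \<open>H\<close>-fixed base point \<open>b\<close>. For \<open>B = {}\<close> this is the unpointed induced space; if \<open>\<iota>\<close> is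
  an isomorphism then both are just \<open>X\<close>.
\<close>

definition induced_class ::
  "('k, 'c) monoid_scheme \<Rightarrow> ('h, 'e) monoid_scheme \<Rightarrow> ('h \<Rightarrow> 'k) \<Rightarrow> ('h \<Rightarrow> 'x \<Rightarrow> 'x) \<Rightarrow> 'x set
     \<Rightarrow> 'x topology \<Rightarrow> 'k \<times> 'x \<Rightarrow> ('k \<times> 'x) set" where
  "induced_class K H \<iota> act B X = (\<lambda>(k, x).
     {(k', x') \<in> carrier K \<times> topspace X.
        (\<exists>h\<in>carrier H. k = k' \<otimes>\<^bsub>K\<^esub> \<iota> h \<and> x' = act h x) \<or> (x \<in> B \<and> x' \<in> B)})"

definition induced_space ::
  "('k, 'c) monoid_scheme \<Rightarrow> ('h, 'e) monoid_scheme \<Rightarrow> ('h \<Rightarrow> 'k) \<Rightarrow> ('h \<Rightarrow> 'x \<Rightarrow> 'x) \<Rightarrow> 'x set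
     \<Rightarrow> 'x topology \<Rightarrow> ('k \<times> 'x) set topology" where
  "induced_space K H \<iota> act B X =
     quotient_topology (prod_topology (discrete_topology (carrier K)) X)
       (induced_class K H \<iota> act B X)"

text \<open>
  As \<open>|\<Pi>\<^sub>1|\<close> is regarded as the sphere of dimension -2, joining it with the suspension
  sphere \<open>S\<^sup>0\<close> gives the sphere of dimension -1, that is the empty space, which is the unit for
  the join. As \<^term>\<open>partition_complex 1\<close> is the empty space too, the suspension of a
  join with \<open>|\<Pi>\<^sub>1|\<close> is therefore obtained by replacing \<open>S\<^sup>0\<close> with the empty space; the
  result is a copy of the other factor. In this case there is no cone point.
\<close>

definition suspension_sphere :: "nat \<Rightarrow> nat \<Rightarrow> int topology" where
  "suspension_sphere d m = (if d = 1 \<or> m = 1 then discrete_topology {} else sphere0)"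

type_synonym partition_pt = "nat set set \<Rightarrow> real"
type_synonym susp_join_pt = "(int, (partition_pt, partition_pt) join_pt) join_pt"

definition susp_join :: "nat \<Rightarrow> nat \<Rightarrow> (nat \<Rightarrow> nat) set \<Rightarrow> susp_join_pt topology" where
  "susp_join d m G =
     join_space (suspension_sphere d m)
       (join_space (fixed_points G perm_act (partition_complex d)) (partition_complex m))"

definition susp_join_act :: "(nat \<Rightarrow> nat) \<Rightarrow> susp_join_pt \<Rightarrow> susp_join_pt" where
  "susp_join_act c = map_join_pt id (map_join_pt (perm_act c) id)"

definition susp_join_base :: "nat \<Rightarrow> nat \<Rightarrow> susp_join_pt set" where
  "susp_join_base d m = Join_Left ` (topspace (suspension_sphere d m) \<inter> {1})"

definition centralizer_group ::
  "('a, 'b) monoid_scheme \<Rightarrow> 'a set \<Rightarrow> ('a, 'b) monoid_scheme" where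
  "centralizer_group M S =
     M\<lparr>carrier := {x \<in> carrier M. \<forall>s\<in>S. x \<otimes>\<^bsub>M\<^esub> s = s \<otimes>\<^bsub>M\<^esub> x}\<rparr>"

definition power_group :: "('a, 'b) monoid_scheme \<Rightarrow> nat \<Rightarrow> (nat \<Rightarrow> 'a) monoid" where
  "power_group M m = product_group {1..m} (\<lambda>_. M)"

definition diagonal :: "nat \<Rightarrow> 'a \<Rightarrow> nat \<Rightarrow> 'a" where
  "diagonal m x = (\<lambda>j\<in>{1..m}. x)"

end

theory Submission
  imports Defs
begin

text \<open>
  The fixed points are the realization of the poset \<open>P\<close> of proper invariant partitions. Let \<open>o\<close> be
  the partition into orbits. A partition \<open>y\<close> in \<open>P\<close> is a complement of \<open>o\<close> (trivial meet and
  trivial join) iff each of its blocks meets each orbit in exactly one point. Identifying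
  every orbit with \<open>{1..d}\<close>, such a \<open>y\<close> is given by an \<open>n/d\<close>-tuple of elements of the centralizer \<open>C\<close>, up
  to a common factor. The interval above \<open>y\<close> consists of the invariant partitions of \<open>{1..d}\<close>,
  the interval below \<open>y\<close> is the poset of all partitions of \<open>{1..n/d}\<close>.

  The rest follows the homotopy complementation formula of Bjorner and Walker: the complements
  form an antichain, and the other vertices span a contractible subcomplex, because they can be
  removed one by one with contractible links. Collapsing this subcomplex leaves a wedge of
  suspended links, one for each complement, which is the induced space. The quotient is realized
  inside a space of functions by the products of the coordinates \<open>t y * t x\<close> with \<open>y\<close> a complement.
  If \<open>d = 1\<close> or \<open>d = n\<close>, then \<open>y\<close> is the top or bottom partition and its link is all of \<open>P\<close>.
\<close>

text \<open>The fixed points form a subcomplex because a partition \<open>Q\<close> and a translate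
  \<open>g Q\<close> in the support of one point are comparable with equally many blocks, and
  therefore agree. In the coordinates position in the orbit and index of the orbit, a complement is
  the relation of having equal positions. A coarser partition ignores the index. A finer one
  partitions the indices over each position, and transitivity of \<open>G\<close> forces the same
  partition over all positions; this is why the lower interval carries no condition of invariance. A
  common factor from \<open>C\<close> only relabels the positions, so it acts on the upper interval
  and leaves the complement and its lower interval alone. Spaces are compared through continuous
  surjections of compact spaces onto Hausdorff spaces: such a map is a quotient map, also after
  multiplication with the interval, so it suffices to know its fibres. Hence the collapsed complex
  is modelled in a space of functions, and the collapse is shown to be an equivalence by an explicit
  homotopy of the uncollapsed complex that respects the fibres.\<close>

section \<open>Quotient maps out of compact spaces\<close>

lemma homotopy_descends:
  fixes h :: "real \<times> 'a \<Rightarrow> 'c"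
  assumes q: "continuous_map Y V q" "q ` topspace Y = topspace V"
    and Y: "compact_space Y" and V: "Hausdorff_space V"
    and h: "continuous_map (prod_topology (top_of_set {0..1}) Y) Z h"
    and compat: "\<And>\<tau> a b. \<tau> \<in> {0..1} \<Longrightarrow> a \<in> topspace Y \<Longrightarrow> b \<in> topspace Y \<Longrightarrow> q a = q b
                   \<Longrightarrow> h (\<tau>, a) = h (\<tau>, b)"
  obtains h' where "continuous_map (prod_topology (top_of_set {0..1}) V) Z h'"
    and "\<And>\<tau> a. \<tau> \<in> {0..1} \<Longrightarrow> a \<in> topspace Y \<Longrightarrow> h' (\<tau>, q a) = h (\<tau>, a)"
proof -
  let ?I = "top_of_set {0..1::real}"
  let ?q = "\<lambda>(\<tau>, a). (\<tau>, q a)"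
  \<comment> \<open>Compactness of the source and the Hausdorff property of the target make the
    product of the identity with \<open>q\<close> a quotient map, along which the homotopy
    descends.\<close>
  have "quotient_map (prod_topology ?I Y) (prod_topology ?I V) ?q"
  proof (rule continuous_imp_quotient_map)
    show "continuous_map (prod_topology ?I Y) (prod_topology ?I V) ?q"
      using q(1) by (simp add: continuous_map_prod_top)
    show "compact_space (prod_topology ?I Y)"
      using Y by (simp add: compact_space_prod_topology compact_space_subtopology)
    show "Hausdorff_space (prod_topology ?I V)"
      using V by (simp add: Hausdorff_space_prod_topology Hausdorff_space_subtopology)
    show "?q ` topspace (prod_topology ?I Y) = topspace (prod_topology ?I V)"
      using q(2) by (force simp: image_iff)
  qed
  then obtain h' where h': "continuous_map (prod_topology ?I V) Z h'"
      "\<And>p. p \<in> topspace (prod_topology ?I Y) \<Longrightarrow> h' (?q p) = h p"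
    by (rule quotient_map_lift_exists [OF _ h]) (auto intro: compat)
  show thesis
    by (rule that [OF h'(1)]) (use h'(2) in force)
qed

text \<open>This is the argument by which collapsing a contractible subcomplex is an equivalence.
  The end map of \<open>H\<close> is constant on fibres, so it factors as \<open>g\<close> after
  \<open>q\<close>, and \<open>H\<close> joins the identity to it. Since \<open>H\<close> maps
  fibres into fibres, it descends to a homotopy from the identity to \<open>q\<close> after
  \<open>g\<close>.\<close>

lemma quotient_homotopy_equivalent:
  fixes H :: "real \<times> 'a \<Rightarrow> 'a"
  assumes q: "continuous_map X V q" "q ` topspace X = topspace V"
    and X: "compact_space X" and V: "Hausdorff_space V"
    and H: "continuous_map (prod_topology (top_of_set {0..1}) X) X H"
    and H0: "\<And>a. a \<in> topspace X \<Longrightarrow> H (0, a) = a"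
    and H1: "\<And>a b. a \<in> topspace X \<Longrightarrow> b \<in> topspace X \<Longrightarrow> q a = q b \<Longrightarrow> H (1, a) = H (1, b)"
    and compat: "\<And>\<tau> a b. \<tau> \<in> {0..1} \<Longrightarrow> a \<in> topspace X \<Longrightarrow> b \<in> topspace X \<Longrightarrow> q a = q b
                   \<Longrightarrow> q (H (\<tau>, a)) = q (H (\<tau>, b))"
  shows "X homotopy_equivalent_space V"
proof -
  let ?I = "top_of_set {0..1::real}"
  have "continuous_map (prod_topology ?I X) V (q \<circ> H)"
    using H q(1) by (rule continuous_map_compose)
  then obtain h' where h': "continuous_map (prod_topology ?I V) V h'"
      "\<And>\<tau> a. \<tau> \<in> {0..1} \<Longrightarrow> a \<in> topspace X \<Longrightarrow> h' (\<tau>, q a) = q (H (\<tau>, a))"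
  proof (rule homotopy_descends [OF q X V])
    show "(q \<circ> H) (\<tau>, a) = (q \<circ> H) (\<tau>, b)"
      if "\<tau> \<in> {0..1}" "a \<in> topspace X" "b \<in> topspace X" "q a = q b" for \<tau> a b
      using compat [OF that] by simp
  qed auto
  have qm: "quotient_map X V q"
    by (rule continuous_imp_quotient_map [OF q(1) X V q(2)])
  have H1c: "continuous_map X X (\<lambda>a. H (1, a))"
    using continuous_map_o_Pair [OF H, of 1] by (simp add: o_def)
  obtain g where g: "continuous_map V X g" "\<And>a. a \<in> topspace X \<Longrightarrow> g (q a) = H (1, a)"
    by (rule quotient_map_lift_exists [OF qm H1c]) (erule (2) H1, blast)
  have "homotopic_with (\<lambda>x. True) X X id (g \<circ> q)"
    by (subst homotopic_with) (auto intro!: exI [of _ H] simp: H H0 g)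
  moreover have "homotopic_with (\<lambda>x. True) V V id (q \<circ> g)"
  proof (subst homotopic_with, simp, intro exI conjI ballI)
    show "continuous_map (prod_topology ?I V) V h'" by fact
    fix v assume "v \<in> topspace V"
    then obtain a where a: "a \<in> topspace X" "v = q a"
      using q(2) by blast
    show "h' (0, v) = id v" "h' (1, v) = (q \<circ> g) v"
      using a h'(2)[of 0 a] h'(2)[of 1 a] by (simp_all add: H0 g)
  qed auto
  ultimately show ?thesis
    unfolding homotopy_equivalent_space_def
    using q(1) g(1) by (intro exI [of _ q] exI [of _ g] conjI) (auto simp: homotopic_with_sym)
qed

text \<open>Serves to replace a quotient made of equivalence classes by a concrete Hausdorff model:
  the induced map is a continuous bijection from a compact space to a Hausdorff space.\<close>

lemma quotient_maps_homeomorphic: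
  assumes f: "quotient_map X Y f"
    and g: "continuous_map X Z g" "g ` topspace X = topspace Z"
    and X: "compact_space X" and Z: "Hausdorff_space Z"
    and fibres: "\<And>a b. a \<in> topspace X \<Longrightarrow> b \<in> topspace X \<Longrightarrow> f a = f b \<longleftrightarrow> g a = g b"
  shows "Y homeomorphic_space Z"
proof -
  obtain k where k: "continuous_map Y Z k" "k ` topspace Y = g ` topspace X"
      "\<And>a. a \<in> topspace X \<Longrightarrow> k (f a) = g a"
    by (rule quotient_map_lift_exists [OF f g(1)]) (use fibres in auto)
  have fX: "f ` topspace X = topspace Y"
    using f by (simp add: quotient_map_def)
  have "homeomorphic_map Y Z k"
  proof (rule continuous_imp_homeomorphic_map [OF k(1) _ Z])
    show "compact_space Y"
      using X f fX unfolding compact_space_def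
      by (metis image_compactin quotient_imp_continuous_map)
    show "k ` topspace Y = topspace Z"
      using k(2) g(2) by simp
    show "inj_on k (topspace Y)"
      unfolding fX [symmetric] inj_on_def using k(3) fibres by auto
  qed
  then show ?thesis
    by (rule homeomorphic_map_imp_homeomorphic_space)
qed

lemma continuous_map_discrete_prod:
  assumes "\<And>k. k \<in> K \<Longrightarrow> continuous_map X Y (\<lambda>x. f (k, x))"
  shows "continuous_map (prod_topology (discrete_topology K) X) Y f"
proof -
  have "openin (prod_topology (discrete_topology K) X) {p \<in> K \<times> topspace X. f p \<in> U}"
    if U: "openin Y U" for U
  proof -
    have "{p \<in> K \<times> topspace X. f p \<in> U} = (\<Union>k\<in>K. {k} \<times> {x \<in> topspace X. f (k, x) \<in> U})"
      by auto
    moreover have "openin (prod_topology (discrete_topology K) X) ({k} \<times> {x \<in> topspace X. f (k, x) \<in> U})"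
      if "k \<in> K" for k
      using openin_continuous_map_preimage [OF assms [OF that] U] that
      by (simp add: openin_prod_Times_iff)
    ultimately show ?thesis
      by auto
  qed
  moreover have "f \<in> K \<times> topspace X \<rightarrow> topspace Y"
    using assms by (force simp: continuous_map_def)
  ultimately show ?thesis
    by (simp add: continuous_map_def)
qed

subsection \<open>Joins\<close>

text \<open>The three pieces are those of the disjoint union of which the join is a quotient. The
  ends are tested separately because the segments give nothing when the other factor is
  empty.\<close>

lemma continuous_map_join_space:
  assumes "continuous_map X Z (\<lambda>x. f (Join_Left x))"
    and "continuous_map (prod_topology X (prod_topology (top_of_set {0..1}) Y)) Z (\<lambda>p. f (join_segment p))"
    and "continuous_map Y Z (\<lambda>y. f (Join_Right y))"
  shows "continuous_map (join_space X Y) Z f"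
proof -
  let ?S = "prod_topology X (prod_topology (top_of_set {0..1}) Y)"
  have "openin (join_space X Y) {p \<in> join_points (topspace X) (topspace Y). f p \<in> U}"
    if U: "openin Z U" for U
  proof -
    let ?U = "{p \<in> join_points (topspace X) (topspace Y). f p \<in> U}"
    have "{x \<in> topspace X. Join_Left x \<in> ?U} = {x \<in> topspace X. f (Join_Left x) \<in> U}"
      "{p \<in> topspace X \<times> {0..1} \<times> topspace Y. join_segment p \<in> ?U}
        = {p \<in> topspace ?S. f (join_segment p) \<in> U}"
      "{y \<in> topspace Y. Join_Right y \<in> ?U} = {y \<in> topspace Y. f (Join_Right y) \<in> U}"
      by (auto simp: join_points_def)
    moreover note assms [THEN openin_continuous_map_preimage, OF U]
    ultimately show ?thesis
      unfolding openin_join_space by auto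
  qed
  moreover have "f \<in> join_points (topspace X) (topspace Y) \<rightarrow> topspace Z"
    using assms unfolding continuous_map_def join_points_def by fastforce
  ultimately show ?thesis
    by (simp add: continuous_map_def topspace_join_space)
qed

lemma continuous_map_join_segment:
  "continuous_map (prod_topology X (prod_topology (top_of_set {0..1}) Y)) (join_space X Y) join_segment"
  unfolding continuous_map_def topspace_join_space
  by (auto simp: openin_join_space join_points_def)

lemma continuous_map_Join_Left: "continuous_map X (join_space X Y) Join_Left"
  and continuous_map_Join_Right: "continuous_map Y (join_space X Y) Join_Right"
  unfolding continuous_map_def topspace_join_space
  by (auto simp: openin_join_space join_points_def)

lemma compact_space_join_space:
  assumes X: "compact_space X" and Y: "compact_space Y"
  shows "compact_space (join_space X Y)"
proof -
  have "compactin (join_space X Y) (Join_Left ` topspace X)"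
    "compactin (join_space X Y) (Join_Right ` topspace Y)"
    using X Y by (auto simp: compact_space_def intro: image_compactin continuous_map_Join_Left continuous_map_Join_Right)
  moreover have "compactin (join_space X Y) (join_segment ` (topspace X \<times> {0..1::real} \<times> topspace Y))"
  proof (rule image_compactin [OF _ continuous_map_join_segment])
    have "compact_space (prod_topology X (prod_topology (top_of_set {0..1::real}) Y))"
      using X Y by (simp add: compact_space_prod_topology compact_space_subtopology)
    then show "compactin (prod_topology X (prod_topology (top_of_set {0..1})Y)) (topspace X \<times> {0..1::real} \<times> topspace Y)"
      by (simp add: compact_space_def)
  qed
  ultimately show ?thesis
    unfolding compact_space_def topspace_join_space join_points_def
    by (intro compactin_Un)
qed

lemma join_points_cases:
  assumes "p \<in> join_points A B"
  obtains (left) x where "x \<in> A" "p = Join_Left x"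
  | (mid) x t y where "x \<in> A" "0 < t" "t < 1" "y \<in> B" "p = Join_Mid x t y"
  | (right) y where "y \<in> B" "p = Join_Right y"
  using assms unfolding join_points_def join_segment_def by (force split: if_splits)

lemma join_points_simps [simp]:
  "Join_Left x \<in> join_points A B \<longleftrightarrow> x \<in> A"
  "Join_Mid x t y \<in> join_points A B \<longleftrightarrow> x \<in> A \<and> 0 < t \<and> t < 1 \<and> y \<in> B"
  "Join_Right y \<in> join_points A B \<longleftrightarrow> y \<in> B"
proof -
  show "Join_Left x \<in> join_points A B \<longleftrightarrow> x \<in> A" "Join_Right y \<in> join_points A B \<longleftrightarrow> y \<in> B"
    by (auto simp: join_points_def join_segment_def split: if_splits)
  have "Join_Mid x t y \<in> join_points A B" if "x \<in> A" "0 < t" "t < 1" "y \<in> B"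
  proof -
    have "join_segment (x, t, y) \<in> join_points A B"
      unfolding join_points_def using that by (intro UnI1 UnI2 imageI) auto
    then show ?thesis
      using that by (simp add: join_segment_def)
  qed
  then show "Join_Mid x t y \<in> join_points A B \<longleftrightarrow> x \<in> A \<and> 0 < t \<and> t < 1 \<and> y \<in> B"
    by (auto elim: join_points_cases)
qed

subsection \<open>Realizations of finite posets\<close>

text \<open>For finite \<open>P\<close> the sum runs over a fixed set, and that the support is a
  chain is a condition on pairs. In this form all conditions are closed in the product topology and
  easy to check for convex combinations.\<close>

definition barycentric :: "('a \<Rightarrow> 'a \<Rightarrow> bool) \<Rightarrow> 'a set \<Rightarrow> ('a \<Rightarrow> real) set" where
  "barycentric r P =
     {t. (\<forall>v. 0 \<le> t v) \<and> (\<forall>v. v \<notin> P \<longrightarrow> t v = 0) \<and>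
         (\<forall>v w. t v \<noteq> 0 \<longrightarrow> t w \<noteq> 0 \<longrightarrow> r v w \<or> r w v) \<and> sum t P = 1}"

abbreviation realization :: "('a \<Rightarrow> 'a \<Rightarrow> bool) \<Rightarrow> 'a set \<Rightarrow> ('a \<Rightarrow> real) topology" where
  "realization r P \<equiv> geometric_realization (order_complex r P)"

abbreviation point_mass :: "'a \<Rightarrow> 'a \<Rightarrow> real" where
  "point_mass v \<equiv> (\<lambda>w. if w = v then 1 else 0)"

lemma barycentricD:
  assumes "t \<in> barycentric r P"
  shows "0 \<le> t v" "v \<notin> P \<Longrightarrow> t v = 0" "t v \<noteq> 0 \<Longrightarrow> t w \<noteq> 0 \<Longrightarrow> r v w \<or> r w v" "sum t P = 1"
  using assms by (auto simp: barycentric_def)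

lemma barycentric_le_1:
  assumes "finite P" "t \<in> barycentric r P"
  shows "t v \<le> 1"
proof (cases "v \<in> P")
  case True
  then have "t v \<le> sum t P"
    using assms by (intro member_le_sum) (auto dest: barycentricD(1))
  then show ?thesis
    using assms by (simp add: barycentricD(4))
qed (use assms in \<open>auto dest: barycentricD(2)\<close>)

lemma realization_eq:
  assumes "finite P"
  shows "realization r P = subtopology (powertop_real UNIV) (barycentric r P)"
proof -
  have "{t. (\<forall>v. 0 \<le> t v) \<and> {v. t v \<noteq> 0} \<in> order_complex r P \<and> sum t {v. t v \<noteq> 0} = (1::real)}
        = barycentric r P"
  proof -
    have "sum t {v. t v \<noteq> 0} = sum t P" if "\<forall>v. v \<notin> P \<longrightarrow> t v = 0" for t :: "'a \<Rightarrow> real"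
      using that assms by (intro sum.mono_neutral_left) auto
    moreover have "{v. t v \<noteq> 0} \<subseteq> P \<longleftrightarrow> (\<forall>v. v \<notin> P \<longrightarrow> t v = 0)" for t :: "'a \<Rightarrow> real"
      by auto
    moreover have "{v. t v \<noteq> 0} \<noteq> {}" if "sum t P = 1" for t :: "'a \<Rightarrow> real"
      using that by fastforce
    ultimately show ?thesis
      unfolding barycentric_def order_complex_def Complete_Partial_Order.chain_def
      using assms by (auto intro: finite_subset)
  qed
  then show ?thesis
    by (simp add: geometric_realization_def)
qed

lemma topspace_realization [simp]: "finite P \<Longrightarrow> topspace (realization r P) = barycentric r P"
  by (simp add: realization_eq)

lemma continuous_map_into_realization:
  assumes "finite P"
  shows "continuous_map X (realization r P) f \<longleftrightarrow>
     (\<forall>v. continuous_map X euclideanreal (\<lambda>x. f x v)) \<and> (\<forall>x\<in>topspace X. f x \<in> barycentric r P)"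
  using assms by (auto simp: realization_eq continuous_map_in_subtopology continuous_map_componentwise_UNIV)

lemma continuous_map_coordinate [continuous_intros]:
  "finite P \<Longrightarrow> continuous_map (realization r P) euclideanreal (\<lambda>t. t v)"
  unfolding realization_eq
  by (rule continuous_map_from_subtopology, rule continuous_map_product_projection) simp

lemma Hausdorff_space_powertop_real: "Hausdorff_space (powertop_real UNIV)"
  by (simp add: Hausdorff_space_product_topology)

lemma Hausdorff_space_realization: "finite P \<Longrightarrow> Hausdorff_space (realization r P)"
  by (simp add: realization_eq Hausdorff_space_powertop_real Hausdorff_space_subtopology)

text \<open>A closed subset of a product of compact intervals: the support is a chain iff
  \<open>t v * t w\<close> vanishes for all incomparable \<open>v\<close> and
  \<open>w\<close>.\<close>

lemma compact_space_realization:
  assumes "finite P"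
  shows "compact_space (realization r P)"
proof -
  let ?T = "powertop_real (UNIV :: 'a set)"
  let ?B = "PiE UNIV (\<lambda>v. if v \<in> P then {0..1::real} else {0})"
  let ?N = "\<lambda>v w. {t \<in> topspace ?T. t v * t w \<in> {0}}"
  let ?S = "{t \<in> topspace ?T. sum t P \<in> {1}}"
  have coord: "continuous_map ?T euclideanreal (\<lambda>t. t v)" for v
    by (rule continuous_map_product_projection) simp
  have "compactin ?T ?B"
    by (auto simp: compactin_PiE)
  moreover have N: "closedin ?T (?N v w)" for v w
    by (rule closedin_continuous_map_preimage [where Y = euclideanreal])
       (auto intro: continuous_intros coord)
  have "closedin ?T (\<Inter>(insert ?S {?N v w | v w. \<not> r v w \<and> \<not> r w v}))"
  proof (rule closedin_Inter)
    have "closedin ?T ?S"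
      by (rule closedin_continuous_map_preimage [where Y = euclideanreal])
         (use assms in \<open>auto intro: continuous_map_sum coord\<close>)
    then show "closedin ?T S" if "S \<in> insert ?S {?N v w | v w. \<not> r v w \<and> \<not> r w v}" for S
      using that N by auto
  qed simp
  ultimately have "compactin ?T (?B \<inter> \<Inter>(insert ?S {?N v w | v w. \<not> r v w \<and> \<not> r w v}))"
    by (rule compact_Int_closedin)
  moreover have "?B \<inter> \<Inter>(insert ?S {?N v w | v w. \<not> r v w \<and> \<not> r w v}) = barycentric r P" (is "?L = _")
  proof (intro equalityI subsetI)
    fix t assume t: "t \<in> ?L"
    then have tB: "t v \<in> (if v \<in> P then {0..1} else {0})" for v
      by (auto simp: PiE_iff)
    then have "0 \<le> t v" "v \<notin> P \<Longrightarrow> t v = 0" for v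
      by (smt (verit) atLeastAtMost_iff singletonD)+
    moreover have "t v * t w = 0" if "\<not> r v w" "\<not> r w v" for v w
      using t that by auto
    ultimately show "t \<in> barycentric r P"
      using t unfolding barycentric_def by auto
  next
    fix t assume t: "t \<in> barycentric r P"
    then show "t \<in> ?L"
      using barycentricD [OF t] barycentric_le_1 [OF assms t] by auto
  qed
  ultimately show ?thesis
    using assms by (simp add: realization_eq compact_space_subtopology)
qed

lemma barycentric_mono:
  assumes "finite P" "S \<subseteq> P" "t \<in> barycentric r S"
  shows "t \<in> barycentric r P"
proof -
  have "sum t P = sum t S"
    using assms by (intro sum.mono_neutral_right) (auto dest: barycentricD)
  then show ?thesis
    using assms by (auto simp: barycentric_def)
qed

lemma barycentric_restrict:
  assumes "finite P" "S \<subseteq> P" "t \<in> barycentric r P" "\<And>v. v \<in> P - S \<Longrightarrow> t v = 0"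
  shows "t \<in> barycentric r S"
proof -
  have "sum t P = sum t S"
    using assms by (intro sum.mono_neutral_right) auto
  then show ?thesis
    using assms by (auto simp: barycentric_def)
qed

lemma point_mass_barycentric:
  assumes "finite P" "v \<in> P" "r v v"
  shows "point_mass v \<in> barycentric r P"
  using assms by (auto simp: barycentric_def)

definition mix :: "real \<Rightarrow> ('a \<Rightarrow> real) \<Rightarrow> ('a \<Rightarrow> real) \<Rightarrow> 'a \<Rightarrow> real" where
  "mix s t u = (\<lambda>v. (1 - s) * t v + s * u v)"

lemma mix_0 [simp]: "mix 0 t u = t" and mix_1 [simp]: "mix 1 t u = u"
  by (simp_all add: mix_def)

lemma mix_barycentric:
  assumes t: "t \<in> barycentric r P" and u: "u \<in> barycentric r P" and s: "0 \<le> s" "s \<le> 1"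
    and comp: "\<And>v w. t v \<noteq> 0 \<Longrightarrow> u w \<noteq> 0 \<Longrightarrow> r v w \<or> r w v"
  shows "mix s t u \<in> barycentric r P"
proof -
  have "sum (mix s t u) P = 1"
    using t u by (simp add: mix_def sum.distrib sum_distrib_left [symmetric] barycentricD(4))
  moreover have "r v w \<or> r w v" if "mix s t u v \<noteq> 0" "mix s t u w \<noteq> 0" for v w
  proof -
    have "t v \<noteq> 0 \<or> u v \<noteq> 0" "t w \<noteq> 0 \<or> u w \<noteq> 0"
      using that by (auto simp: mix_def)
    then show ?thesis
      using comp [of v w] comp [of w v] barycentricD(3) [OF t, of v w] barycentricD(3) [OF u, of v w]
      by blast
  qed
  ultimately show ?thesis
    using t u s by (auto simp: barycentric_def mix_def)
qed

lemma continuous_map_mix: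
  assumes "continuous_map X euclideanreal s" "continuous_map X euclideanreal (\<lambda>x. t x v)"
    "continuous_map X euclideanreal (\<lambda>x. u x v)"
  shows "continuous_map X euclideanreal (\<lambda>x. mix (s x) (t x) (u x) v)"
  unfolding mix_def by (intro continuous_intros assms) simp

text \<open>The straight-line homotopy to the vertex \<open>u\<close> stays in the complex, since
  adding \<open>u\<close> to a chain gives a chain.\<close>

lemma cone_contractible:
  assumes P: "finite P" and u: "u \<in> P" and cone: "\<And>x. x \<in> P \<Longrightarrow> r x u \<or> r u x"
  shows "contractible_space (realization r P)"
proof -
  let ?h = "\<lambda>(s, t). mix s t (point_mass u)"
  have pm: "point_mass u \<in> barycentric r P"
    using assms point_mass_barycentric by fast
  have mx: "mix s t (point_mass u) \<in> barycentric r P" if "t \<in> barycentric r P" "0 \<le> s" "s \<le> 1" for s t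
    using that cone barycentricD(2) [OF that(1)] by (intro mix_barycentric pm) (auto split: if_splits)
  have "continuous_map (prod_topology (top_of_set {0..1}) (realization r P)) (realization r P) ?h"
    unfolding continuous_map_into_realization [OF P] case_prod_beta
  proof (intro conjI allI continuous_map_mix)
    show "continuous_map (prod_topology (top_of_set {0..1}) (realization r P)) euclideanreal fst"
      by (rule continuous_map_into_fulltopology [OF continuous_map_fst])
    show "continuous_map (prod_topology (top_of_set {0..1}) (realization r P)) euclideanreal (\<lambda>x. snd x v)" for v
      using continuous_map_compose [OF continuous_map_snd continuous_map_coordinate [OF P]] by (simp add: o_def)
  qed (use P mx in auto)
  then show ?thesis
    unfolding contractible_space_def by (subst homotopic_with) (auto intro!: exI [of _ ?h])
qed

subsection \<open>Collapsing the complement of an antichain\<close>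

text \<open>A model of the quotient by the subcomplex without vertices in \<open>A\<close>. All
  coordinates vanish on that subcomplex, and outside of it some diagonal coordinate, the square of
  \<open>t y\<close>, does not. The factor \<open>t y\<close> makes the other coordinates tend to 0
  near the subcomplex.\<close>

definition collapse :: "'a set \<Rightarrow> ('a \<Rightarrow> real) \<Rightarrow> 'a \<times> 'a \<Rightarrow> real" where
  "collapse A t = (\<lambda>(y, x). if y \<in> A then t y * t x else 0)"

definition collapsed_realization ::
  "('a \<Rightarrow> 'a \<Rightarrow> bool) \<Rightarrow> 'a set \<Rightarrow> 'a set \<Rightarrow> ('a \<times> 'a \<Rightarrow> real) topology" where
  "collapsed_realization r P A = subtopology (powertop_real UNIV) (collapse A ` barycentric r P)"

lemma topspace_collapsed_realization [simp]:
  "topspace (collapsed_realization r P A) = collapse A ` barycentric r P"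
  by (simp add: collapsed_realization_def)

lemma Hausdorff_space_collapsed_realization: "Hausdorff_space (collapsed_realization r P A)"
  by (simp add: collapsed_realization_def Hausdorff_space_powertop_real Hausdorff_space_subtopology)

lemma continuous_map_into_collapsed_realization:
  "continuous_map X (collapsed_realization r P A) f \<longleftrightarrow>
     (\<forall>v. continuous_map X euclideanreal (\<lambda>x. f x v)) \<and> (\<forall>x\<in>topspace X. f x \<in> collapse A ` barycentric r P)"
  by (auto simp: collapsed_realization_def continuous_map_in_subtopology continuous_map_componentwise_UNIV)

lemma continuous_map_collapse:
  assumes "finite P"
  shows "continuous_map (realization r P) (collapsed_realization r P A) (collapse A)"
  unfolding continuous_map_into_collapsed_realization collapse_def case_prod_beta
  using assms by (auto intro!: continuous_intros)

lemma collapse_eq_0: "\<forall>y\<in>A. t y = 0 \<Longrightarrow> collapse A t = (\<lambda>_. 0)"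
  by (auto simp: collapse_def)

text \<open>The coordinate at \<open>(y, y)\<close> is the square of \<open>t y\<close>, which
  determines \<open>t y\<close> by nonnegativity; dividing by it recovers all other
  coordinates.\<close>

lemma collapse_inject:
  assumes eq: "collapse A t = collapse A u" and nonneg: "\<And>v. 0 \<le> t v" "\<And>v. 0 \<le> u v"
    and y: "y \<in> A" "t y \<noteq> 0"
  shows "t = u"
proof -
  have *: "t y * t x = u y * u x" for x
    using fun_cong [OF eq, of "(y, x)"] y by (simp add: collapse_def)
  have "t y = u y"
    using *[of y] nonneg by (metis abs_of_nonneg real_sqrt_abs2)
  then show ?thesis
    using * y by auto
qed

lemma collapse_eq_cases:
  assumes "collapse A t = collapse A u" "\<And>v. 0 \<le> t v" "\<And>v. 0 \<le> u v"
  shows "t = u \<or> (\<forall>y\<in>A. t y = 0) \<and> (\<forall>y\<in>A. u y = 0)"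
  using collapse_inject [OF assms] collapse_inject [OF assms(1) [symmetric] assms(3,2)] by metis

lemma continuous_map_fst_real:
  "continuous_map (prod_topology (top_of_set S) X) euclideanreal fst"
  by (rule continuous_map_into_fulltopology [OF continuous_map_fst])

lemma continuous_map_snd_coordinate:
  "finite P \<Longrightarrow> continuous_map (prod_topology X (realization r P)) euclideanreal (\<lambda>x. snd x v)"
  using continuous_map_compose [OF continuous_map_snd continuous_map_coordinate] by (force simp: o_def)

text \<open>
  The homotopy stretches the stars of the vertices in \<open>A\<close> and fills the gap around them by the
  contraction of the subcomplex without these vertices.
\<close>

theorem realization_homotopy_equivalent_collapsed:
  assumes P: "finite P" and A: "A \<subseteq> P" and anti: "\<And>y z. y \<in> A \<Longrightarrow> z \<in> A \<Longrightarrow> r y z \<Longrightarrow> y = z"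
    and contr: "contractible_space (realization r (P - A))"
  shows "realization r P homotopy_equivalent_space collapsed_realization r P A"
proof -
  let ?I = "top_of_set {0..1::real}"
  let ?Q = "P - A"
  have fQ: "finite ?Q" and fA: "finite A"
    using P A finite_subset by auto
  obtain K p where K: "continuous_map (prod_topology ?I (realization r ?Q)) (realization r ?Q) K"
    and K0: "\<And>t. t \<in> barycentric r ?Q \<Longrightarrow> K (0, t) = t"
    and K1: "\<And>t. t \<in> barycentric r ?Q \<Longrightarrow> K (1, t) = p"
    using contr unfolding contractible_space_def by (subst (asm) homotopic_with) (auto simp: fQ)
  have KQ: "K (\<tau>, t) \<in> barycentric r ?Q" if "\<tau> \<in> {0..1}" "t \<in> barycentric r ?Q" for \<tau> t
    using continuous_map_image_subset_topspace [OF K] that fQ by auto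
  \<comment> \<open>The weight taken away from \<open>A\<close> up to time \<open>\<tau>\<close>. A
    chain contains at most one element of \<open>A\<close>, so the cap \<open>\<tau>/2\<close> gives
    \<open>a \<le> 1/2\<close>, and the denominator \<open>1 - a\<close> in \<open>N\<close> stays
    positive.\<close>
  define a where "a = (\<lambda>(\<tau>, t). \<Sum>y\<in>A. min (t y) (\<tau>/2) :: real)"
  define s where "s = (\<lambda>t. \<Sum>y\<in>A. t y :: real)"
  define N where "N = (\<lambda>(\<tau>, t) v. (t v - (if v \<in> A then min (t v) (\<tau>/2) else 0)) / (1 - a (\<tau>, t)))"
  \<comment> \<open>Where \<open>N\<close> has lost all weight on \<open>A\<close>, that is for
    \<open>s t \<le> \<tau>/2\<close>, it lies in the subcomplex and the contraction
    \<open>K\<close> applies. The time \<open>\<tau> - 2 * s t\<close> is 0 on the border, so that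
    the two cases fit together, and \<open>\<tau>\<close> on the subcomplex itself, so that
    \<open>H\<close> ends there in the constant \<open>p\<close>.\<close>
  define H where "H = (\<lambda>p. if s (snd p) \<le> fst p / 2 then K (max 0 (fst p - 2 * s (snd p)), N p) else N p)"
  have supp: "\<exists>y. \<forall>z\<in>A. z \<noteq> y \<longrightarrow> t z = 0" if "t \<in> barycentric r P" for t
    using barycentricD(3) [OF that] anti by metis
  have a_half: "0 \<le> a (\<tau>, t)" "a (\<tau>, t) \<le> 1/2" if "t \<in> barycentric r P" "\<tau> \<in> {0..1}" for \<tau> t
  proof -
    from supp [OF that(1)] obtain y where y: "\<forall>z\<in>A. z \<noteq> y \<longrightarrow> t z = 0"
      by blast
    have "min (t z) (\<tau>/2) = (if z = y then min (t y) (\<tau>/2) else 0)" if "z \<in> A" for z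
      using y that \<open>\<tau> \<in> {0..1}\<close> by auto
    then have "a (\<tau>, t) = (\<Sum>z\<in>A. if z = y then min (t y) (\<tau>/2) else 0)"
      unfolding a_def by simp
    then have "a (\<tau>, t) = (if y \<in> A then min (t y) (\<tau>/2) else 0)"
      using fA by simp
    then show "0 \<le> a (\<tau>, t)" "a (\<tau>, t) \<le> 1/2"
      using that barycentricD(1) [OF that(1), of y] by auto
  qed
  have NP: "N (\<tau>, t) \<in> barycentric r P" if t: "t \<in> barycentric r P" and \<tau>: "\<tau> \<in> {0..1}" for \<tau> t
  proof -
    have pos: "1 - a (\<tau>, t) > 0"
      using a_half [OF that] by linarith
    have "0 \<le> N (\<tau>, t) v" for v
      using pos barycentricD(1) [OF t, of v] by (auto simp: N_def)
    moreover have z: "t v = 0 \<Longrightarrow> N (\<tau>, t) v = 0" for v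
      using \<tau> by (auto simp: N_def)
    moreover have "sum (N (\<tau>, t)) P = 1"
    proof -
      have "(\<Sum>v\<in>P. if v \<in> A then min (t v) (\<tau>/2) else 0) = a (\<tau>, t)"
        using A P by (simp add: a_def sum.If_cases Int_absorb1)
      then have "(\<Sum>v\<in>P. t v - (if v \<in> A then min (t v) (\<tau>/2) else 0)) = 1 - a (\<tau>, t)"
        using barycentricD(4) [OF t] by (simp add: sum_subtractf)
      then show ?thesis
        unfolding N_def using pos by (simp add: sum_divide_distrib [symmetric])
    qed
    ultimately show ?thesis
      unfolding barycentric_def using barycentricD(2,3) [OF t] by blast
  qed
  have NQ: "N (\<tau>, t) \<in> barycentric r ?Q"
    if t: "t \<in> barycentric r P" and \<tau>: "\<tau> \<in> {0..1}" and le: "s t \<le> \<tau> / 2" for \<tau> t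
  proof (rule barycentric_restrict [OF P _ NP [OF t \<tau>]])
    fix v assume "v \<in> P - ?Q"
    then have v: "v \<in> A"
      by blast
    then have "t v \<le> s t"
      unfolding s_def using fA barycentricD(1) [OF t] by (intro member_le_sum) auto
    then show "N (\<tau>, t) v = 0"
      using v le by (simp add: N_def)
  qed auto
  have s0: "0 \<le> s t" if "t \<in> barycentric r P" for t
    unfolding s_def using barycentricD(1) [OF that] by (simp add: sum_nonneg)
  have HQ: "H (\<tau>, t) = K (\<tau>, t)" "t \<in> barycentric r ?Q"
    if t: "t \<in> barycentric r P" and \<tau>: "\<tau> \<in> {0..1}" and A0: "\<forall>y\<in>A. t y = 0" for \<tau> t
  proof -
    have "s t = 0" "a (\<tau>, t) = 0"
      using A0 \<tau> by (auto simp: s_def a_def)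
    moreover from this have "N (\<tau>, t) = t"
      using A0 \<tau> by (auto simp: N_def)
    ultimately show "H (\<tau>, t) = K (\<tau>, t)"
      using \<tau> by (simp add: H_def)
    show "t \<in> barycentric r ?Q"
      by (rule barycentric_restrict [OF P _ t]) (use A0 in auto)
  qed
  let ?X = "prod_topology ?I (realization r P)"
  have cs: "continuous_map ?X euclideanreal (\<lambda>p. s (snd p))"
    unfolding s_def by (intro continuous_map_sum continuous_map_snd_coordinate P fA)
  have cN: "continuous_map ?X (realization r P) N"
    unfolding continuous_map_into_realization [OF P]
  proof (intro conjI allI)
    have c: "continuous_map ?X euclideanreal (\<lambda>p. min (snd p y) (fst p / 2))" for y
      by (intro continuous_intros continuous_map_snd_coordinate P continuous_map_fst_real) auto
    fix v
    have "continuous_map ?X euclideanreal (\<lambda>p. (snd p v - (if v \<in> A then min (snd p v) (fst p / 2) else 0)) / (1 - (\<Sum>y\<in>A. min (snd p y) (fst p / 2))))"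
    proof (intro continuous_map_real_divide)
      show "continuous_map ?X euclideanreal (\<lambda>p. snd p v - (if v \<in> A then min (snd p v) (fst p / 2) else 0))"
        using c by (cases "v \<in> A") (auto intro!: continuous_map_diff continuous_map_snd_coordinate P)
      show "continuous_map ?X euclideanreal (\<lambda>p. 1 - (\<Sum>y\<in>A. min (snd p y) (fst p / 2)))"
        using c by (intro continuous_map_diff continuous_map_sum fA) auto
      show "1 - (\<Sum>y\<in>A. min (snd p y) (fst p / 2)) \<noteq> 0" if "p \<in> topspace ?X" for p
        using a_half [of "snd p" "fst p"] that P by (auto simp: a_def)
    qed
    then show "continuous_map ?X euclideanreal (\<lambda>p. N p v)"
      by (simp add: N_def a_def case_prod_beta)
  qed (use NP P in auto)
  have cH: "continuous_map ?X (realization r P) H"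
    unfolding H_def
  proof (rule continuous_map_cases_le [OF cs])
    show "continuous_map ?X euclideanreal (\<lambda>p. fst p / 2)"
      by (intro continuous_intros continuous_map_fst_real) auto
    let ?Y = "subtopology ?X {p \<in> topspace ?X. s (snd p) \<le> fst p / 2}"
    have "continuous_map ?Y (realization r ?Q) (K \<circ> (\<lambda>p. (max 0 (fst p - 2 * s (snd p)), N p)))"
    proof (rule continuous_map_compose [OF _ K])
      show "continuous_map ?Y (prod_topology ?I (realization r ?Q)) (\<lambda>p. (max 0 (fst p - 2 * s (snd p)), N p))"
        unfolding continuous_map_paired
      proof
        have "continuous_map ?X euclideanreal (\<lambda>p. max 0 (fst p - 2 * s (snd p)))"
          by (intro continuous_intros continuous_map_fst_real cs) auto
        then show "continuous_map ?Y ?I (\<lambda>p. max 0 (fst p - 2 * s (snd p)))"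
          using s0 P by (fastforce simp: continuous_map_in_subtopology intro: continuous_map_from_subtopology)
        show "continuous_map ?Y (realization r ?Q) N"
          unfolding continuous_map_into_realization [OF fQ]
          using cN NQ P by (auto simp: continuous_map_into_realization intro: continuous_map_from_subtopology)
      qed
    qed
    then have *: "continuous_map ?Y (realization r ?Q) (\<lambda>p. K (max 0 (fst p - 2 * s (snd p)), N p))"
      by (simp add: o_def)
    then show "continuous_map ?Y (realization r P) (\<lambda>p. K (max 0 (fst p - 2 * s (snd p)), N p))"
      unfolding continuous_map_into_realization [OF fQ] continuous_map_into_realization [OF P]
      using barycentric_mono [OF P, of ?Q] by blast
    show "continuous_map (subtopology ?X {p \<in> topspace ?X. fst p / 2 \<le> s (snd p)}) (realization r P) N"
      by (rule continuous_map_from_subtopology [OF cN])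
    show "K (max 0 (fst p - 2 * s (snd p)), N p) = N p" if "p \<in> topspace ?X" "s (snd p) = fst p / 2" for p
      using that NQ [of "snd p" "fst p"] P K0 by auto
  qed
  show ?thesis
  proof (rule quotient_homotopy_equivalent [where q = "collapse A"])
    show "continuous_map (realization r P) (collapsed_realization r P A) (collapse A)"
      by (rule continuous_map_collapse [OF P])
    show "compact_space (realization r P)" "Hausdorff_space (collapsed_realization r P A)"
      by (rule compact_space_realization [OF P] Hausdorff_space_collapsed_realization)+
    show "continuous_map ?X (realization r P) H" by fact
    show "H (0, t) = t" if "t \<in> topspace (realization r P)" for t
    proof -
      have t: "t \<in> barycentric r P"
        using that P by simp
      show ?thesis
      proof (cases "s t \<le> 0")
        case True
        then have "s t = 0"
          using s0 [OF t] by simp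
        then have "\<forall>y\<in>A. t y = 0"
          unfolding s_def using fA barycentricD(1) [OF t] by (simp add: sum_nonneg_eq_0_iff)
        then show ?thesis
          using HQ [OF t, of 0] K0 by simp
      next
        case False
        have "\<And>v. min (t v) 0 = 0"
          using barycentricD(1) [OF t] by (simp add: min_absorb2)
        then show ?thesis
          using False by (auto simp: H_def N_def a_def)
      qed
    qed
    fix t u assume "t \<in> topspace (realization r P)" "u \<in> topspace (realization r P)"
      and eq: "collapse A t = collapse A u"
    then have t: "t \<in> barycentric r P" and u: "u \<in> barycentric r P"
      using P by auto
    consider "t = u" | "\<forall>y\<in>A. t y = 0" "\<forall>y\<in>A. u y = 0"
      using collapse_eq_cases [OF eq] barycentricD(1) [OF t] barycentricD(1) [OF u] by blast
    note cases = this
    show "H (1, t) = H (1, u)"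
      by (cases rule: cases) (use HQ [OF t, of 1] HQ [OF u, of 1] K1 in auto)
    show "collapse A (H (\<tau>, t)) = collapse A (H (\<tau>, u))" if "\<tau> \<in> {0..1}" for \<tau>
    proof (cases rule: cases)
      case 2
      then have "H (\<tau>, t) \<in> barycentric r ?Q" "H (\<tau>, u) \<in> barycentric r ?Q"
        using HQ [OF t that] HQ [OF u that] KQ [OF that] by auto
      then show ?thesis
        by (simp add: collapse_eq_0 barycentricD(2))
    qed simp
  qed (use P in simp)
qed

subsection \<open>Links\<close>

definition link :: "('a \<Rightarrow> 'a \<Rightarrow> bool) \<Rightarrow> 'a set \<Rightarrow> 'a \<Rightarrow> 'a set" where
  "link r P x = {z \<in> P. z \<noteq> x \<and> (r z x \<or> r x z)}"

lemma link_subset: "link r P x \<subseteq> P - {x}"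
  by (auto simp: link_def)

lemma finite_link: "finite P \<Longrightarrow> finite (link r P x)"
  by (simp add: link_def)

lemma mix_link_barycentric:
  assumes P: "finite P" "x \<in> P" "r x x" and l: "l \<in> barycentric r (link r P x)" and s: "0 \<le> s" "s \<le> 1"
  shows "mix s l (point_mass x) \<in> barycentric r P"
proof (rule mix_barycentric [OF _ _ s])
  show "l \<in> barycentric r P"
    using barycentric_mono [OF P(1) _ l] link_subset by fast
  show "point_mass x \<in> barycentric r P"
    using P by (intro point_mass_barycentric)
  show "r v w \<or> r w v" if "l v \<noteq> 0" "point_mass x w \<noteq> 0" for v w
    using that barycentricD(2) [OF l, of v] by (auto simp: link_def split: if_splits)
qed

lemma barycentric_1_eq_point_mass:
  assumes P: "finite P" and t: "t \<in> barycentric r P" and x: "t x = 1"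
  shows "t = point_mass x"
proof
  fix v
  have "x \<in> P"
    using barycentricD(2) [OF t] x by force
  then have "sum t (P - {x}) = 0"
    using barycentricD(4) [OF t] P x by (simp add: sum_diff1)
  then have "\<forall>v\<in>P - {x}. t v = 0"
    using P barycentricD(1) [OF t] by (subst (asm) sum_nonneg_eq_0_iff) auto
  then show "t v = point_mass x v"
    using x barycentricD(2) [OF t] by auto
qed

text \<open>Radial projection from the vertex \<open>x\<close>: the other coordinates are rescaled
  by \<open>1 / (1 - t x)\<close>.\<close>

lemma barycentric_decompose:
  assumes P: "finite P" and t: "t \<in> barycentric r P" and x: "0 < t x" "t x < 1"
  obtains l where "l \<in> barycentric r (link r P x)" "t = mix (t x) l (point_mass x)"
proof -
  define l where "l = (\<lambda>v. if v = x then 0 else t v / (1 - t x))"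
  have xP: "x \<in> P"
    using barycentricD(2) [OF t] x by force
  have "sum l P = sum l (P - {x})"
    using P xP by (simp add: sum.remove l_def)
  also have "\<dots> = (\<Sum>v\<in>P - {x}. t v / (1 - t x))"
    by (simp add: l_def)
  also have "\<dots> = (\<Sum>v\<in>P - {x}. t v) / (1 - t x)"
    by (simp add: sum_divide_distrib)
  also have "\<dots> = 1"
    using barycentricD(4) [OF t] P xP x by (simp add: sum_diff1)
  finally have "l \<in> barycentric r P"
    using barycentricD [OF t] x by (auto simp: barycentric_def l_def)
  then have "l \<in> barycentric r (link r P x)"
    using barycentricD(3) [OF t, of x] x
    by (rule_tac barycentric_restrict [OF P, rotated]) (auto simp: link_def l_def)
  moreover have "t = mix (t x) l (point_mass x)"
    using x by (auto simp: mix_def l_def)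
  ultimately show thesis
    by (rule that)
qed

text \<open>Collapsing the contractible complex without \<open>x\<close> leaves the cone over the
  link with its base pinched to a point. A contraction of the link yields one of this space. The
  homotopies are written on the cylinder \<open>Y\<close> over the link and descend along
  \<open>q\<close>.\<close>

lemma contractible_delete_vertex:
  assumes P: "finite P" and refl: "\<And>v. v \<in> P \<Longrightarrow> r v v" and x: "x \<in> P"
    and del: "contractible_space (realization r (P - {x}))"
    and ne: "link r P x \<noteq> {}" and lk: "contractible_space (realization r (link r P x))"
  shows "contractible_space (realization r P)"
proof -
  let ?I = "top_of_set {0..1::real}"
  let ?L = "link r P x"
  let ?V = "collapsed_realization r P {x}"
  let ?m = "\<lambda>s l. mix s l (point_mass x)"
  define Y where "Y = prod_topology ?I (realization r ?L)"
  define q where "q = (\<lambda>(s, l). collapse {x} (?m s l))"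
  have fL: "finite ?L"
    by (rule finite_link [OF P])
  obtain v0 where v0: "v0 \<in> ?L"
    using ne by blast
  \<comment> \<open>Some point of the link is needed at the two ends: \<open>q (0, l)\<close> is the
    collapsed point and \<open>q (1, l)\<close> is the image of the vertex \<open>x\<close>,
    whatever \<open>l\<close> is.\<close>
  define l0 :: "'a \<Rightarrow> real" where "l0 = point_mass v0"
  have l0: "l0 \<in> barycentric r ?L"
    unfolding l0_def using v0 link_subset by (intro point_mass_barycentric fL refl) fast+
  obtain J c where J: "continuous_map (prod_topology ?I (realization r ?L)) (realization r ?L) J"
    and J0: "\<And>t. t \<in> barycentric r ?L \<Longrightarrow> J (0, t) = t"
    and J1: "\<And>t. t \<in> barycentric r ?L \<Longrightarrow> J (1, t) = c"
    using lk unfolding contractible_space_def by (subst (asm) homotopic_with) (auto simp: fL)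
  have JL: "J (\<tau>, t) \<in> barycentric r ?L" if "\<tau> \<in> {0..1}" "t \<in> barycentric r ?L" for \<tau> t
    using continuous_map_image_subset_topspace [OF J] that fL by auto
  then have cL: "c \<in> barycentric r ?L"
    using J1 [OF l0] l0 by force
  have topY: "topspace Y = {0..1} \<times> barycentric r ?L"
    using fL by (simp add: Y_def)
  have lx: "l x = 0" if "l \<in> barycentric r ?L" for l
    using barycentricD(2) [OF that, of x] by (simp add: link_def)
  have mP: "?m s l \<in> barycentric r P" if "s \<in> {0..1}" "l \<in> barycentric r ?L" for s l
    using that by (intro mix_link_barycentric P x refl) auto
  have mix_cont: "continuous_map X ?V (\<lambda>p. collapse {x} (?m (s p) (l p)))"
    if s: "continuous_map X ?I s" and l: "continuous_map X (realization r ?L) l"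
    for X :: "'x topology" and s l
  proof -
    have "continuous_map X (realization r P) (\<lambda>p. ?m (s p) (l p))"
      unfolding continuous_map_into_realization [OF P]
    proof (intro conjI allI ballI continuous_map_mix)
      show "continuous_map X euclideanreal s"
        using s by (simp add: continuous_map_in_subtopology)
      show "continuous_map X euclideanreal (\<lambda>p. l p v)" for v
        using l by (simp add: continuous_map_into_realization [OF fL])
      show "?m (s p) (l p) \<in> barycentric r P" if "p \<in> topspace X" for p
        using continuous_map_image_subset_topspace [OF s] continuous_map_image_subset_topspace [OF l] that fL
        by (intro mP) auto
    qed simp
    then show ?thesis
      using continuous_map_compose [OF _ continuous_map_collapse [OF P, of r "{x}"]] by (simp add: o_def)
  qed
  have cq: "continuous_map Y ?V q"
    unfolding q_def case_prod_beta Y_def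
    by (intro mix_cont continuous_map_fst continuous_map_snd)
  have compY: "compact_space Y"
    unfolding Y_def
    by (simp add: compact_space_prod_topology compact_space_subtopology compact_space_realization [OF fL])
  have qY: "q ` topspace Y = topspace ?V"
  proof (intro equalityI subsetI)
    show "u \<in> topspace ?V" if "u \<in> q ` topspace Y" for u
      using that mP by (auto simp: q_def topY)
    fix u assume "u \<in> topspace ?V"
    then obtain t where t: "t \<in> barycentric r P" "u = collapse {x} t"
      by auto
    consider "t x = 0" | "t x = 1" | "0 < t x" "t x < 1"
      using barycentricD(1) [OF t(1), of x] barycentric_le_1 [OF P t(1), of x] by linarith
    then show "u \<in> q ` topspace Y"
    proof cases
      case 1
      then have "u = q (0, l0)"
        using lx [OF l0] t(2) by (simp add: q_def collapse_eq_0)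
      then show ?thesis
        using l0 by (auto simp: topY)
    next
      case 2
      then have "u = q (1, l0)"
        using barycentric_1_eq_point_mass [OF P t(1)] t(2) by (simp add: q_def)
      then show ?thesis
        using l0 by (auto simp: topY)
    next
      case 3
      then obtain l where "l \<in> barycentric r ?L" "t = ?m (t x) l"
        using barycentric_decompose [OF P t(1)] by blast
      then show ?thesis
        using 3 t(2) by (intro image_eqI [of _ _ "(t x, l)"]) (auto simp: q_def topY)
    qed
  qed
  have q_coord: "collapse {x} (?m s l) (x, v) = s * ((1 - s) * l v + s * point_mass x v)"
    if "l \<in> barycentric r ?L" for s l v
    using lx [OF that] by (simp add: collapse_def mix_def)
  have q_eq: "s = s' \<and> (s = 0 \<or> s = 1 \<or> l = l')"
    if eq: "q (s, l) = q (s', l')" and p: "(s, l) \<in> topspace Y" "(s', l') \<in> topspace Y" for s l s' l'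
  proof -
    have *: "s * ((1 - s) * l v + s * point_mass x v) = s' * ((1 - s') * l' v + s' * point_mass x v)" for v
      using fun_cong [OF eq, of "(x, v)"] q_coord p by (simp add: q_def topY)
    \<comment> \<open>At the vertex \<open>x\<close> itself both sides are the squares of the
      heights.\<close>
    from *[of x] have "s\<^sup>2 = s'\<^sup>2"
      using p by (simp add: topY lx power2_eq_square)
    then have "s = s'"
      by (rule power2_eq_imp_eq) (use p in \<open>auto simp: topY\<close>)
    moreover have "l v = l' v" if "0 < s" "s < 1" for v
      using *[of v] \<open>s = s'\<close> that p by (cases "v = x") (auto simp: topY lx)
    ultimately show ?thesis
      using p by (force simp: topY)
  qed
  have V: "Hausdorff_space ?V"
    by (rule Hausdorff_space_collapsed_realization)
  have sndY: "continuous_map (prod_topology ?I Y) (realization r ?L) (\<lambda>p. snd (snd p))"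
    and fstY: "continuous_map (prod_topology ?I Y) ?I (\<lambda>p. fst (snd p))"
    unfolding Y_def
    using continuous_map_compose [OF continuous_map_snd continuous_map_snd]
      continuous_map_compose [OF continuous_map_snd continuous_map_fst] by (auto simp: o_def)
  \<comment> \<open>\<open>h1\<close> contracts the link at each height, which leaves the segment
    over \<open>c\<close>; afterwards \<open>h2\<close> lowers the height to 0.\<close>
  define h1 where "h1 = (\<lambda>p. collapse {x} (?m (fst (snd p)) (J (fst p, snd (snd p)))))"
  have "continuous_map (prod_topology ?I Y) (realization r ?L) (J \<circ> (\<lambda>p. (fst p, snd (snd p))))"
    by (rule continuous_map_compose [OF _ J]) (simp add: continuous_map_paired sndY continuous_map_fst)
  then have "continuous_map (prod_topology ?I Y) ?V h1"
    unfolding h1_def by (intro mix_cont fstY) (simp add: o_def)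
  then obtain k1 where k1: "continuous_map (prod_topology ?I ?V) ?V k1"
    and k1q: "\<And>\<tau> a. \<tau> \<in> {0..1} \<Longrightarrow> a \<in> topspace Y \<Longrightarrow> k1 (\<tau>, q a) = h1 (\<tau>, a)"
  proof (rule homotopy_descends [OF cq qY compY V])
    fix \<tau> :: real and a b assume "\<tau> \<in> {0..1}" "a \<in> topspace Y" "b \<in> topspace Y" "q a = q b"
    then show "h1 (\<tau>, a) = h1 (\<tau>, b)"
      using q_eq [of "fst a" "snd a" "fst b" "snd b"] lx JL [of \<tau>]
      by (cases a; cases b) (auto simp: h1_def collapse_eq_0 topY)
  qed auto
  define h2 where "h2 = (\<lambda>p :: real \<times> real \<times> ('a \<Rightarrow> real). collapse {x} (?m ((1 - fst p) * fst (snd p)) c))"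
  have "continuous_map (prod_topology ?I Y) ?V h2"
    unfolding h2_def
  proof (intro mix_cont)
    have "continuous_map (prod_topology ?I Y) euclideanreal (\<lambda>p. (1 - fst p) * fst (snd p))"
      by (intro continuous_map_real_mult continuous_map_diff continuous_map_into_fulltopology [OF fstY]
          continuous_map_into_fulltopology [OF continuous_map_fst]) simp
    then show "continuous_map (prod_topology ?I Y) ?I (\<lambda>p. (1 - fst p) * fst (snd p))"
      by (auto simp: continuous_map_in_subtopology topY mult_le_one)
  qed (use cL fL in simp)
  then obtain k2 where k2: "continuous_map (prod_topology ?I ?V) ?V k2"
    and k2q: "\<And>\<tau> a. \<tau> \<in> {0..1} \<Longrightarrow> a \<in> topspace Y \<Longrightarrow> k2 (\<tau>, q a) = h2 (\<tau>, a)"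
  proof (rule homotopy_descends [OF cq qY compY V])
    fix \<tau> :: real and a b assume "\<tau> \<in> {0..1}" "a \<in> topspace Y" "b \<in> topspace Y" "q a = q b"
    then show "h2 (\<tau>, a) = h2 (\<tau>, b)"
      using q_eq [of "fst a" "snd a" "fst b" "snd b"] by (cases a; cases b) (auto simp: h2_def)
  qed auto
  let ?g = "\<lambda>v. k1 (1, v)"
  have "homotopic_with (\<lambda>_. True) ?V ?V id ?g"
  proof (subst homotopic_with, simp, intro exI conjI ballI)
    show "k1 (0, v) = id v" if "v \<in> topspace ?V" for v
      using that k1q [of 0] J0 unfolding qY [symmetric] by (auto simp: h1_def topY q_def)
  qed (use k1 in auto)
  moreover have "homotopic_with (\<lambda>_. True) ?V ?V ?g (\<lambda>_. collapse {x} c)"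
  proof (subst homotopic_with, simp, intro exI conjI ballI)
    show "k2 (0, v) = ?g v" "k2 (1, v) = collapse {x} c" if "v \<in> topspace ?V" for v
      using that k1q [of 1] k2q [of 0] k2q [of 1] J1 unfolding qY [symmetric]
      by (auto simp: h1_def h2_def topY)
  qed (use k2 in auto)
  ultimately have "contractible_space ?V"
    unfolding contractible_space_def using homotopic_with_trans by blast
  moreover have "realization r P homotopy_equivalent_space ?V"
    by (rule realization_homotopy_equivalent_collapsed [OF P]) (use x del in auto)
  ultimately show ?thesis
    by (simp add: homotopy_equivalent_space_contractibility)
qed

section \<open>Contractible posets by removal of vertices\<close>

locale finite_poset =
  fixes r :: "'a \<Rightarrow> 'a \<Rightarrow> bool" and P :: "'a set"
  assumes finite: "finite P"
    and refl: "x \<in> P \<Longrightarrow> r x x"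
    and antisym: "x \<in> P \<Longrightarrow> y \<in> P \<Longrightarrow> r x y \<Longrightarrow> r y x \<Longrightarrow> x = y"
    and trans: "x \<in> P \<Longrightarrow> y \<in> P \<Longrightarrow> z \<in> P \<Longrightarrow> r x y \<Longrightarrow> r y z \<Longrightarrow> r x z"

lemma finite_poset_subset:
  assumes "finite_poset r P" "S \<subseteq> P"
  shows "finite_poset r S"
proof -
  interpret finite_poset r P by fact
  show ?thesis
  proof
    show "finite S"
      using assms(2) finite by (rule finite_subset)
    show "x \<in> S \<Longrightarrow> r x x" for x
      using assms(2) refl by auto
    show "x \<in> S \<Longrightarrow> y \<in> S \<Longrightarrow> r x y \<Longrightarrow> r y x \<Longrightarrow> x = y" for x y
      using assms(2) antisym by auto
    show "x \<in> S \<Longrightarrow> y \<in> S \<Longrightarrow> z \<in> S \<Longrightarrow> r x y \<Longrightarrow> r y z \<Longrightarrow> r x z" for x y z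
      using assms(2) trans [of x y z] by auto
  qed
qed

context finite_poset
begin

lemma ex_minimal:
  assumes "S \<subseteq> P" "S \<noteq> {}"
  shows "\<exists>x\<in>S. \<forall>w\<in>S. r w x \<longrightarrow> w = x"
proof -
  have "asymp_on S (\<lambda>v w. r v w \<and> v \<noteq> w)" "transp_on S (\<lambda>v w. r v w \<and> v \<noteq> w)"
    unfolding asymp_on_def transp_on_def
    using assms(1) antisym trans by (metis subsetD)+
  then show ?thesis
    using Finite_Set.bex_min_element [of S "\<lambda>v w. r v w \<and> v \<noteq> w"] assms finite_subset [OF _ finite] by metis
qed

lemma ex_maximal:
  assumes "S \<subseteq> P" "S \<noteq> {}"
  shows "\<exists>x\<in>S. \<forall>w\<in>S. r x w \<longrightarrow> w = x"
proof -
  have "asymp_on S (\<lambda>v w. r v w \<and> v \<noteq> w)" "transp_on S (\<lambda>v w. r v w \<and> v \<noteq> w)"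
    unfolding asymp_on_def transp_on_def
    using assms(1) antisym trans by (metis subsetD)+
  then show ?thesis
    using Finite_Set.bex_max_element [of S "\<lambda>v w. r v w \<and> v \<noteq> w"] assms finite_subset [OF _ finite] by metis
qed

end

text \<open>
  Vertices that do not lie below \<open>u\<close> are removed one by one, minimal ones first: then the link of
  the removed vertex is a cone whose apex is the meet with \<open>u\<close>.
\<close>

lemma contractible_if_meets:
  assumes "finite_poset r R" "u \<in> R"
    and "\<And>z. z \<in> R \<Longrightarrow> \<exists>m\<in>R. r m z \<and> r m u \<and> (\<forall>w\<in>R. r w z \<and> r w u \<longrightarrow> r w m)"
  shows "contractible_space (realization r R)"
  using assms
proof (induction "card {z \<in> R. \<not> r z u}" arbitrary: R rule: less_induct)
  case less
  interpret finite_poset r R by fact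
  show ?case
  proof (cases "{z \<in> R. \<not> r z u} = {}")
    case True
    then show ?thesis
      by (intro cone_contractible [OF finite \<open>u \<in> R\<close>]) auto
  next
    case False
    then obtain z where z: "z \<in> R" "\<not> r z u"
      and min: "\<And>w. w \<in> R \<Longrightarrow> \<not> r w u \<Longrightarrow> r w z \<Longrightarrow> w = z"
      using ex_minimal [of "{z \<in> R. \<not> r z u}"] by auto
    obtain m where m: "m \<in> R" "r m z" "r m u" "\<And>w. w \<in> R \<Longrightarrow> r w z \<Longrightarrow> r w u \<Longrightarrow> r w m"
      using less.prems(3) [OF z(1)] by blast
    have m_link: "m \<in> link r R z"
      using m z by (auto simp: link_def)
    have "contractible_space (realization r (link r R z))"
    proof (rule cone_contractible [OF finite_link [OF finite] m_link])
      \<comment> \<open>By minimality of \<open>z\<close>, what lies strictly below \<open>z\<close>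
        lies below \<open>u\<close> and hence below \<open>m\<close>; what lies above
        \<open>z\<close> lies above \<open>m\<close>.\<close>
      show "r w m \<or> r m w" if "w \<in> link r R z" for w
        using that m z min [of w] trans [of m z w] by (auto simp: link_def)
    qed
    moreover have "contractible_space (realization r (R - {z}))"
    proof (rule less.hyps)
      have "{w \<in> R - {z}. \<not> r w u} \<subset> {w \<in> R. \<not> r w u}"
        using z by auto
      then show "card {w \<in> R - {z}. \<not> r w u} < card {w \<in> R. \<not> r w u}"
        by (intro psubset_card_mono) (simp_all add: finite)
      show "finite_poset r (R - {z})"
        by (rule finite_poset_subset [OF less.prems(1)]) auto
      show "u \<in> R - {z}"
        using z less.prems(2) refl by auto
      \<comment> \<open>The old meets survive: they lie below \<open>u\<close>, while the removed
        \<open>z\<close> does not.\<close>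
      show "\<exists>m\<in>R - {z}. r m z' \<and> r m u \<and> (\<forall>w\<in>R - {z}. r w z' \<and> r w u \<longrightarrow> r w m)" if "z' \<in> R - {z}" for z'
        using less.prems(3) [of z'] that z by blast
    qed
    ultimately show ?thesis
      using m_link by (intro contractible_delete_vertex [OF finite refl z(1)]) auto
  qed
qed

text \<open>\<open>P\<close> is meant as a lattice without its top and bottom. A common lower bound
  inside \<open>P\<close> then says that the meet is not the bottom, and dually for the
  join.\<close>

definition complements :: "('a \<Rightarrow> 'a \<Rightarrow> bool) \<Rightarrow> 'a set \<Rightarrow> 'a \<Rightarrow> 'a set" where
  "complements r P x =
     {y \<in> P. \<not> (\<exists>w\<in>P. r w y \<and> r w x) \<and> \<not> (\<exists>w\<in>P. r y w \<and> r x w)}"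

text \<open>\<open>A\<close> consists of the elements with nontrivial meet with \<open>p\<close> and
  contracts to \<open>p\<close> by taking meets. The remaining non-complements \<open>B\<close> have
  a proper upper bound \<open>u\<close> in common with \<open>p\<close>. They are attached to
  \<open>A\<close> one by one, and the link of each contracts to its \<open>u\<close>.\<close>

theorem contractible_without_complements:
  assumes "finite_poset r P" and p: "p \<in> P"
    and meets: "\<And>x y w. x \<in> P \<Longrightarrow> y \<in> P \<Longrightarrow> w \<in> P \<Longrightarrow> r w x \<Longrightarrow> r w y \<Longrightarrow>
                  \<exists>m\<in>P. r m x \<and> r m y \<and> (\<forall>w\<in>P. r w x \<and> r w y \<longrightarrow> r w m)"
  shows "contractible_space (realization r (P - complements r P p))"
proof -
  interpret finite_poset r P by fact
  define A where "A = {x \<in> P. \<exists>w\<in>P. r w x \<and> r w p}"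
  define B where "B = {x \<in> P - A. \<exists>w\<in>P. r x w \<and> r p w}"
  have A: "contractible_space (realization r A)"
  proof (rule contractible_if_meets)
    show "finite_poset r A"
      by (rule finite_poset_subset [OF assms(1)]) (auto simp: A_def)
    show "p \<in> A"
      using p refl by (auto simp: A_def)
    show "\<exists>m\<in>A. r m z \<and> r m p \<and> (\<forall>w\<in>A. r w z \<and> r w p \<longrightarrow> r w m)" if "z \<in> A" for z
    proof -
      obtain w where "w \<in> P" "r w z" "r w p" "z \<in> P"
        using \<open>z \<in> A\<close> unfolding A_def by blast
      then obtain m where "m \<in> P" "r m z" "r m p" "\<forall>w\<in>P. r w z \<and> r w p \<longrightarrow> r w m"
        using meets [of z p w] p by blast
      then show ?thesis
        using refl [of m] unfolding A_def by blast
    qed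
  qed
  have "contractible_space (realization r (A \<union> T))" if "T \<subseteq> B" for T
    using that
  proof (induction "card T" arbitrary: T)
    case 0
    moreover have "finite T"
      using 0 by (intro finite_subset [OF _ finite]) (auto simp: B_def)
    ultimately have "T = {}"
      by simp
    then show ?case
      using A by simp
  next
    case (Suc n)
    have TP: "T \<subseteq> P"
      using Suc.prems by (auto simp: B_def)
    then have fT: "finite T"
      using finite by (rule finite_subset)
    have "T \<noteq> {}"
      using Suc.hyps(2) by auto
    \<comment> \<open>A maximal element is chosen so that everything above it in the link belongs to
      \<open>A\<close>.\<close>
    with TP obtain x where x: "x \<in> T" and max: "\<forall>w\<in>T. r x w \<longrightarrow> w = x"
      using ex_maximal by blast
    then have xP: "x \<in> P" and xA: "x \<notin> A"
      using Suc.prems by (auto simp: B_def)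
    obtain u where u: "u \<in> P" "r x u" "r p u"
      using x Suc.prems unfolding B_def by blast
    have R: "finite_poset r (A \<union> T)"
      using finite_poset_subset [OF assms(1)] TP by (auto simp: A_def)
    have uA: "u \<in> A"
      using u p refl by (auto simp: A_def)
    have "contractible_space (realization r (link r (A \<union> T) x))"
    proof (rule contractible_if_meets [where u = u])
      show "finite_poset r (link r (A \<union> T) x)"
        using link_subset by (intro finite_poset_subset [OF R]) fast
      show u_link: "u \<in> link r (A \<union> T) x"
        using u uA xA by (auto simp: link_def)
      fix z assume z: "z \<in> link r (A \<union> T) x"
      then have zP: "z \<in> P" and "z \<noteq> x" and "r z x \<or> r x z"
        using TP by (auto simp: link_def A_def)
      from this(3) show "\<exists>m\<in>link r (A \<union> T) x. r m z \<and> r m u \<and>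
          (\<forall>w\<in>link r (A \<union> T) x. r w z \<and> r w u \<longrightarrow> r w m)"
      proof
        assume "r z x"
        then have "r z u"
          using trans [of z x u] zP xP u by simp
        then show ?thesis
          using z refl [OF zP] by blast
      next
        assume xz: "r x z"
        then have "z \<in> A"
          using z max \<open>z \<noteq> x\<close> by (auto simp: link_def)
        then obtain w where w: "w \<in> P" "r w z" "r w p"
          unfolding A_def by blast
        obtain m where m: "m \<in> P" "r m z" "r m u" "\<forall>w\<in>P. r w z \<and> r w u \<longrightarrow> r w m"
          using meets [of z u x] zP u xP xz by blast
        \<comment> \<open>The meet of \<open>z\<close> and \<open>u\<close> stays in
          \<open>A\<close>: as \<open>p\<close> lies below \<open>u\<close>, it lies above the
          common lower bound \<open>w\<close> of \<open>z\<close> and \<open>p\<close>.\<close>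
        have "r w u"
          using trans [of w p u] w u p by simp
        then have "m \<in> A"
          using m w unfolding A_def by blast
        moreover have "r x m"
          using m(4) xP xz u by blast
        ultimately have "m \<in> link r (A \<union> T) x"
          using xA by (auto simp: link_def)
        moreover have "link r (A \<union> T) x \<subseteq> P"
          using TP by (auto simp: link_def A_def)
        ultimately show ?thesis
          using m by blast
      qed
    qed
    moreover have "contractible_space (realization r ((A \<union> T) - {x}))"
    proof -
      have "contractible_space (realization r (A \<union> (T - {x})))"
        using Suc.hyps(2) Suc.prems fT x by (intro Suc.hyps(1)) auto
      moreover have "A \<union> (T - {x}) = (A \<union> T) - {x}"
        using xA by auto
      ultimately show ?thesis
        by simp
    qed
    moreover have "u \<in> link r (A \<union> T) x"
      using u uA xA by (auto simp: link_def)
    ultimately show ?case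
      using x R [THEN finite_poset.finite] R [THEN finite_poset.refl]
      by (intro contractible_delete_vertex [of "A \<union> T" r x]) auto
  qed
  moreover have "P - complements r P p = A \<union> B"
    by (auto simp: complements_def A_def B_def)
  ultimately show ?thesis
    by simp
qed

subsection \<open>Induced spaces\<close>

text \<open>Both spaces are quotients of one compact product, and \<open>fibres\<close> says that
  they make the same identifications. It also shows that \<open>induced_class\<close> yields the
  classes of an equivalence relation.\<close>

lemma induced_space_homeomorphic:
  assumes finK: "finite (carrier K)" and X: "compact_space X" and Z: "Hausdorff_space Z"
    and cont: "\<And>k. k \<in> carrier K \<Longrightarrow> continuous_map X Z (\<lambda>x. \<Theta> (k, x))"
    and surj: "\<Theta> ` (carrier K \<times> topspace X) = topspace Z"
    and fibres: "\<And>k x k' x'. k \<in> carrier K \<Longrightarrow> k' \<in> carrier K \<Longrightarrow> x \<in> topspace X \<Longrightarrow> x' \<in> topspace X \<Longrightarrow>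
       \<Theta> (k, x) = \<Theta> (k', x') \<longleftrightarrow>
         (\<exists>h\<in>carrier H. k = k' \<otimes>\<^bsub>K\<^esub> \<iota> h \<and> x' = act h x) \<or> (x \<in> B \<and> x' \<in> B)"
  shows "induced_space K H \<iota> act B X homeomorphic_space Z"
proof -
  let ?Y = "prod_topology (discrete_topology (carrier K)) X"
  have class_eq: "induced_class K H \<iota> act B X p = {p' \<in> carrier K \<times> topspace X. \<Theta> p = \<Theta> p'}"
    if "p \<in> carrier K \<times> topspace X" for p
    using that fibres unfolding induced_class_def by (cases p) auto
  show ?thesis
    unfolding induced_space_def
  proof (rule quotient_maps_homeomorphic [OF quotient_map_quotient_topology _ _ _ Z])
    show "continuous_map ?Y Z \<Theta>"
      using cont by (rule continuous_map_discrete_prod)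
    show "\<Theta> ` topspace ?Y = topspace Z"
      using surj by simp
    show "compact_space ?Y"
      using finK X by (simp add: compact_space_prod_topology compact_space_discrete_topology)
    show "induced_class K H \<iota> act B X a = induced_class K H \<iota> act B X b \<longleftrightarrow> \<Theta> a = \<Theta> b"
      if "a \<in> topspace ?Y" "b \<in> topspace ?Y" for a b
      using that class_eq [of a] class_eq [of b] by auto
  qed
qed

section \<open>Links as joins of two intervals\<close>

text \<open>The simplicial map induced by the map \<open>f\<close> of vertices, in barycentric
  coordinates. As a finite sum it is continuous in \<open>t\<close>, and it mentions no inverse of
  \<open>f\<close>.\<close>

definition push :: "('b \<Rightarrow> 'a) \<Rightarrow> 'b set \<Rightarrow> ('b \<Rightarrow> real) \<Rightarrow> 'a \<Rightarrow> real" where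
  "push f S t = (\<lambda>v. \<Sum>x\<in>S. if f x = v then t x else 0)"

lemma push_apply:
  assumes "finite S" "inj_on f S" "x \<in> S"
  shows "push f S t (f x) = t x"
proof -
  have "push f S t (f x) = (\<Sum>z\<in>S. if z = x then t z else 0)"
    unfolding push_def using assms by (intro sum.cong) (auto dest: inj_onD)
  then show ?thesis
    using assms by simp
qed

lemma push_eq_0: "v \<notin> f ` S \<Longrightarrow> push f S t v = 0"
  unfolding push_def by (intro sum.neutral) auto

lemma push_barycentric:
  assumes S: "finite S" "inj_on f S" and mono: "\<And>x y. x \<in> S \<Longrightarrow> y \<in> S \<Longrightarrow> rd x y \<Longrightarrow> r (f x) (f y)"
    and t: "t \<in> barycentric rd S"
  shows "push f S t \<in> barycentric r (f ` S)"
proof -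
  have "sum (push f S t) (f ` S) = sum t S"
    using S by (simp add: sum.reindex push_apply)
  moreover have "r v w \<or> r w v" if nz: "push f S t v \<noteq> 0" "push f S t w \<noteq> 0" for v w
  proof -
    obtain x y where "x \<in> S" "v = f x" "y \<in> S" "w = f y"
      using nz push_eq_0 [of v f S t] push_eq_0 [of w f S t] by blast
    then show ?thesis
      using nz mono [of x y] mono [of y x] barycentricD(3) [OF t, of x y] S by (auto simp: push_apply)
  qed
  moreover have "0 \<le> push f S t v" for v
    unfolding push_def using barycentricD(1) [OF t] by (auto intro: sum_nonneg)
  ultimately show ?thesis
    using barycentricD(4) [OF t] push_eq_0 [of _ f S t] by (auto simp: barycentric_def)
qed

lemma continuous_map_push:
  assumes "finite S"
  shows "continuous_map (realization rd S) euclideanreal (\<lambda>t. push f S t v)"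
  unfolding push_def
proof (intro continuous_map_sum assms)
  show "continuous_map (realization rd S) euclideanreal (\<lambda>t. if f x = v then t x else 0)" for x
    using assms by (cases "f x = v") (auto intro: continuous_map_coordinate)
qed

text \<open>
  \<open>up k\<close> and \<open>dn k\<close> parametrize the open intervals above and below \<open>y k\<close>. The vertex \<open>y k\<close> need not
  belong to \<open>P\<close>: it is the top or the bottom element of the lattice if \<open>d = 1\<close> or \<open>m = 1\<close>.
\<close>

locale interval_system = finite_poset r P'
  for r :: "'a \<Rightarrow> 'a \<Rightarrow> bool" and P' :: "'a set" +
  fixes P :: "'a set" and rd :: "'b \<Rightarrow> 'b \<Rightarrow> bool" and D :: "'b set"
    and rm :: "'c \<Rightarrow> 'c \<Rightarrow> bool" and M :: "'c set"
    and K :: "('k, 'e) monoid_scheme" and H :: "('h, 'f) monoid_scheme" and \<iota> :: "'h \<Rightarrow> 'k"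
    and up :: "'k \<Rightarrow> 'b \<Rightarrow> 'a" and dn :: "'k \<Rightarrow> 'c \<Rightarrow> 'a" and y :: "'k \<Rightarrow> 'a"
    and \<alpha> :: "'h \<Rightarrow> ('b \<Rightarrow> real) \<Rightarrow> 'b \<Rightarrow> real"
  assumes PP': "P \<subseteq> P'" and finite_D: "finite D" and finite_M: "finite M" and finite_K: "finite (carrier K)"
    and y_in: "k \<in> carrier K \<Longrightarrow> y k \<in> P'"
    and up_bij: "k \<in> carrier K \<Longrightarrow> bij_betw (up k) D {x \<in> P. x \<noteq> y k \<and> r (y k) x}"
    and dn_bij: "k \<in> carrier K \<Longrightarrow> bij_betw (dn k) M {x \<in> P. x \<noteq> y k \<and> r x (y k)}"
    and up_iff: "k \<in> carrier K \<Longrightarrow> a \<in> D \<Longrightarrow> a' \<in> D \<Longrightarrow> r (up k a) (up k a') \<longleftrightarrow> rd a a'"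
    and dn_iff: "k \<in> carrier K \<Longrightarrow> b \<in> M \<Longrightarrow> b' \<in> M \<Longrightarrow> r (dn k b) (dn k b') \<longleftrightarrow> rm b b'"
    and y_coset: "k \<in> carrier K \<Longrightarrow> k' \<in> carrier K \<Longrightarrow> y k = y k' \<Longrightarrow> \<exists>h\<in>carrier H. k = k' \<otimes>\<^bsub>K\<^esub> \<iota> h"
    and y_shift: "k \<in> carrier K \<Longrightarrow> h \<in> carrier H \<Longrightarrow> y (k \<otimes>\<^bsub>K\<^esub> \<iota> h) = y k"
    and up_shift: "k \<in> carrier K \<Longrightarrow> h \<in> carrier H \<Longrightarrow> t \<in> barycentric rd D \<Longrightarrow>
       push (up (k \<otimes>\<^bsub>K\<^esub> \<iota> h)) D t = push (up k) D (\<alpha> h t)"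
    and dn_shift: "k \<in> carrier K \<Longrightarrow> h \<in> carrier H \<Longrightarrow> b \<in> M \<Longrightarrow> dn (k \<otimes>\<^bsub>K\<^esub> \<iota> h) b = dn k b"
    and act_closed: "h \<in> carrier H \<Longrightarrow> t \<in> barycentric rd D \<Longrightarrow> \<alpha> h t \<in> barycentric rd D"
begin

lemma finite_P: "finite P"
  using PP' finite by (rule finite_subset)

abbreviation J :: "('b \<Rightarrow> real, 'c \<Rightarrow> real) join_pt topology" where
  "J \<equiv> join_space (realization rd D) (realization rm M)"

lemma topspace_J: "topspace J = join_points (barycentric rd D) (barycentric rm M)"
  by (simp add: topspace_join_space finite_D finite_M)

text \<open>Every element below \<open>y k\<close> lies below every element above it, so a chain in
  the link is a chain above \<open>y k\<close> together with one below. This makes the link the join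
  of the two intervals, with the upper one at parameter 0.\<close>

definition join_link :: "'k \<Rightarrow> ('b \<Rightarrow> real, 'c \<Rightarrow> real) join_pt \<Rightarrow> 'a \<Rightarrow> real" where
  "join_link k p = (case p of
     Join_Left a \<Rightarrow> push (up k) D a
   | Join_Mid a t b \<Rightarrow> mix t (push (up k) D a) (push (dn k) M b)
   | Join_Right b \<Rightarrow> push (dn k) M b)"

lemma join_link_segment:
  "join_link k (join_segment (a, t, b)) = mix t (push (up k) D a) (push (dn k) M b)"
  by (simp add: join_link_def join_segment_def)

context
  fixes k assumes k: "k \<in> carrier K"
begin

lemma inj_up: "inj_on (up k) D" and inj_dn: "inj_on (dn k) M"
  using up_bij [OF k] dn_bij [OF k] by (simp_all add: bij_betw_def)

lemma up_image: "up k ` D = {x \<in> P. x \<noteq> y k \<and> r (y k) x}"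
  and dn_image: "dn k ` M = {x \<in> P. x \<noteq> y k \<and> r x (y k)}"
  using up_bij [OF k] dn_bij [OF k] by (simp_all add: bij_betw_def)

lemma link_y: "link r P (y k) = up k ` D \<union> dn k ` M"
  unfolding up_image dn_image by (auto simp: link_def)

lemma finite_link_y: "finite (link r P (y k))"
  by (rule finite_link [OF finite_P])

lemma up_neq_dn: "a \<in> D \<Longrightarrow> b \<in> M \<Longrightarrow> up k a \<noteq> dn k b"
  using up_image dn_image antisym [OF _ y_in [OF k]] PP' by blast

lemma dn_less_up: "a \<in> D \<Longrightarrow> b \<in> M \<Longrightarrow> r (dn k b) (up k a)"
  using up_image dn_image trans [OF _ y_in [OF k]] PP' by blast

lemma push_up_link: "t \<in> barycentric rd D \<Longrightarrow> push (up k) D t \<in> barycentric r (link r P (y k))"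
  using push_barycentric [of D "up k" rd r] up_iff [OF k] inj_up finite_D
  by (intro barycentric_mono [OF finite_link_y, where S = "up k ` D"]) (auto simp: link_y)

lemma push_dn_link: "t \<in> barycentric rm M \<Longrightarrow> push (dn k) M t \<in> barycentric r (link r P (y k))"
  using push_barycentric [of M "dn k" rm r] dn_iff [OF k] inj_dn finite_M
  by (intro barycentric_mono [OF finite_link_y, where S = "dn k ` M"]) (auto simp: link_y)

lemma mix_push_link:
  assumes "a \<in> barycentric rd D" "b \<in> barycentric rm M" "0 \<le> t" "t \<le> 1"
  shows "mix t (push (up k) D a) (push (dn k) M b) \<in> barycentric r (link r P (y k))"
proof (rule mix_barycentric [OF push_up_link push_dn_link])
  show "r v w \<or> r w v" if "push (up k) D a v \<noteq> 0" "push (dn k) M b w \<noteq> 0" for v w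
    using that push_eq_0 [of v "up k" D a] push_eq_0 [of w "dn k" M b] dn_less_up by blast
qed (use assms in auto)

lemma join_link_in: "p \<in> topspace J \<Longrightarrow> join_link k p \<in> barycentric r (link r P (y k))"
  unfolding topspace_J
  by (erule join_points_cases) (auto simp: join_link_def intro: push_up_link push_dn_link mix_push_link)

lemma continuous_map_join_link: "continuous_map J (realization r (link r P (y k))) (join_link k)"
  unfolding continuous_map_into_realization [OF finite_link_y]
proof (intro conjI allI ballI join_link_in)
  fix v
  let ?S = "prod_topology (realization rd D) (prod_topology (top_of_set {0..1::real}) (realization rm M))"
  have a: "continuous_map ?S euclideanreal (\<lambda>p. push (up k) D (fst p) v)"
    using continuous_map_compose [OF continuous_map_fst continuous_map_push [OF finite_D]] by (simp add: o_def)
  have b: "continuous_map ?S euclideanreal (\<lambda>p. push (dn k) M (snd (snd p)) v)"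
    using continuous_map_compose [OF continuous_map_compose [OF continuous_map_snd continuous_map_snd] continuous_map_push [OF finite_M]]
    by (simp add: o_def)
  have t: "continuous_map ?S euclideanreal (\<lambda>p. fst (snd p))"
    using continuous_map_compose [OF continuous_map_snd continuous_map_fst_real] by (simp add: o_def)
  show "continuous_map J euclideanreal (\<lambda>p. join_link k p v)"
  proof (rule continuous_map_join_space)
    show "continuous_map (realization rd D) euclideanreal (\<lambda>a. join_link k (Join_Left a) v)"
      "continuous_map (realization rm M) euclideanreal (\<lambda>b. join_link k (Join_Right b) v)"
      by (simp_all add: join_link_def continuous_map_push finite_D finite_M)
    have "(\<lambda>p. join_link k (join_segment p) v)
        = (\<lambda>p. mix (fst (snd p)) (push (up k) D (fst p)) (push (dn k) M (snd (snd p))) v)"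
      using join_link_segment by (metis prod.collapse)
    then show "continuous_map ?S euclideanreal (\<lambda>p. join_link k (join_segment p) v)"
      using continuous_map_mix [where t = "\<lambda>p. push (up k) D (fst p)" and u = "\<lambda>p. push (dn k) M (snd (snd p))", OF t a b]
      by simp
  qed
qed

lemma push_up_up: "a \<in> D \<Longrightarrow> push (up k) D t (up k a) = t a"
  and push_dn_dn: "b \<in> M \<Longrightarrow> push (dn k) M u (dn k b) = u b"
  and push_up_dn: "b \<in> M \<Longrightarrow> push (up k) D t (dn k b) = 0"
  and push_dn_up: "a \<in> D \<Longrightarrow> push (dn k) M u (up k a) = 0"
  using push_apply [OF finite_D inj_up] push_apply [OF finite_M inj_dn] up_neq_dn
  by (auto intro!: push_eq_0) metis

lemma join_link_up: "a \<in> D \<Longrightarrow> join_link k p (up k a) =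
    (case p of Join_Left t \<Rightarrow> t a | Join_Mid t s u \<Rightarrow> (1 - s) * t a | Join_Right u \<Rightarrow> 0)"
  and join_link_dn: "b \<in> M \<Longrightarrow> join_link k p (dn k b) =
    (case p of Join_Left t \<Rightarrow> 0 | Join_Mid t s u \<Rightarrow> s * u b | Join_Right u \<Rightarrow> u b)"
  by (auto simp: join_link_def mix_def push_up_up push_dn_dn push_up_dn push_dn_up split: join_pt.split)

text \<open>The total weight \<open>U\<close> on the upper interval is 1 minus the join parameter.
  It tells the three kinds of points apart and then allows the coordinates in both factors to be
  recovered.\<close>

lemma inj_join_link: "inj_on (join_link k) (topspace J)"
proof (rule inj_onI)
  fix p q assume p: "p \<in> topspace J" and q: "q \<in> topspace J" and eq: "join_link k p = join_link k q"
  define U where "U = (\<lambda>p. \<Sum>a\<in>D. join_link k p (up k a))"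
  have U: "U p = (case p of Join_Left t \<Rightarrow> 1 | Join_Mid t s u \<Rightarrow> 1 - s | Join_Right u \<Rightarrow> 0)"
    if "p \<in> topspace J" for p
    using that unfolding topspace_J U_def
    by (cases rule: join_points_cases) (simp_all add: join_link_up sum_distrib_left [symmetric] barycentricD(4))
  have Ueq: "U p = U q"
    by (simp add: U_def eq)
  have up_eq: "join_link k p (up k a) = join_link k q (up k a)"
    and dn_eq: "join_link k p (dn k b) = join_link k q (dn k b)" for a b
    using eq by simp_all
  have extD: "t = t'" if "t \<in> barycentric rd D" "t' \<in> barycentric rd D" "\<And>a. a \<in> D \<Longrightarrow> t a = t' a" for t t'
    using that barycentricD(2) by (metis ext)
  have extM: "t = t'" if "t \<in> barycentric rm M" "t' \<in> barycentric rm M" "\<And>a. a \<in> M \<Longrightarrow> t a = t' a" for t t'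
    using that barycentricD(2) by (metis ext)
  have U': "U p = (case q of Join_Left t \<Rightarrow> 1 | Join_Mid t s u \<Rightarrow> 1 - s | Join_Right u \<Rightarrow> 0)"
    using U [OF q] Ueq by simp
  from p [unfolded topspace_J] show "p = q"
  proof (cases rule: join_points_cases)
    case (left t)
    with U [OF p] U' q obtain t' where t': "q = Join_Left t'" "t' \<in> barycentric rd D"
      unfolding topspace_J by (elim join_points_cases) auto
    have "t a = t' a" if "a \<in> D" for a
      using up_eq [of a] that t' left by (simp add: join_link_up)
    then show ?thesis
      using extD t' left by auto
  next
    case (right t)
    with U [OF p] U' q obtain t' where t': "q = Join_Right t'" "t' \<in> barycentric rm M"
      unfolding topspace_J by (elim join_points_cases) auto
    have "t a = t' a" if "a \<in> M" for a
      using dn_eq [of a] that t' right by (simp add: join_link_dn)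
    then show ?thesis
      using extM t' right by auto
  next
    case (mid t s u)
    with U [OF p] U' q obtain t' u' where t': "q = Join_Mid t' s u'" "t' \<in> barycentric rd D" "u' \<in> barycentric rm M"
      unfolding topspace_J by (elim join_points_cases) auto
    have "t a = t' a" if "a \<in> D" for a
      using up_eq [of a] that t' mid by (simp add: join_link_up)
    moreover have "u a = u' a" if "a \<in> M" for a
      using dn_eq [of a] that t' mid by (simp add: join_link_dn)
    ultimately show ?thesis
      using extD extM t' mid by auto
  qed
qed

lemma join_link_surj: "join_link k ` topspace J = barycentric r (link r P (y k))"
proof (intro equalityI subsetI)
  show "t \<in> barycentric r (link r P (y k))" if "t \<in> join_link k ` topspace J" for t
    using that join_link_in by auto
  fix t assume t: "t \<in> barycentric r (link r P (y k))"
  \<comment> \<open>The weight \<open>\<beta>\<close> on the lower interval becomes the join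
    parameter; \<open>T\<close> and \<open>U\<close> become points of the two factors after division
    by \<open>1 - \<beta>\<close> and \<open>\<beta>\<close>.\<close>
  define \<beta> where "\<beta> = (\<Sum>b\<in>M. t (dn k b))"
  define T U where "T = (\<lambda>a. if a \<in> D then t (up k a) else 0)" and "U = (\<lambda>b. if b \<in> M then t (dn k b) else 0)"
  have nonneg: "0 \<le> t v" for v
    by (rule barycentricD(1) [OF t])
  have "sum t (up k ` D \<union> dn k ` M) = sum t (up k ` D) + sum t (dn k ` M)"
    using up_neq_dn by (intro sum.union_disjoint) (auto simp: finite_D finite_M)
  then have sumT: "sum T D = 1 - \<beta>"
    using barycentricD(4) [OF t] inj_up inj_dn by (simp add: link_y sum.reindex T_def \<beta>_def)
  have sumU: "sum U M = \<beta>"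
    by (simp add: U_def \<beta>_def)
  have \<beta>: "0 \<le> \<beta>" "\<beta> \<le> 1"
    using sumT sum_nonneg [of D T] nonneg by (auto simp: \<beta>_def T_def intro: sum_nonneg)
  have cmpT: "rd a a' \<or> rd a' a" if "a \<in> D" "a' \<in> D" "t (up k a) \<noteq> 0" "t (up k a') \<noteq> 0" for a a'
    using barycentricD(3) [OF t that(3,4)] up_iff [OF k] that(1,2) by simp
  have cmpU: "rm b b' \<or> rm b' b" if "b \<in> M" "b' \<in> M" "t (dn k b) \<noteq> 0" "t (dn k b') \<noteq> 0" for b b'
    using barycentricD(3) [OF t that(3,4)] dn_iff [OF k] that(1,2) by simp
  have T_pos: "(\<lambda>a. T a / c) \<in> barycentric rd D" if "c = 1 - \<beta>" "c > 0" for c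
    using that sumT nonneg cmpT
    by (auto simp: barycentric_def sum_divide_distrib [symmetric] T_def split: if_splits)
  have U_pos: "(\<lambda>b. U b / c) \<in> barycentric rm M" if "c = \<beta>" "c > 0" for c
    using that sumU nonneg cmpU
    by (auto simp: barycentric_def sum_divide_distrib [symmetric] U_def split: if_splits)
  have t_eq: "t = (\<lambda>v. push (up k) D T v + push (dn k) M U v)"
  proof
    fix v
    consider a where "a \<in> D" "v = up k a" | b where "b \<in> M" "v = dn k b" | "v \<notin> link r P (y k)"
      unfolding link_y by blast
    then show "t v = push (up k) D T v + push (dn k) M U v"
    proof cases
      case 3
      then show ?thesis
        using barycentricD(2) [OF t] push_eq_0 [of v "up k" D T] push_eq_0 [of v "dn k" M U] by (simp add: link_y)
    qed (auto simp: push_up_up push_dn_dn push_up_dn push_dn_up T_def U_def)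
  qed
  have push_div: "push f S (\<lambda>a. V a / c) v = push f S V v / c" for f :: "'z \<Rightarrow> 'a" and S V c v
    unfolding push_def sum_divide_distrib by (intro sum.cong) auto
  have push_0: "push f S V v = 0" if "\<And>a. V a = 0" for f :: "'z \<Rightarrow> 'a" and S V v
    using that unfolding push_def by (intro sum.neutral) auto
  consider "\<beta> = 0" | "\<beta> = 1" | "0 < \<beta>" "\<beta> < 1"
    using \<beta> by linarith
  then show "t \<in> join_link k ` topspace J"
  proof cases
    case 1
    then have "U b = 0" for b
      using sumU sum_nonneg_eq_0_iff [of M U] nonneg finite_M by (auto simp: U_def)
    then have "t = join_link k (Join_Left T)"
      by (subst t_eq) (simp add: join_link_def push_0)
    then show ?thesis
      using T_pos [of 1] 1 by (auto simp: topspace_J)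
  next
    case 2
    then have "T a = 0" for a
      using sumT sum_nonneg_eq_0_iff [of D T] nonneg finite_D by (auto simp: T_def)
    then have "t = join_link k (Join_Right U)"
      by (subst t_eq) (simp add: join_link_def push_0)
    then show ?thesis
      using U_pos [of 1] 2 by (auto simp: topspace_J)
  next
    case 3
    then have "t = join_link k (Join_Mid (\<lambda>a. T a / (1 - \<beta>)) \<beta> (\<lambda>b. U b / \<beta>))"
      by (subst t_eq) (simp add: join_link_def mix_def push_div)
    then show ?thesis
      using T_pos [of "1 - \<beta>"] U_pos [of \<beta>] 3 by (auto simp: topspace_J)
  qed
qed

end

lemma push_dn_shift:
  assumes "k \<in> carrier K" "h \<in> carrier H"
  shows "push (dn (k \<otimes>\<^bsub>K\<^esub> \<iota> h)) M u = push (dn k) M u"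
  unfolding push_def using dn_shift [OF assms] by (intro ext sum.cong) auto

lemma join_link_shift:
  assumes "k \<in> carrier K" "h \<in> carrier H" "p \<in> topspace J"
  shows "join_link (k \<otimes>\<^bsub>K\<^esub> \<iota> h) p = join_link k (map_join_pt (\<alpha> h) id p)"
    and "map_join_pt (\<alpha> h) id p \<in> topspace J"
  using assms(3) push_dn_shift [OF assms(1,2)] up_shift [OF assms(1,2)] act_closed [OF assms(2)]
  unfolding topspace_J by (auto elim!: join_points_cases simp: join_link_def)

lemma compact_space_J: "compact_space J"
  by (intro compact_space_join_space compact_space_realization finite_D finite_M)

text \<open>As all \<open>y k\<close> agree, \<open>K\<close> is a single coset of the image of
  \<open>H\<close>, and each class has a representative over any chosen \<open>k\<close>. The join
  with the empty sphere is a copy of \<open>J\<close>, which parametrizes the link of that one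
  vertex.\<close>

theorem induced_space_trivial_suspension:
  assumes ne: "carrier K \<noteq> {}" and all: "\<And>k. k \<in> carrier K \<Longrightarrow> link r P (y k) = P"
    and same: "\<And>k k'. k \<in> carrier K \<Longrightarrow> k' \<in> carrier K \<Longrightarrow> y k = y k'"
  shows "induced_space K H \<iota> (\<lambda>h. map_join_pt id (map_join_pt (\<alpha> h) id)) {}
           (join_space (discrete_topology {} :: int topology) J) homeomorphic_space realization r P"
proof -
  let ?X = "join_space (discrete_topology {} :: int topology) J"
  define f where "f = (\<lambda>(k, p :: (int, ('b \<Rightarrow> real, 'c \<Rightarrow> real) join_pt) join_pt).
     case p of Join_Right l \<Rightarrow> join_link k l | _ \<Rightarrow> undefined)"
  have X: "topspace ?X = Join_Right ` topspace J"
    by (auto simp: topspace_join_space join_points_def)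
  show ?thesis
  proof (rule induced_space_homeomorphic [where \<Theta> = f, OF finite_K])
    show "compact_space ?X"
      by (intro compact_space_join_space compact_space_J) (simp add: compact_space_discrete_topology)
    show "Hausdorff_space (realization r P)"
      by (rule Hausdorff_space_realization [OF finite_P])
    show "continuous_map ?X (realization r P) (\<lambda>x. f (k, x))" if "k \<in> carrier K" for k
      using continuous_map_join_link [OF that] all [OF that]
      by (rule_tac continuous_map_join_space) (simp_all add: f_def)
    have "f ` (carrier K \<times> topspace ?X) = (\<Union>k\<in>carrier K. join_link k ` topspace J)"
      unfolding X by (force simp: f_def)
    also have "\<dots> = barycentric r P"
      using join_link_surj all ne by simp
    finally show "f ` (carrier K \<times> topspace ?X) = topspace (realization r P)"
      by (simp add: finite_P)
    fix k x k' x' assume k: "k \<in> carrier K" and k': "k' \<in> carrier K" and "x \<in> topspace ?X" "x' \<in> topspace ?X"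
    then obtain p p' where p: "x = Join_Right p" "x' = Join_Right p'" "p \<in> topspace J" "p' \<in> topspace J"
      unfolding X by auto
    have "join_link k p = join_link k' p' \<longleftrightarrow> (\<exists>h\<in>carrier H. k = k' \<otimes>\<^bsub>K\<^esub> \<iota> h \<and> p' = map_join_pt (\<alpha> h) id p)"
    proof
      assume eq: "join_link k p = join_link k' p'"
      obtain h where h: "h \<in> carrier H" "k = k' \<otimes>\<^bsub>K\<^esub> \<iota> h"
        using y_coset [OF k k'] same [OF k k'] by blast
      then have "join_link k' (map_join_pt (\<alpha> h) id p) = join_link k' p'"
        using join_link_shift [OF k' h(1) p(3)] eq by simp
      then have "map_join_pt (\<alpha> h) id p = p'"
        using inj_onD [OF inj_join_link [OF k']] join_link_shift(2) [OF k' h(1) p(3)] p(4) by blast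
      then show "\<exists>h\<in>carrier H. k = k' \<otimes>\<^bsub>K\<^esub> \<iota> h \<and> p' = map_join_pt (\<alpha> h) id p"
        using h by auto
    qed (use join_link_shift(1) [OF k' _ p(3)] in auto)
    then show "f (k, x) = f (k', x') \<longleftrightarrow> (\<exists>h\<in>carrier H. k = k' \<otimes>\<^bsub>K\<^esub> \<iota> h \<and>
        x' = map_join_pt id (map_join_pt (\<alpha> h) id) x) \<or> x \<in> {} \<and> x' \<in> {}"
      by (simp add: f_def p)
  qed
qed

text \<open>
  The cone point \<open>-1\<close> of the suspension becomes the vertex \<open>y k\<close>, and the cone point \<open>1\<close> becomes the
  point to which everything outside the open stars is collapsed. The height is the resulting
  coordinate at \<open>y k\<close>.
\<close>

definition height :: "int \<Rightarrow> real \<Rightarrow> real" where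
  "height e t = (1 - of_int e * (1 - t)) / 2"

definition susp_link :: "'k \<Rightarrow> (int, ('b \<Rightarrow> real, 'c \<Rightarrow> real) join_pt) join_pt \<Rightarrow> 'a \<Rightarrow> real" where
  "susp_link k p = (case p of
     Join_Left e \<Rightarrow> if e = 1 then (\<lambda>_. 0) else point_mass (y k)
   | Join_Mid e t l \<Rightarrow> mix (height e t) (join_link k l) (point_mass (y k))
   | Join_Right l \<Rightarrow> mix (1/2) (join_link k l) (point_mass (y k)))"

text \<open>A point of the collapsed complex other than the collapsed one comes from a point with
  positive coordinate at exactly one vertex \<open>y k\<close>. This fixes \<open>k\<close> up to
  the image of \<open>H\<close>. For a chosen \<open>k\<close> the map \<open>susp_link k\<close> is
  injective away from the base point, and a change of \<open>k\<close> is compensated by the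
  action.\<close>

theorem induced_space_suspension:
  assumes ne: "carrier K \<noteq> {}" and y_P: "y ` carrier K \<subset> P"
    and anti: "\<And>k k'. k \<in> carrier K \<Longrightarrow> k' \<in> carrier K \<Longrightarrow> r (y k) (y k') \<Longrightarrow> y k = y k'"
  shows "induced_space K H \<iota> (\<lambda>h. map_join_pt id (map_join_pt (\<alpha> h) id)) {Join_Left 1}
           (join_space sphere0 J) homeomorphic_space collapsed_realization r P (y ` carrier K)"
proof -
  let ?X = "join_space sphere0 J"
  let ?Co = "y ` carrier K"
  let ?act = "\<lambda>h. map_join_pt id (map_join_pt (\<alpha> h) id)"
  define f where "f = (\<lambda>(k, p). collapse ?Co (susp_link k p))"
  have X: "topspace ?X = join_points {-1, 1} (topspace J)"
    by (simp add: topspace_join_space sphere0_def)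
  have refl_P: "r v v" if "v \<in> P" for v
    using refl that PP' by blast
  have y_P': "y k \<in> P" if "k \<in> carrier K" for k
    using that y_P by auto
  have link_Co: "join_link k l v = 0" if "k \<in> carrier K" "l \<in> topspace J" "v \<in> ?Co" for k l v
    using barycentricD(2) [OF join_link_in [OF that(1,2)], of v] that anti by (fastforce simp: link_def)
  \<comment> \<open>The half over \<open>1\<close> covers the heights from 0 to 1/2 and the half
    over \<open>-1\<close> those from 1 down to 1/2. They meet at the equator, whence the constant
    in the case \<open>Join_Right\<close>.\<close>
  have height: "height 1 t = t / 2" "height (-1) t = 1 - t / 2" for t
    by (simp_all add: height_def field_simps)
  have apex: "susp_link k p (y k) = (case p of Join_Left e \<Rightarrow> if e = 1 then 0 else 1
      | Join_Mid e t l \<Rightarrow> height e t | Join_Right l \<Rightarrow> 1/2)"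
    if "k \<in> carrier K" "p \<in> topspace ?X" for k p
    using that unfolding X
    by (auto elim!: join_points_cases simp: susp_link_def mix_def link_Co)
  have apex_pos: "0 < susp_link k p (y k)" if "k \<in> carrier K" "p \<in> topspace ?X" "p \<noteq> Join_Left 1" for k p
    using that unfolding apex [OF that(1,2)] unfolding X by (auto elim!: join_points_cases simp: height)
  have mixP: "mix s (join_link k l) (point_mass (y k)) \<in> barycentric r P"
    if "k \<in> carrier K" "l \<in> topspace J" "0 \<le> s" "s \<le> 1" for k l s
    using that y_P' refl_P by (intro mix_link_barycentric finite_P join_link_in) auto
  have susp_in: "susp_link k p \<in> barycentric r P"
    if "k \<in> carrier K" "p \<in> topspace ?X" "p \<noteq> Join_Left 1" for k p
    using that y_P' refl_P unfolding X
    by (auto elim!: join_points_cases simp: susp_link_def height intro!: mixP point_mass_barycentric finite_P)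
  have nonneg: "0 \<le> susp_link k p v" if "k \<in> carrier K" "p \<in> topspace ?X" for k p v
    using barycentricD(1) [OF susp_in [OF that]] by (cases "p = Join_Left 1") (auto simp: susp_link_def)
  have base: "collapse ?Co (susp_link k (Join_Left 1)) = (\<lambda>_. 0)" for k
    by (simp add: susp_link_def collapse_eq_0)
  \<comment> \<open>The zero function is a value of \<open>collapse\<close> because some vertex of
    \<open>P\<close> lies outside the antichain.\<close>
  have base_in: "(\<lambda>_. 0) \<in> collapse ?Co ` barycentric r P"
  proof -
    obtain v where v: "v \<in> P" "v \<notin> ?Co"
      using y_P by blast
    then have "collapse ?Co (point_mass v) = (\<lambda>_. 0)"
      by (intro collapse_eq_0) auto
    then show ?thesis
      using point_mass_barycentric [of P v r] finite_P v refl_P by (metis imageI)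
  qed
  have inj: "p = p'" if k: "k \<in> carrier K" and p: "p \<in> topspace ?X" "p \<noteq> Join_Left 1"
    and p': "p' \<in> topspace ?X" "p' \<noteq> Join_Left 1" and eq: "susp_link k p = susp_link k p'" for k p p'
  proof -
    have l_eq: "l = l'" if "mix s (join_link k l) (point_mass (y k)) = mix s (join_link k l') (point_mass (y k))"
        "s < 1" "l \<in> topspace J" "l' \<in> topspace J" for s l l'
    proof -
      have "join_link k l v = join_link k l' v" for v
        using fun_cong [OF that(1), of v] that(2) by (simp add: mix_def)
      then show ?thesis
        using inj_onD [OF inj_join_link [OF k]] that(3,4) by blast
    qed
    show ?thesis
      using apex [OF k p(1)] apex [OF k p'(1)] eq p p' unfolding X
      by (elim join_points_cases) (auto simp: height susp_link_def intro: l_eq)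
  qed
  have shift: "susp_link (k \<otimes>\<^bsub>K\<^esub> \<iota> h) p = susp_link k (?act h p)"
    and act_in: "?act h p \<in> topspace ?X" "?act h p = Join_Left 1 \<longleftrightarrow> p = Join_Left 1"
    if "k \<in> carrier K" "h \<in> carrier H" "p \<in> topspace ?X" for k h p
    using that(3) join_link_shift [OF that(1,2)] y_shift [OF that(1,2)] unfolding X
    by (auto elim!: join_points_cases simp: susp_link_def)
  have fibres: "f (k, p) = f (k', p') \<longleftrightarrow> (\<exists>h\<in>carrier H. k = k' \<otimes>\<^bsub>K\<^esub> \<iota> h \<and> p' = ?act h p) \<or>
      p \<in> {Join_Left 1} \<and> p' \<in> {Join_Left 1}"
    if k: "k \<in> carrier K" and k': "k' \<in> carrier K" and p: "p \<in> topspace ?X" and p': "p' \<in> topspace ?X" for k k' p p'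
  proof
    assume "f (k, p) = f (k', p')"
    then have "susp_link k p = susp_link k' p' \<or>
        (\<forall>v\<in>?Co. susp_link k p v = 0) \<and> (\<forall>v\<in>?Co. susp_link k' p' v = 0)"
      using nonneg [OF k p] nonneg [OF k' p'] by (intro collapse_eq_cases) (auto simp: f_def)
    moreover have "p = Join_Left 1 \<longleftrightarrow> susp_link k p = (\<lambda>_. 0)"
      using apex_pos [OF k p] by (fastforce simp: susp_link_def)
    moreover have "p' = Join_Left 1 \<longleftrightarrow> susp_link k' p' = (\<lambda>_. 0)"
      using apex_pos [OF k' p'] by (fastforce simp: susp_link_def)
    ultimately consider "p = Join_Left 1" "p' = Join_Left 1"
      | "susp_link k p = susp_link k' p'" "p \<noteq> Join_Left 1" "p' \<noteq> Join_Left 1"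
      using apex_pos [OF k p] apex_pos [OF k' p'] k k' by force
    then show "(\<exists>h\<in>carrier H. k = k' \<otimes>\<^bsub>K\<^esub> \<iota> h \<and> p' = ?act h p) \<or> p \<in> {Join_Left 1} \<and> p' \<in> {Join_Left 1}"
    proof cases
      case 2
      have "r (y k) (y k') \<or> r (y k') (y k)"
        using apex_pos [OF k p 2(2)] apex_pos [OF k' p' 2(3)] 2(1)
        by (intro barycentricD(3) [OF susp_in [OF k p 2(2)]]) auto
      then have "y k = y k'"
        using anti k k' by metis
      then obtain h where h: "h \<in> carrier H" "k = k' \<otimes>\<^bsub>K\<^esub> \<iota> h"
        using y_coset [OF k k'] by blast
      then have "susp_link k' (?act h p) = susp_link k' p'"
        using shift [OF k' h(1) p] 2(1) by simp
      then have "?act h p = p'"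
        using inj [OF k' act_in(1) [OF k' h(1) p] _ p' 2(3)] act_in(2) [OF k' h(1) p] 2(2) by simp
      then show ?thesis
        using h by auto
    qed simp
  next
    assume "(\<exists>h\<in>carrier H. k = k' \<otimes>\<^bsub>K\<^esub> \<iota> h \<and> p' = ?act h p) \<or> p \<in> {Join_Left 1} \<and> p' \<in> {Join_Left 1}"
    then show "f (k, p) = f (k', p')"
      using shift [OF k' _ p] base by (auto simp: f_def)
  qed
  show ?thesis
  proof (rule induced_space_homeomorphic [where \<Theta> = f, OF finite_K _ _ _ _ fibres])
    show "compact_space ?X"
      by (intro compact_space_join_space compact_space_J) (simp add: sphere0_def compact_space_discrete_topology)
    show "Hausdorff_space (collapsed_realization r P ?Co)"
      by (rule Hausdorff_space_collapsed_realization)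
    have f_in: "f (k, p) \<in> collapse ?Co ` barycentric r P" if "k \<in> carrier K" "p \<in> topspace ?X" for k p
      using susp_in [OF that] base base_in by (cases "p = Join_Left 1") (auto simp: f_def)
    show "f ` (carrier K \<times> topspace ?X) = topspace (collapsed_realization r P ?Co)"
    proof (intro equalityI subsetI)
      show "u \<in> topspace (collapsed_realization r P ?Co)" if "u \<in> f ` (carrier K \<times> topspace ?X)" for u
        using that f_in by auto
      fix u assume "u \<in> topspace (collapsed_realization r P ?Co)"
      then obtain t where t: "t \<in> barycentric r P" "u = collapse ?Co t"
        by auto
      show "u \<in> f ` (carrier K \<times> topspace ?X)"
      proof (cases "\<forall>v\<in>?Co. t v = 0")
        case True
        obtain k where "k \<in> carrier K"
          using ne by blast
        moreover have "u = f (k, Join_Left 1)"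
          using t(2) True base by (simp add: f_def collapse_eq_0)
        ultimately show ?thesis
          by (auto simp: X)
      next
        case False
        then obtain k where k: "k \<in> carrier K" and pos: "0 < t (y k)"
          using barycentricD(1) [OF t(1)] by (metis imageE less_eq_real_def)
        have "\<exists>p\<in>topspace ?X. t = susp_link k p"
        proof (cases "t (y k) = 1")
          case True
          then show ?thesis
            using barycentric_1_eq_point_mass [OF finite_P t(1)]
            by (intro bexI [of _ "Join_Left (-1)"]) (auto simp: susp_link_def X)
        next
          case False
          then have lt: "t (y k) < 1"
            using barycentric_le_1 [OF finite_P t(1), of "y k"] by simp
          obtain l where "l \<in> barycentric r (link r P (y k))" "t = mix (t (y k)) l (point_mass (y k))"
            using barycentric_decompose [OF finite_P t(1) pos lt] .
          then obtain q where q: "q \<in> topspace J" "t = mix (t (y k)) (join_link k q) (point_mass (y k))"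
            unfolding join_link_surj [OF k, symmetric] by auto
          \<comment> \<open>The height determines the half and the join parameter, which is
            \<open>2 * t (y k)\<close> over \<open>1\<close> and \<open>2 - 2 * t (y k)\<close> over
            \<open>-1\<close>.\<close>
          consider "t (y k) < 1/2" | "t (y k) = 1/2" | "t (y k) > 1/2"
            by linarith
          then show ?thesis
          proof cases
            case 1
            then show ?thesis
              using q pos by (intro bexI [of _ "Join_Mid 1 (2 * t (y k)) q"]) (auto simp: susp_link_def X height)
          next
            case 2
            then show ?thesis
              using q(1) q(2) [unfolded 2] by (intro bexI [of _ "Join_Right q"]) (auto simp: susp_link_def X)
          next
            case 3
            then show ?thesis
              using q lt by (intro bexI [of _ "Join_Mid (-1) (2 - 2 * t (y k)) q"])
                (auto simp: susp_link_def X height field_simps)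
          qed
        qed
        then show ?thesis
          using k t(2) by (auto simp: f_def)
      qed
    qed
    show "continuous_map ?X (collapsed_realization r P ?Co) (\<lambda>p. f (k, p))" if k: "k \<in> carrier K" for k
      unfolding continuous_map_into_collapsed_realization
    proof (intro conjI allI ballI f_in k)
      fix v :: "'a \<times> 'a"
      let ?S = "prod_topology sphere0 (prod_topology (top_of_set {0..1::real}) J)"
      let ?m = "\<lambda>s l. collapse ?Co (mix s (join_link k l) (point_mass (y k))) v"
      have lc: "continuous_map J euclideanreal (\<lambda>l. join_link k l w)" for w
        using continuous_map_join_link [OF k] by (simp add: continuous_map_into_realization finite_link_y [OF k])
      have mc: "continuous_map Z euclideanreal (\<lambda>p. ?m (s p) (l p))"
        if "continuous_map Z euclideanreal s" "continuous_map Z J l" for Z :: "'z topology" and s l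
      proof -
        have "continuous_map Z euclideanreal (\<lambda>p. mix (s p) (join_link k (l p)) (point_mass (y k)) w)" for w
          using continuous_map_compose [OF that(2) lc] that(1)
          by (intro continuous_map_mix) (auto simp: o_def)
        then show ?thesis
          by (cases "fst v \<in> ?Co") (auto simp: collapse_def case_prod_beta intro: continuous_map_real_mult)
      qed
      show "continuous_map ?X euclideanreal (\<lambda>p. f (k, p) v)"
      proof (rule continuous_map_join_space)
        show "continuous_map sphere0 euclideanreal (\<lambda>e. f (k, Join_Left e) v)"
          by (simp add: sphere0_def)
        show "continuous_map J euclideanreal (\<lambda>l. f (k, Join_Right l) v)"
          unfolding f_def susp_link_def using mc [of J "\<lambda>_. 1/2" id] by simp
        have "continuous_map sphere0 euclideanreal (of_int :: int \<Rightarrow> real)"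
          by (simp add: sphere0_def)
        then have e: "continuous_map ?S euclideanreal (\<lambda>p. of_int (fst p))"
          using continuous_map_compose [OF continuous_map_fst] by (fastforce simp: o_def)
        have t: "continuous_map ?S euclideanreal (\<lambda>p. fst (snd p))"
          using continuous_map_compose [OF continuous_map_snd continuous_map_fst_real] by (simp add: o_def)
        have l: "continuous_map ?S J (\<lambda>p. snd (snd p))"
          using continuous_map_compose [OF continuous_map_snd continuous_map_snd] by (simp add: o_def)
        have "continuous_map ?S euclideanreal (\<lambda>p. height (fst p) (fst (snd p)))"
          unfolding height_def
          by (intro continuous_map_real_divide continuous_map_diff continuous_map_real_mult e t) auto
        then have "continuous_map ?S euclideanreal (\<lambda>p. ?m (height (fst p) (fst (snd p))) (snd (snd p)))"
          using l by (rule mc)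
        moreover have "?m (height (fst p) (fst (snd p))) (snd (snd p)) = f (k, join_segment p) v"
          if "p \<in> topspace ?S" for p
        proof -
          obtain e t l where p: "p = (e, t, l)"
            by (cases p) auto
          with that have e: "e = -1 \<or> e = 1" and l: "l \<in> topspace J"
            by (auto simp: sphere0_def)
          \<comment> \<open>At the cone point \<open>1\<close> the formula gives a point of the link
            and \<open>susp_link\<close> the zero function. They agree after
            \<open>collapse\<close>, which makes the map continuous there.\<close>
          have "collapse ?Co (join_link k l) = (\<lambda>_. 0)"
            using link_Co [OF k l] by (simp add: collapse_eq_0)
          then show ?thesis
            using e base [of k] by (auto simp: p join_segment_def f_def susp_link_def height)
        qed
        ultimately show "continuous_map ?S euclideanreal (\<lambda>p. f (k, join_segment p) v)"
          by (rule continuous_map_eq)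
      qed
    qed
  qed
qed

end

subsection \<open>Partitions and equivalence relations\<close>

text \<open>Inverse to passing to the quotient. Through it refinement becomes inclusion of
  relations, and the meet of two partitions becomes intersection.\<close>

definition same_block :: "'a set set \<Rightarrow> ('a \<times> 'a) set" where
  "same_block P = {(x, y). \<exists>B\<in>P. x \<in> B \<and> y \<in> B}"

lemma equiv_same_block: "partition_on A P \<Longrightarrow> equiv A (same_block P)"
  unfolding same_block_def by (rule equiv_partition_on)

lemma quotient_same_block: "partition_on A P \<Longrightarrow> A // same_block P = P"
  unfolding same_block_def by (rule partition_on_eq_quotient)

lemma same_block_quotient:
  assumes "equiv A E"
  shows "same_block (A // E) = E"
proof (intro equalityI subrelI)
  show "(x, y) \<in> E" if "(x, y) \<in> same_block (A // E)" for x y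
    using that quotient_eq_iff [OF assms, of _ _ x y] by (auto simp: same_block_def)
  fix x y assume xy: "(x, y) \<in> E"
  then have "x \<in> A"
    using assms by (auto simp: equiv_def)
  then have "x \<in> E `` {x}"
    by (rule equiv_class_self [OF assms])
  then show "(x, y) \<in> same_block (A // E)"
    using xy \<open>x \<in> A\<close> by (auto simp: same_block_def intro!: bexI [of _ "E `` {x}"] quotientI)
qed

lemma equiv_intro:
  assumes "E \<subseteq> A \<times> A" "\<And>x. x \<in> A \<Longrightarrow> (x, x) \<in> E" "\<And>x y. (x, y) \<in> E \<Longrightarrow> (y, x) \<in> E"
    "\<And>x y z. (x, y) \<in> E \<Longrightarrow> (y, z) \<in> E \<Longrightarrow> (x, z) \<in> E"
  shows "equiv A E"
  using assms by (intro equivI refl_onI symI transI) blast+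

lemma equivD:
  assumes "equiv A E"
  shows "E \<subseteq> A \<times> A" "x \<in> A \<Longrightarrow> (x, x) \<in> E" "(x, y) \<in> E \<Longrightarrow> (y, x) \<in> E"
    "(x, y) \<in> E \<Longrightarrow> (y, z) \<in> E \<Longrightarrow> (x, z) \<in> E"
  using assms by (auto simp: equiv_def refl_on_def dest: symD transD)

lemma equiv_pullback:
  assumes F: "equiv B F" and f: "\<And>x. x \<in> A \<Longrightarrow> f x \<in> B"
  shows "equiv A {(x, y) \<in> A \<times> A. (f x, f y) \<in> F}"
proof (rule equiv_intro, goal_cases)
  case (4 x y z)
  then show ?case
    using equivD(4) [OF F, of "f x" "f y" "f z"] by simp
qed (use equivD(2,3) [OF F] f in auto)

lemma refines_iff:
  assumes P: "partition_on A P" and Q: "partition_on A Q"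
  shows "refines A P Q \<longleftrightarrow> same_block P \<subseteq> same_block Q"
proof
  assume "refines A P Q"
  then have *: "\<And>X. X \<in> P \<Longrightarrow> \<exists>Y\<in>Q. X \<subseteq> Y"
    by (simp add: refines_def)
  show "same_block P \<subseteq> same_block Q"
  proof (rule subrelI)
    fix x y assume "(x, y) \<in> same_block P"
    then obtain X where "X \<in> P" "x \<in> X" "y \<in> X"
      by (auto simp: same_block_def)
    moreover from * [OF this(1)] obtain Y where "Y \<in> Q" "X \<subseteq> Y"
      by auto
    ultimately show "(x, y) \<in> same_block Q"
      by (auto simp: same_block_def)
  qed
next
  assume sub: "same_block P \<subseteq> same_block Q"
  have "\<exists>Y\<in>Q. X \<subseteq> Y" if X: "X \<in> P" for X
  proof -
    obtain x where x: "x \<in> X"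
      using partition_onD3 [OF P] X by fastforce
    then obtain Y where Y: "Y \<in> Q" "x \<in> Y"
      using partition_onD1 [OF P] partition_onD1 [OF Q] X by blast
    have "z \<in> Y" if "z \<in> X" for z
    proof -
      have "(x, z) \<in> same_block P"
        using X x that by (auto simp: same_block_def)
      then obtain Y' where "Y' \<in> Q" "x \<in> Y'" "z \<in> Y'"
        using sub by (auto simp: same_block_def)
      then show ?thesis
        using Y partition_onD2 [OF Q] by (metis IntI disjointD empty_iff)
    qed
    then show ?thesis
      using Y by blast
  qed
  then show "refines A P Q"
    using P Q by (simp add: refines_def)
qed

lemma refines_quotient_iff:
  "equiv A E \<Longrightarrow> equiv A F \<Longrightarrow> refines A (A // E) (A // F) \<longleftrightarrow> E \<subseteq> F"
  by (simp add: refines_iff partition_on_quotient same_block_quotient)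

lemma quotient_eq_quotient_iff:
  "equiv A E \<Longrightarrow> equiv A F \<Longrightarrow> A // E = A // F \<longleftrightarrow> E = F"
  by (metis same_block_quotient)

lemma finite_poset_refines:
  assumes "finite A"
  shows "finite_poset (refines A) {P. partition_on A P}"
proof
  show "finite {P. partition_on A P}"
    using assms by (rule finitely_many_partition_on)
qed (simp_all add: refines_refl refines_asym, blast intro: refines_trans)

text \<open>Sending a block of \<open>P\<close> to the block of \<open>Q\<close> that contains it is
  onto, hence injective when the numbers agree; then each block of \<open>Q\<close> is a single
  block of \<open>P\<close>. This prevents a permutation from moving a partition to a different
  comparable one.\<close>

lemma refines_card_eq:
  assumes A: "finite A" and ref: "refines A P Q" and card: "card P = card Q"
  shows "P = Q"
proof -
  have P: "partition_on A P" and Q: "partition_on A Q"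
    using ref by (auto simp: refines_def)
  then have fin: "finite P" "finite Q"
    using A finite_elements by auto
  obtain f where f: "\<And>X. X \<in> P \<Longrightarrow> f X \<in> Q \<and> X \<subseteq> f X"
    using ref unfolding refines_def by metis
  have disj: "Y = Y'" if "Y \<in> Q" "Y' \<in> Q" "z \<in> Y" "z \<in> Y'" for Y Y' z
    using that partition_onD2 [OF Q] by (metis IntI disjointD empty_iff)
  have block: "\<exists>X\<in>P. z \<in> X \<and> f X = Y" if Y: "Y \<in> Q" "z \<in> Y" for Y z
  proof -
    obtain X where "X \<in> P" "z \<in> X"
      using Y partition_onD1 [OF P] partition_onD1 [OF Q] by blast
    then show ?thesis
      using f Y disj by blast
  qed
  have "Q \<subseteq> f ` P"
  proof
    fix Y assume "Y \<in> Q"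
    then obtain z where "z \<in> Y"
      using partition_onD3 [OF Q] by fastforce
    then show "Y \<in> f ` P"
      using block [OF \<open>Y \<in> Q\<close>] by blast
  qed
  then have fP: "f ` P = Q"
    using f by blast
  then have inj: "inj_on f P"
    using card fin by (simp add: eq_card_imp_inj_on)
  have "f X = X" if X: "X \<in> P" for X
  proof
    show "f X \<subseteq> X"
      using block [of "f X"] f X inj_onD [OF inj] by blast
  qed (use f X in blast)
  then show ?thesis
    using fP by simp
qed

section \<open>Invariant partitions and fixed points\<close>

definition invariant_partitions :: "'a set \<Rightarrow> ('a \<Rightarrow> 'a) set \<Rightarrow> 'a set set set" where
  "invariant_partitions A S =
     {P. partition_on A P \<and> P \<noteq> {A} \<and> P \<noteq> (\<lambda>i. {i}) ` A \<and> (\<forall>g\<in>S. (`) g ` P = P)}"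

lemma image_quotient:
  assumes E: "equiv A E" and g: "g permutes A"
  defines "E' \<equiv> {(x, y) \<in> A \<times> A. (inv_into UNIV g x, inv_into UNIV g y) \<in> E}"
  shows "equiv A E'" and "(`) g ` (A // E) = A // E'"
    and "(`) g ` (A // E) = A // E \<longleftrightarrow> (\<forall>x\<in>A. \<forall>y\<in>A. (g x, g y) \<in> E \<longleftrightarrow> (x, y) \<in> E)"
proof -
  have gA: "g x \<in> A \<longleftrightarrow> x \<in> A" "inv_into UNIV g x \<in> A \<longleftrightarrow> x \<in> A" for x
    using g permutes_inv [OF g] by (auto simp: permutes_in_image)
  have inv: "g (inv_into UNIV g x) = x" "inv_into UNIV g (g x) = x" for x
    using g by (auto simp: permutes_inverses)
  show E': "equiv A E'"
    unfolding E'_def by (rule equiv_pullback [OF E]) (simp add: gA)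
  have cls: "g ` (E `` {x}) = E' `` {g x}" if "x \<in> A" for x
  proof (intro equalityI subsetI)
    show "z \<in> E' `` {g x}" if "z \<in> g ` (E `` {x})" for z
      using that equivD(1) [OF E] gA \<open>x \<in> A\<close> by (auto simp: E'_def inv)
    show "z \<in> g ` (E `` {x})" if "z \<in> E' `` {g x}" for z
      using that by (intro image_eqI [of _ _ "inv_into UNIV g z"]) (auto simp: E'_def inv)
  qed
  have quot: "A // R = (\<lambda>x. R `` {x}) ` A" for R
    by (auto simp: quotient_def)
  have "(`) g ` (A // E) = (\<lambda>x. E' `` {x}) ` (g ` A)"
    unfolding quot image_image using cls by (intro image_cong) auto
  then show image: "(`) g ` (A // E) = A // E'"
    unfolding quot permutes_image [OF g] .
  have "(`) g ` (A // E) = A // E \<longleftrightarrow> E' = E"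
    using image quotient_eq_quotient_iff [OF E' E] by simp
  also have "\<dots> \<longleftrightarrow> (\<forall>x\<in>A. \<forall>y\<in>A. (g x, g y) \<in> E \<longleftrightarrow> (x, y) \<in> E)"
  proof
    assume eq: "E' = E"
    have "(g x, g y) \<in> E' \<longleftrightarrow> (x, y) \<in> E" if "x \<in> A" "y \<in> A" for x y
      using that by (simp add: E'_def gA inv)
    then show "\<forall>x\<in>A. \<forall>y\<in>A. (g x, g y) \<in> E \<longleftrightarrow> (x, y) \<in> E"
      by (simp add: eq)
  next
    assume *: "\<forall>x\<in>A. \<forall>y\<in>A. (g x, g y) \<in> E \<longleftrightarrow> (x, y) \<in> E"
    have "(inv_into UNIV g x, inv_into UNIV g y) \<in> E \<longleftrightarrow> (x, y) \<in> E" if "x \<in> A" "y \<in> A" for x y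
      using * [rule_format, of "inv_into UNIV g x" "inv_into UNIV g y"] that gA inv by simp
    then show "E' = E"
      using equivD(1) [OF E] by (auto simp: E'_def)
  qed
  finally show "(`) g ` (A // E) = A // E \<longleftrightarrow> (\<forall>x\<in>A. \<forall>y\<in>A. (g x, g y) \<in> E \<longleftrightarrow> (x, y) \<in> E)" .
qed

lemma quotient_full: "A \<noteq> {} \<Longrightarrow> A // (A \<times> A) = {A}"
  and quotient_Id_on: "A // Id_on A = (\<lambda>i. {i}) ` A"
  by (auto simp: quotient_def)

lemma quotient_invariant_iff:
  assumes "equiv A E" "A \<noteq> {}" "\<And>g. g \<in> S \<Longrightarrow> g permutes A"
  shows "A // E \<in> invariant_partitions A S \<longleftrightarrow>
     E \<noteq> A \<times> A \<and> E \<noteq> Id_on A \<and> (\<forall>g\<in>S. \<forall>x\<in>A. \<forall>y\<in>A. (g x, g y) \<in> E \<longleftrightarrow> (x, y) \<in> E)"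
proof -
  have "equiv A (A \<times> A)" "equiv A (Id_on A)"
    by (auto intro!: equiv_intro)
  then have "A // E = {A} \<longleftrightarrow> E = A \<times> A" "A // E = (\<lambda>i. {i}) ` A \<longleftrightarrow> E = Id_on A"
    using quotient_eq_quotient_iff [OF assms(1)] assms(2) by (metis quotient_full quotient_Id_on)+
  then show ?thesis
    using assms by (auto simp: invariant_partitions_def partition_on_quotient image_quotient(3))
qed

lemma invariant_partitionE:
  assumes "P \<in> invariant_partitions A S"
  obtains E where "equiv A E" "P = A // E"
  using assms equiv_same_block quotient_same_block unfolding invariant_partitions_def by fastforce

text \<open>If \<open>t\<close> is fixed and \<open>t Q \<noteq> 0\<close>, then the translates of
  \<open>Q\<close> lie in the support of \<open>t\<close> as well and are comparable with
  \<open>Q\<close>. They have as many blocks as \<open>Q\<close>, so they equal \<open>Q\<close>: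
  the support consists of invariant partitions.\<close>

lemma fixed_points_partition_complex:
  assumes S: "\<And>g. g \<in> S \<Longrightarrow> g permutes {1..n}"
  shows "fixed_points S perm_act (partition_complex n)
    = realization (refines {1..n}) (invariant_partitions {1..n} S)"
proof -
  let ?r = "refines {1..n}"
  let ?P = "invariant_partitions {1..n} S"
  have sub: "?P \<subseteq> partition_poset n"
    by (auto simp: invariant_partitions_def partition_poset_def)
  have fin: "finite (partition_poset n)"
    by (rule finite_subset [OF _ finitely_many_partition_on [of "{1..n}"]]) (auto simp: partition_poset_def)
  have inv: "(\<lambda>B. inv_into UNIV g ` B) ` (`) g ` Q = Q" "(`) g ` (\<lambda>B. inv_into UNIV g ` B) ` Q = Q" if "g \<in> S" for g Q
    using S [OF that] by (simp_all add: image_image permutes_inverses)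
  have "barycentric ?r (partition_poset n) \<inter> {t. \<forall>g\<in>S. perm_act g t = t} = barycentric ?r ?P"
  proof (intro equalityI subsetI)
    fix t assume "t \<in> barycentric ?r (partition_poset n) \<inter> {t. \<forall>g\<in>S. perm_act g t = t}"
    then have t: "t \<in> barycentric ?r (partition_poset n)" and fixed: "\<And>g. g \<in> S \<Longrightarrow> perm_act g t = t"
      by auto
    show "t \<in> barycentric ?r ?P"
    proof (rule barycentric_restrict [OF fin sub t], rule ccontr)
      fix Q assume Q: "Q \<in> partition_poset n - ?P" and nz: "t Q \<noteq> 0"
      then obtain g where g: "g \<in> S" "(`) g ` Q \<noteq> Q"
        by (auto simp: invariant_partitions_def partition_poset_def)
      have "t ((`) g ` Q) = t Q"
        using fun_cong [OF fixed [OF g(1)], of "(`) g ` Q"] inv(1) [OF g(1)] by (simp add: perm_act_def)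
      then have "?r Q ((`) g ` Q) \<or> ?r ((`) g ` Q) Q"
        using barycentricD(3) [OF t] nz by metis
      moreover have "card ((`) g ` Q) = card Q"
        by (rule card_image) (use permutes_inj [OF S [OF g(1)]] in \<open>auto simp: inj_on_def inj_image_eq_iff\<close>)
      ultimately show False
        using g(2) refines_card_eq [of "{1..n}"] by (metis finite_atLeastAtMost)
    qed
  next
    fix t assume t: "t \<in> barycentric ?r ?P"
    have "perm_act g t = t" if g: "g \<in> S" for g
    proof
      fix Q
      have "(`) g ` Q = Q" if "Q \<in> ?P" for Q
        using that g by (auto simp: invariant_partitions_def)
      then have "(\<lambda>B. inv_into UNIV g ` B) ` Q = Q" if "Q \<in> ?P \<or> (\<lambda>B. inv_into UNIV g ` B) ` Q \<in> ?P"
        using that inv [OF g] by metis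
      then show "perm_act g t Q = t Q"
        unfolding perm_act_def using barycentricD(2) [OF t] by metis
    qed
    then show "t \<in> barycentric ?r (partition_poset n) \<inter> {t. \<forall>g\<in>S. perm_act g t = t}"
      using barycentric_mono [OF fin sub t] by blast
  qed
  then show ?thesis
    unfolding fixed_points_def partition_complex_def
    using realization_eq [OF fin] realization_eq [OF finite_subset [OF sub fin]]
    by (simp add: subtopology_subtopology)
qed

lemma invariant_partitions_empty: "invariant_partitions {1..n} {} = partition_poset n"
  by (simp add: invariant_partitions_def partition_poset_def)

subsection \<open>Invariant partitions of a sum of copies of a transitive set\<close>

locale orbit_system =
  fixes n d m :: nat and G :: "(nat \<Rightarrow> nat) set"
  assumes n: "n = d * m" and d: "d \<ge> 1" and m: "m \<ge> 1"
    and G: "subgroup G (sym_group d)"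
    and transitive: "\<forall>i\<in>{1..d}. \<forall>j\<in>{1..d}. \<exists>\<sigma>\<in>G. \<sigma> i = j"
begin

abbreviation "A \<equiv> {1..n}"
abbreviation "C \<equiv> centralizer_group (sym_group d) G"
abbreviation "K \<equiv> power_group C m"
abbreviation "De \<equiv> diagonal_embedding d n"

text \<open>The number \<open>x\<close> is read as a matrix entry, with rows and columns counted
  from 1. \<open>G\<close> permutes the rows, and by transitivity its orbits are the
  columns.\<close>

definition row :: "nat \<Rightarrow> nat" where "row x = (x - 1) mod d + 1"
definition col :: "nat \<Rightarrow> nat" where "col x = (x - 1) div d + 1"
definition entry :: "nat \<Rightarrow> nat \<Rightarrow> nat" where "entry i j = i + (j - 1) * d"

lemma row_in: "row x \<in> {1..d}"
  using d by (simp add: row_def Suc_leI)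

lemma col_in: "x \<in> A \<Longrightarrow> col x \<in> {1..m}"
proof -
  assume "x \<in> A"
  then have "x - 1 < d * m"
    using n by auto
  then have "(x - 1) div d < m"
    by (simp add: less_mult_imp_div_less mult.commute)
  then show ?thesis
    by (simp add: col_def)
qed

lemma entry_row_col: "x \<in> A \<Longrightarrow> entry (row x) (col x) = x"
  by (simp add: entry_def row_def col_def)

lemma entry_in: "i \<in> {1..d} \<Longrightarrow> j \<in> {1..m} \<Longrightarrow> entry i j \<in> A"
proof -
  assume ij: "i \<in> {1..d}" "j \<in> {1..m}"
  then have "(j - 1) * d + d = j * d"
    by (cases j) auto
  also have "\<dots> \<le> d * m"
    using ij by (simp add: mult.commute)
  finally show ?thesis
    using ij n by (simp add: entry_def)
qed

lemma row_entry: "i \<in> {1..d} \<Longrightarrow> row (entry i j) = i"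
  and col_entry: "i \<in> {1..d} \<Longrightarrow> j \<in> {1..m} \<Longrightarrow> col (entry i j) = j"
proof -
  assume "i \<in> {1..d}"
  then obtain i' where i': "i = Suc i'" "i' < d"
    by (cases i) auto
  then show "col (entry i j) = j" if "j \<in> {1..m}"
    using that by (auto simp: row_def col_def entry_def)
  show "row (entry i j) = i"
    using i' by (simp add: row_def entry_def)
qed

lemma G_permutes: "g \<in> G \<Longrightarrow> g permutes {1..d}"
  using subgroup.mem_carrier [OF G] by (simp add: sym_group_carrier)

lemma G_one: "id \<in> G"
  using subgroup.one_closed [OF G] by (simp add: sym_group_one)

lemma G_mult: "g \<in> G \<Longrightarrow> h \<in> G \<Longrightarrow> g \<circ> h \<in> G"
  using subgroup.m_closed [OF G] by (simp add: sym_group_mult)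

lemma G_inv: "g \<in> G \<Longrightarrow> inv_into UNIV g \<in> G"
  using subgroup.m_inv_closed [OF G] subgroup.mem_carrier [OF G] by (metis sym_group_inv_equality sym_group_carrier)

lemma De_entry: "x \<in> A \<Longrightarrow> De g x = entry (g (row x)) (col x)"
  by (simp add: diagonal_embedding_def entry_def row_def col_def)

lemma G_in: "g \<in> G \<Longrightarrow> i \<in> {1..d} \<Longrightarrow> g i \<in> {1..d}"
  using permutes_in_image [OF G_permutes] by blast

lemma
  assumes g: "g \<in> G" and x: "x \<in> A"
  shows De_in: "De g x \<in> A" and row_De: "row (De g x) = g (row x)" and col_De: "col (De g x) = col x"
proof -
  have "g (row x) \<in> {1..d}"
    by (rule G_in [OF g row_in])
  then show "De g x \<in> A" "row (De g x) = g (row x)" "col (De g x) = col x"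
    unfolding De_entry [OF x] by (simp_all only: entry_in row_entry col_entry col_in [OF x])
qed

lemma De_inverse: "g \<in> G \<Longrightarrow> x \<in> A \<Longrightarrow> De (inv_into UNIV g) (De g x) = x"
  "g \<in> G \<Longrightarrow> x \<in> A \<Longrightarrow> De g (De (inv_into UNIV g) x) = x"
  by (simp_all only: De_entry [OF De_in] De_in G_inv row_De col_De permutes_inverses [OF G_permutes] entry_row_col)

lemma De_permutes: "g \<in> G \<Longrightarrow> De g permutes A"
proof (rule bij_imp_permutes)
  show "bij_betw (De g) A A" if "g \<in> G"
    using De_in [OF that] De_in [OF G_inv [OF that]] De_inverse [OF that]
    by (intro bij_betw_byWitness [where f' = "De (inv_into UNIV g)"]) auto
qed (simp only: diagonal_embedding_def if_False)

lemma A_ne: "A \<noteq> {}"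
  using n d m by simp

lemma C_iff: "c \<in> carrier C \<longleftrightarrow> c permutes {1..d} \<and> (\<forall>g\<in>G. c \<circ> g = g \<circ> c)"
  by (simp add: centralizer_group_def sym_group_carrier sym_group_mult)

lemma C_mult: "a \<otimes>\<^bsub>C\<^esub> b = a \<circ> b"
  by (simp add: centralizer_group_def sym_group_mult)

lemma C_commute: "c \<in> carrier C \<Longrightarrow> g \<in> G \<Longrightarrow> c (g i) = g (c i)"
  unfolding C_iff by (metis comp_apply)

lemma C_inv: "c \<in> carrier C \<Longrightarrow> inv_into UNIV c \<in> carrier C"
  unfolding C_iff
proof (intro conjI ballI ext)
  fix g i assume c: "c permutes {1..d} \<and> (\<forall>g\<in>G. c \<circ> g = g \<circ> c)" and g: "g \<in> G"
  then have "c (g (inv_into UNIV c i)) = g (c (inv_into UNIV c i))"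
    by (metis comp_apply)
  then have "c (g (inv_into UNIV c i)) = g i"
    using c permutes_inverses(1) [of c "{1..d}"] by metis
  then show "(inv_into UNIV c \<circ> g) i = (g \<circ> inv_into UNIV c) i"
    using c by (metis comp_apply permutes_inverses(2))
qed (simp add: permutes_inv)

lemma C_comp: "a \<in> carrier C \<Longrightarrow> b \<in> carrier C \<Longrightarrow> a \<circ> b \<in> carrier C"
  unfolding C_iff by (simp add: permutes_compose) (metis comp_assoc)

lemma C_in: "c \<in> carrier C \<Longrightarrow> i \<in> {1..d} \<Longrightarrow> c i \<in> {1..d}"
  by (simp add: C_iff permutes_in_image del: atLeastAtMost_iff)

lemma C_inverses: "c \<in> carrier C \<Longrightarrow> c (inv_into UNIV c i) = i"
  "c \<in> carrier C \<Longrightarrow> inv_into UNIV c (c i) = i"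
  using permutes_inverses [of c "{1..d}"] by (auto simp only: C_iff)

lemma K_carrier: "carrier K = (\<Pi>\<^sub>E j\<in>{1..m}. carrier C)"
  by (simp add: power_group_def)

lemma K_in: "k \<in> carrier K \<Longrightarrow> j \<in> {1..m} \<Longrightarrow> k j \<in> carrier C"
  unfolding K_carrier by (rule PiE_mem)

lemma K_mult_diagonal: "k \<otimes>\<^bsub>K\<^esub> diagonal m h = (\<lambda>j\<in>{1..m}. k j \<circ> h)"
  by (auto simp: power_group_def diagonal_def C_mult)

text \<open>
  An element \<open>k\<close> of \<open>C\<^sup>m\<close> identifies all the orbits \<open>{x. col x = j}\<close> with \<open>{1..d}\<close> in a
  \<open>G\<close>-equivariant way.
\<close>

definition pos :: "(nat \<Rightarrow> nat \<Rightarrow> nat) \<Rightarrow> nat \<Rightarrow> nat" where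
  "pos k x = inv_into UNIV (k (col x)) (row x)"

text \<open>Together with \<open>lift k\<close> as inverse, \<open>pos k\<close> and
  \<open>col\<close> are coordinates that identify \<open>A\<close> with
  \<open>{1..d} \<times> {1..m}\<close>, and \<open>G\<close> acts on the first coordinate
  only.\<close>

definition lift :: "(nat \<Rightarrow> nat \<Rightarrow> nat) \<Rightarrow> nat \<Rightarrow> nat \<Rightarrow> nat" where
  "lift k i j = entry (k j i) j"

context
  fixes k assumes k: "k \<in> carrier K"
begin

lemma pos_in: "x \<in> A \<Longrightarrow> pos k x \<in> {1..d}"
  unfolding pos_def by (rule C_in [OF C_inv [OF K_in [OF k col_in]] row_in])

lemma lift_in: "i \<in> {1..d} \<Longrightarrow> j \<in> {1..m} \<Longrightarrow> lift k i j \<in> A"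
  unfolding lift_def by (rule entry_in [OF C_in [OF K_in [OF k]]])

lemma
  assumes i: "i \<in> {1..d}" and j: "j \<in> {1..m}"
  shows pos_lift: "pos k (lift k i j) = i" and col_lift: "col (lift k i j) = j"
proof -
  have *: "k j i \<in> {1..d}"
    by (rule C_in [OF K_in [OF k j] i])
  then show "col (lift k i j) = j"
    unfolding lift_def using j by (rule col_entry)
  then show "pos k (lift k i j) = i"
    unfolding pos_def by (simp only: lift_def row_entry [OF *] C_inverses(2) [OF K_in [OF k j]])
qed

lemma lift_pos_col: "x \<in> A \<Longrightarrow> lift k (pos k x) (col x) = x"
  unfolding pos_def lift_def by (simp only: C_inverses(1) [OF K_in [OF k col_in]] entry_row_col)

lemma pos_col_eqD: "x \<in> A \<Longrightarrow> x' \<in> A \<Longrightarrow> pos k x = pos k x' \<Longrightarrow> col x = col x' \<Longrightarrow> x = x'"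
  using lift_pos_col by metis

text \<open>Here the centralizer enters: the inverse of each member of \<open>k\<close> commutes
  with \<open>G\<close>.\<close>

lemma pos_De:
  assumes g: "g \<in> G" and x: "x \<in> A"
  shows "pos k (De g x) = g (pos k x)"
  unfolding pos_def row_De [OF g x] col_De [OF g x] by (rule C_commute [OF C_inv [OF K_in [OF k col_in [OF x]]] g])

lemma De_lift:
  assumes "g \<in> G" "i \<in> {1..d}" "j \<in> {1..m}"
  shows "De g (lift k i j) = lift k (g i) j"
  by (rule pos_col_eqD) (simp_all only: assms De_in lift_in G_in pos_De col_De pos_lift col_lift)

end

section \<open>The intervals above and below a complement\<close>

text \<open>In the coordinates \<open>pos k\<close> and \<open>col\<close>, this is \<open>F\<close>
  times the full relation. Likewise \<open>Dn k F\<close> is equality times \<open>F\<close>, and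
  \<open>Fib k\<close>, the relation of the complement given by \<open>k\<close>, is equality times
  the full relation.\<close>

definition Up :: "(nat \<Rightarrow> nat \<Rightarrow> nat) \<Rightarrow> (nat \<times> nat) set \<Rightarrow> (nat \<times> nat) set" where
  "Up k F = {(x, x') \<in> A \<times> A. (pos k x, pos k x') \<in> F}"

definition Dn :: "(nat \<Rightarrow> nat \<Rightarrow> nat) \<Rightarrow> (nat \<times> nat) set \<Rightarrow> (nat \<times> nat) set" where
  "Dn k F = {(x, x') \<in> A \<times> A. pos k x = pos k x' \<and> (col x, col x') \<in> F}"

definition Fib :: "(nat \<Rightarrow> nat \<Rightarrow> nat) \<Rightarrow> (nat \<times> nat) set" where
  "Fib k = {(x, x') \<in> A \<times> A. pos k x = pos k x'}"

definition "up k a = A // Up k (same_block a)"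
definition "dn k b = A // Dn k (same_block b)"
definition "fib k = A // Fib k"

definition "Col = {(x, x') \<in> A \<times> A. col x = col x'}"

abbreviation "P \<equiv> invariant_partitions A (De ` G)"
abbreviation "D \<equiv> invariant_partitions {1..d} G"
abbreviation "M \<equiv> partition_poset m"

lemma equiv_Col: "equiv A Col"
  by (rule equiv_intro) (auto simp: Col_def)

lemma P_iff:
  "equiv A E \<Longrightarrow> A // E \<in> P \<longleftrightarrow> E \<noteq> A \<times> A \<and> E \<noteq> Id_on A \<and>
     (\<forall>g\<in>G. \<forall>x\<in>A. \<forall>y\<in>A. (De g x, De g y) \<in> E \<longleftrightarrow> (x, y) \<in> E)"
  using quotient_invariant_iff [of A E "De ` G"] A_ne De_permutes by auto

lemma D_iff:
  "equiv {1..d} E \<Longrightarrow> {1..d} // E \<in> D \<longleftrightarrow> E \<noteq> {1..d} \<times> {1..d} \<and> E \<noteq> Id_on {1..d} \<and>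
     (\<forall>g\<in>G. \<forall>x\<in>{1..d}. \<forall>y\<in>{1..d}. (g x, g y) \<in> E \<longleftrightarrow> (x, y) \<in> E)"
  using quotient_invariant_iff [of "{1..d}" E G] d G_permutes by auto

lemma M_iff:
  "equiv {1..m} E \<Longrightarrow> {1..m} // E \<in> M \<longleftrightarrow> E \<noteq> {1..m} \<times> {1..m} \<and> E \<noteq> Id_on {1..m}"
  unfolding invariant_partitions_empty [symmetric] using m by (subst quotient_invariant_iff) simp_all

lemma PE:
  assumes "z \<in> P"
  obtains E where "equiv A E" "z = A // E" "E \<noteq> A \<times> A" "E \<noteq> Id_on A"
    "\<And>g x y. g \<in> G \<Longrightarrow> x \<in> A \<Longrightarrow> y \<in> A \<Longrightarrow> (De g x, De g y) \<in> E \<longleftrightarrow> (x, y) \<in> E"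
  using assms invariant_partitionE [OF assms] P_iff by metis

lemma DE:
  assumes "z \<in> D"
  obtains E where "equiv {1..d} E" "z = {1..d} // E" "E \<noteq> {1..d} \<times> {1..d}" "E \<noteq> Id_on {1..d}"
    "\<And>g x y. g \<in> G \<Longrightarrow> x \<in> {1..d} \<Longrightarrow> y \<in> {1..d} \<Longrightarrow> (g x, g y) \<in> E \<longleftrightarrow> (x, y) \<in> E"
  using assms invariant_partitionE [OF assms] D_iff by metis

lemma ME:
  assumes "z \<in> M"
  obtains E where "equiv {1..m} E" "z = {1..m} // E" "E \<noteq> {1..m} \<times> {1..m}" "E \<noteq> Id_on {1..m}"
  using assms invariant_partitionE [of z "{1..m}" "{}"] M_iff by (metis invariant_partitions_empty)

lemma one_in_d: "1 \<in> {1..d}" and one_in_m: "1 \<in> {1..m}"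
  using d m by auto

declare One_nat_def [simp del] atLeastAtMost_iff [simp del]

context
  fixes k assumes k: "k \<in> carrier K"
begin

lemma equiv_Up: "equiv {1..d} F \<Longrightarrow> equiv A (Up k F)"
  unfolding Up_def by (erule equiv_pullback) (rule pos_in [OF k])

lemma equiv_Fib: "equiv A (Fib k)"
  by (rule equiv_intro) (auto simp: Fib_def)

lemma equiv_Dn:
  assumes F: "equiv {1..m} F"
  shows "equiv A (Dn k F)"
proof (rule equiv_intro, goal_cases)
  case (4 x y z)
  then show ?case
    using equivD(4) [OF F, of "col x" "col y" "col z"] by (simp add: Dn_def)
qed (use equivD(2,3) [OF F] col_in in \<open>auto simp: Dn_def\<close>)

lemma Up_iff: "i \<in> {1..d} \<Longrightarrow> i' \<in> {1..d} \<Longrightarrow> j \<in> {1..m} \<Longrightarrow> j' \<in> {1..m} \<Longrightarrow>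
    (lift k i j, lift k i' j') \<in> Up k F \<longleftrightarrow> (i, i') \<in> F"
  using lift_in [OF k] pos_lift [OF k] by (simp add: Up_def)

lemma Dn_iff: "i \<in> {1..d} \<Longrightarrow> j \<in> {1..m} \<Longrightarrow> j' \<in> {1..m} \<Longrightarrow>
    (lift k i j, lift k i j') \<in> Dn k F \<longleftrightarrow> (j, j') \<in> F"
  using lift_in [OF k] pos_lift [OF k] col_lift [OF k] by (simp add: Dn_def)

lemma Up_mono_iff:
  assumes "F \<subseteq> {1..d} \<times> {1..d}"
  shows "Up k F \<subseteq> Up k F' \<longleftrightarrow> F \<subseteq> F'"
proof
  assume sub: "Up k F \<subseteq> Up k F'"
  show "F \<subseteq> F'"
  proof (rule subrelI)
    fix i i' assume "(i, i') \<in> F"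
    then show "(i, i') \<in> F'"
      using assms one_in_m sub Up_iff [of i i' 1 1 F] Up_iff [of i i' 1 1 F'] by auto
  qed
qed (auto simp: Up_def)

lemma Dn_mono_iff:
  assumes "F \<subseteq> {1..m} \<times> {1..m}"
  shows "Dn k F \<subseteq> Dn k F' \<longleftrightarrow> F \<subseteq> F'"
proof
  assume sub: "Dn k F \<subseteq> Dn k F'"
  show "F \<subseteq> F'"
  proof (rule subrelI)
    fix i i' assume "(i, i') \<in> F"
    then show "(i, i') \<in> F'"
      using assms one_in_d sub Dn_iff [of 1 i i' F] Dn_iff [of 1 i i' F'] by auto
  qed
qed (auto simp: Dn_def)

lemma Up_full: "Up k ({1..d} \<times> {1..d}) = A \<times> A"
  using pos_in [OF k] by (auto simp: Up_def)

lemma Up_Id: "Up k (Id_on {1..d}) = Fib k"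
  using pos_in [OF k] by (auto simp: Up_def Fib_def)

lemma Dn_full: "Dn k ({1..m} \<times> {1..m}) = Fib k"
  using col_in by (auto simp: Dn_def Fib_def)

lemma Dn_Id: "Dn k (Id_on {1..m}) = Id_on A"
  using col_in pos_col_eqD [OF k] by (fastforce simp: Dn_def)

lemma Up_eq_iff: "F \<subseteq> {1..d} \<times> {1..d} \<Longrightarrow> F' \<subseteq> {1..d} \<times> {1..d} \<Longrightarrow> Up k F = Up k F' \<longleftrightarrow> F = F'"
  using Up_mono_iff by (metis order_antisym order_refl)

lemma Dn_eq_iff: "F \<subseteq> {1..m} \<times> {1..m} \<Longrightarrow> F' \<subseteq> {1..m} \<times> {1..m} \<Longrightarrow> Dn k F = Dn k F' \<longleftrightarrow> F = F'"
  using Dn_mono_iff by (metis order_antisym order_refl)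

lemma up_quotient: "equiv {1..d} F \<Longrightarrow> up k ({1..d} // F) = A // Up k F"
  by (simp add: up_def same_block_quotient)

lemma dn_quotient: "equiv {1..m} F \<Longrightarrow> dn k ({1..m} // F) = A // Dn k F"
  by (simp add: dn_def same_block_quotient)

lemma up_refines_iff:
  assumes "a \<in> D" "a' \<in> D"
  shows "refines A (up k a) (up k a') \<longleftrightarrow> refines {1..d} a a'"
proof -
  obtain F F' where "equiv {1..d} F" "a = {1..d} // F" "equiv {1..d} F'" "a' = {1..d} // F'"
    using DE [OF assms(1)] DE [OF assms(2)] by metis
  then show ?thesis
    by (simp add: up_quotient refines_quotient_iff equiv_Up Up_mono_iff equivD(1))
qed

lemma dn_refines_iff:
  assumes "a \<in> M" "a' \<in> M"
  shows "refines A (dn k a) (dn k a') \<longleftrightarrow> refines {1..m} a a'"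
proof -
  obtain F F' where "equiv {1..m} F" "a = {1..m} // F" "equiv {1..m} F'" "a' = {1..m} // F'"
    using ME [OF assms(1)] ME [OF assms(2)] by metis
  then show ?thesis
    by (simp add: dn_quotient refines_quotient_iff equiv_Dn Dn_mono_iff equivD(1))
qed

lemma Up_invariant:
  assumes "\<And>g x y. g \<in> G \<Longrightarrow> x \<in> {1..d} \<Longrightarrow> y \<in> {1..d} \<Longrightarrow> (g x, g y) \<in> F \<longleftrightarrow> (x, y) \<in> F"
    and "g \<in> G" "x \<in> A" "y \<in> A"
  shows "(De g x, De g y) \<in> Up k F \<longleftrightarrow> (x, y) \<in> Up k F"
  using assms by (simp add: Up_def pos_De [OF k] De_in pos_in [OF k])

lemma Dn_invariant:
  assumes "g \<in> G" "x \<in> A" "y \<in> A"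
  shows "(De g x, De g y) \<in> Dn k F \<longleftrightarrow> (x, y) \<in> Dn k F"
proof -
  have "g (pos k x) = g (pos k y) \<longleftrightarrow> pos k x = pos k y"
    by (rule inj_eq [OF permutes_inj [OF G_permutes [OF assms(1)]]])
  then show ?thesis
    using assms by (simp add: Dn_def pos_De [OF k] De_in col_De)
qed

text \<open>A relation that contains \<open>Fib k\<close> does not see the columns: it is determined
  by its restriction to the first column, which amounts to an invariant relation on
  \<open>{1..d}\<close>.\<close>

lemma up_image: "up k ` D = {x \<in> P. x \<noteq> fib k \<and> refines A (fib k) x}"
proof (intro equalityI subsetI)
  fix z assume "z \<in> up k ` D"
  then obtain a where "a \<in> D" "z = up k a"
    by blast
  then obtain F where F: "equiv {1..d} F" "z = up k ({1..d} // F)" "F \<noteq> {1..d} \<times> {1..d}" "F \<noteq> Id_on {1..d}"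
    and inv: "\<And>g x y. g \<in> G \<Longrightarrow> x \<in> {1..d} \<Longrightarrow> y \<in> {1..d} \<Longrightarrow> (g x, g y) \<in> F \<longleftrightarrow> (x, y) \<in> F"
    by (metis DE)
  have z: "z = A // Up k F"
    using F by (simp add: up_quotient)
  have sub: "Id_on {1..d} \<subseteq> F" "F \<subseteq> {1..d} \<times> {1..d}" "Id_on {1..d} \<subseteq> {1..d} \<times> {1..d}"
    using equivD(1,2) [OF F(1)] by auto
  have le: "Fib k \<subseteq> Up k F" and ne: "Up k F \<noteq> Fib k" "Up k F \<noteq> A \<times> A"
    using sub F(3,4) Up_eq_iff [of F] Up_mono_iff [of "Id_on {1..d}" F] by (auto simp: Up_Id [symmetric] Up_full [symmetric])
  have "Id_on A \<subseteq> Fib k"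
    using equivD(2) [OF equiv_Fib] by auto
  then have ne': "Up k F \<noteq> Id_on A"
    using le ne(1) by (metis subset_antisym)
  have "z \<in> P"
    unfolding z P_iff [OF equiv_Up [OF F(1)]]
    by (intro conjI ballI ne ne') (rule Up_invariant [OF inv])
  then show "z \<in> {x \<in> P. x \<noteq> fib k \<and> refines A (fib k) x}"
    using le ne by (simp add: z fib_def quotient_eq_quotient_iff refines_quotient_iff equiv_Up F(1) equiv_Fib)
next
  fix z assume "z \<in> {x \<in> P. x \<noteq> fib k \<and> refines A (fib k) x}"
  then have z: "z \<in> P" "z \<noteq> fib k" "refines A (fib k) z"
    by auto
  from z(1) obtain E where E: "equiv A E" "z = A // E" "E \<noteq> A \<times> A"
    and inv: "\<And>g x y. g \<in> G \<Longrightarrow> x \<in> A \<Longrightarrow> y \<in> A \<Longrightarrow> (De g x, De g y) \<in> E \<longleftrightarrow> (x, y) \<in> E"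
    by (metis PE)
  have le: "Fib k \<subseteq> E" and ne: "E \<noteq> Fib k"
    using z E by (auto simp: fib_def refines_quotient_iff equiv_Fib)
  define F where "F = {(i, i') \<in> {1..d} \<times> {1..d}. (lift k i 1, lift k i' 1) \<in> E}"
  have one: "1 \<in> {1..m}"
    by (rule one_in_m)
  have F: "equiv {1..d} F"
    unfolding F_def using lift_in [OF k _ one] by (intro equiv_pullback [OF E(1)])
  \<comment> \<open>\<open>Fib k \<subseteq> E\<close> relates each point to the point of the first
    column in the same position.\<close>
  have bottom: "(lift k (pos k x) 1, x) \<in> E" if "x \<in> A" for x
    using le that lift_in [OF k pos_in [OF k that] one] pos_lift [OF k pos_in [OF k that] one] by (auto simp: Fib_def)
  have "(x, y) \<in> E \<longleftrightarrow> (lift k (pos k x) 1, lift k (pos k y) 1) \<in> E" if "x \<in> A" "y \<in> A" for x y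
    using bottom [OF that(1)] bottom [OF that(2)] equivD(3,4) [OF E(1)] by meson
  then have Up: "Up k F = E"
    using equivD(1) [OF E(1)] pos_in [OF k] by (auto simp: Up_def F_def)
  have "{1..d} // F \<in> D"
    unfolding D_iff [OF F]
  proof (intro conjI ballI)
    show "F \<noteq> {1..d} \<times> {1..d}" "F \<noteq> Id_on {1..d}"
      using E(3) ne Up Up_full Up_Id by metis+
    show "(g i, g i') \<in> F \<longleftrightarrow> (i, i') \<in> F" if "g \<in> G" "i \<in> {1..d}" "i' \<in> {1..d}" for g i i'
      using inv [OF that(1) lift_in [OF k that(2) one] lift_in [OF k that(3) one]] that G_in one
      by (simp add: F_def De_lift [OF k])
  qed
  then show "z \<in> up k ` D"
    using up_quotient [OF F] Up E(2) by (metis imageI)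
qed

text \<open>A relation inside \<open>Fib k\<close> splits into relations on the set of columns, one
  for each position. Transitivity of \<open>G\<close> makes them all equal to the one at position 1,
  on which invariance imposes nothing; so all proper partitions of \<open>{1..m}\<close>
  occur.\<close>

lemma dn_image: "dn k ` M = {x \<in> P. x \<noteq> fib k \<and> refines A x (fib k)}"
proof (intro equalityI subsetI)
  fix z assume "z \<in> dn k ` M"
  then obtain b where "b \<in> M" "z = dn k b"
    by blast
  then obtain F where F: "equiv {1..m} F" "z = dn k ({1..m} // F)" "F \<noteq> {1..m} \<times> {1..m}" "F \<noteq> Id_on {1..m}"
    by (metis ME)
  have z: "z = A // Dn k F"
    using F by (simp add: dn_quotient)
  have sub: "F \<subseteq> {1..m} \<times> {1..m}" "Id_on {1..m} \<subseteq> {1..m} \<times> {1..m}"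
    using equivD(1) [OF F(1)] by auto
  have le: "Dn k F \<subseteq> Fib k" and ne: "Dn k F \<noteq> Fib k" "Dn k F \<noteq> Id_on A"
    using sub F(3,4) Dn_eq_iff [of F] Dn_mono_iff [of F "{1..m} \<times> {1..m}"] by (auto simp: Dn_Id [symmetric] Dn_full [symmetric])
  have "Fib k \<subseteq> A \<times> A"
    by (auto simp: Fib_def)
  then have ne': "Dn k F \<noteq> A \<times> A"
    using le ne(1) by (metis subset_antisym)
  have "z \<in> P"
    unfolding z P_iff [OF equiv_Dn [OF F(1)]]
    by (intro conjI ballI ne ne') (rule Dn_invariant)
  then show "z \<in> {x \<in> P. x \<noteq> fib k \<and> refines A x (fib k)}"
    using le ne by (simp add: z fib_def quotient_eq_quotient_iff refines_quotient_iff equiv_Dn F(1) equiv_Fib)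
next
  fix z assume "z \<in> {x \<in> P. x \<noteq> fib k \<and> refines A x (fib k)}"
  then have z: "z \<in> P" "z \<noteq> fib k" "refines A z (fib k)"
    by auto
  from z(1) obtain E where E: "equiv A E" "z = A // E" "E \<noteq> Id_on A"
    and inv: "\<And>g x y. g \<in> G \<Longrightarrow> x \<in> A \<Longrightarrow> y \<in> A \<Longrightarrow> (De g x, De g y) \<in> E \<longleftrightarrow> (x, y) \<in> E"
    by (metis PE)
  have le: "E \<subseteq> Fib k" and ne: "E \<noteq> Fib k"
    using z E by (auto simp: fib_def refines_quotient_iff equiv_Fib)
  define F where "F = {(j, j') \<in> {1..m} \<times> {1..m}. (lift k 1 j, lift k 1 j') \<in> E}"
  have one: "1 \<in> {1..d}"
    by (rule one_in_d)
  have F: "equiv {1..m} F"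
    unfolding F_def using lift_in [OF k one] by (intro equiv_pullback [OF E(1)])
  \<comment> \<open>An element of \<open>G\<close> that takes position 1 to \<open>i\<close> carries
    the points at position 1 to those at position \<open>i\<close> without changing columns.\<close>
  have *: "(lift k i j, lift k i j') \<in> E \<longleftrightarrow> (lift k 1 j, lift k 1 j') \<in> E"
    if "i \<in> {1..d}" "j \<in> {1..m}" "j' \<in> {1..m}" for i j j'
  proof -
    from transitive one that(1) obtain g where g: "g \<in> G" "g 1 = i"
      by metis
    show ?thesis
      using inv [OF g(1) lift_in [OF k one that(2)] lift_in [OF k one that(3)]] g one that
      by (simp add: De_lift [OF k])
  qed
  have "(x, y) \<in> E \<longleftrightarrow> pos k x = pos k y \<and> (lift k 1 (col x), lift k 1 (col y)) \<in> E" if "x \<in> A" "y \<in> A" for x y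
  proof (cases "pos k x = pos k y")
    case True
    then show ?thesis
      using * [OF pos_in [OF k that(1)] col_in [OF that(1)] col_in [OF that(2)]]
        lift_pos_col [OF k that(1)] lift_pos_col [OF k that(2)] by simp
  next
    case False
    then show ?thesis
      using le by (auto simp: Fib_def)
  qed
  then have Dn: "Dn k F = E"
    using equivD(1) [OF E(1)] col_in by (auto simp: Dn_def F_def)
  have "{1..m} // F \<in> M"
    unfolding M_iff [OF F]
    using E(3) ne Dn Dn_full Dn_Id by metis
  then show "z \<in> dn k ` M"
    using dn_quotient [OF F] Dn E(2) by (metis imageI)
qed

lemma inj_up: "inj_on (up k) D"
proof (rule inj_onI)
  fix a a' assume a: "a \<in> D" "a' \<in> D" "up k a = up k a'"
  then have "refines {1..d} a a" "refines {1..d} a' a'"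
    by (auto simp: invariant_partitions_def intro: refines_refl)
  then show "a = a'"
    using a up_refines_iff by (metis refines_asym)
qed

lemma inj_dn: "inj_on (dn k) M"
proof (rule inj_onI)
  fix b b' assume b: "b \<in> M" "b' \<in> M" "dn k b = dn k b'"
  then have "refines {1..m} b b" "refines {1..m} b' b'"
    by (auto simp: partition_poset_def intro: refines_refl)
  then show "b = b'"
    using b dn_refines_iff by (metis refines_asym)
qed

end

end

section \<open>The action of the centralizer\<close>

lemma refines_image:
  assumes g: "g permutes A" and ref: "refines A P Q"
  shows "refines A ((`) g ` P) ((`) g ` Q)"
proof -
  have "partition_on A ((`) g ` R)" if "partition_on A R" for R
    using image_quotient(1,2) [OF equiv_same_block [OF that] g] partition_on_quotient
    by (simp add: quotient_same_block [OF that])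
  then show ?thesis
    using ref unfolding refines_def by (metis (no_types, lifting) image_iff image_mono)
qed

lemma image_permutes_inverse:
  assumes "g permutes A"
  shows "(`) (inv_into UNIV g) ` (`) g ` Q = Q" "(`) g ` (`) (inv_into UNIV g) ` Q = Q"
  using assms by (simp_all add: image_image permutes_inverses)

context orbit_system
begin

lemma C_permutes: "c \<in> carrier C \<Longrightarrow> c permutes {1..d}"
  by (simp add: C_iff)

text \<open>Since \<open>h\<close> commutes with \<open>G\<close>, it preserves invariance; the two
  trivial partitions are excluded by pulling them back along \<open>h\<close>.\<close>

lemma image_C_in_D:
  assumes h: "h \<in> carrier C" and a: "a \<in> D"
  shows "(`) h ` a \<in> D"
proof -
  note hp = C_permutes [OF h]
  have part: "partition_on {1..d} a" and fixed: "\<And>g. g \<in> G \<Longrightarrow> (`) g ` a = a"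
    and ne: "a \<noteq> {{1..d}}" "a \<noteq> (\<lambda>i. {i}) ` {1..d}"
    using a by (auto simp: invariant_partitions_def)
  have inv_image: "inv_into UNIV h ` {1..d} = {1..d}"
    by (rule permutes_image [OF permutes_inv [OF hp]])
  have pull_back: "a = (`) (inv_into UNIV h) ` X" if "(`) h ` a = X" for X
    using image_permutes_inverse(1) [OF hp, of a] that by simp
  have "(`) h ` a \<noteq> {{1..d}}"
    using pull_back [of "{{1..d}}"] ne(1) inv_image by auto
  moreover have "(`) h ` a \<noteq> (\<lambda>i. {i}) ` {1..d}"
  proof
    assume "(`) h ` a = (\<lambda>i. {i}) ` {1..d}"
    then have "a = (`) (inv_into UNIV h) ` (\<lambda>i. {i}) ` {1..d}"
      by (rule pull_back)
    also have "\<dots> = (\<lambda>i. {i}) ` inv_into UNIV h ` {1..d}"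
      by (simp add: image_image)
    finally show False
      using ne(2) inv_image by simp
  qed
  moreover have "(`) g ` (`) h ` a = (`) h ` a" if g: "g \<in> G" for g
  proof -
    have "(`) g ` (`) h ` a = (`) h ` (`) g ` a"
      unfolding image_image using C_commute [OF h g] by (auto intro!: image_cong)
    then show ?thesis
      using fixed [OF g] by simp
  qed
  moreover have "partition_on {1..d} ((`) h ` a)"
    using refines_image [OF hp refines_refl [OF part]] by (simp add: refines_def)
  ultimately show ?thesis
    by (simp add: invariant_partitions_def)
qed

context
  fixes k h assumes k: "k \<in> carrier K" and h: "h \<in> carrier C"
begin

abbreviation (input) "kh \<equiv> k \<otimes>\<^bsub>K\<^esub> diagonal m h"

lemma shift_carrier: "kh \<in> carrier K"
  unfolding K_mult_diagonal K_carrier using C_comp [OF K_in [OF k] h] by (intro restrict_PiE_iff [THEN iffD2]) auto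

text \<open>The same permutation relabels the positions in all columns. Relations that only ask
  whether positions agree, as \<open>Fib\<close> and \<open>Dn\<close> do, are therefore unchanged,
  while \<open>Up\<close> is transported by \<open>h\<close>.\<close>

lemma pos_shift: "x \<in> A \<Longrightarrow> pos kh x = inv_into UNIV h (pos k x)"
  using o_inv_distrib [OF permutes_bij [OF C_permutes [OF K_in [OF k col_in]]] permutes_bij [OF C_permutes [OF h]], of x] col_in [of x]
  by (simp add: pos_def K_mult_diagonal)

lemma pos_shift_eq_iff: "x \<in> A \<Longrightarrow> y \<in> A \<Longrightarrow> pos kh x = pos kh y \<longleftrightarrow> pos k x = pos k y"
  using C_inverses(1) [OF h] by (metis pos_shift)

lemma Fib_shift: "Fib kh = Fib k"
  using pos_shift_eq_iff by (auto simp: Fib_def)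

lemma Dn_shift: "Dn kh F = Dn k F"
  using pos_shift_eq_iff by (auto simp: Dn_def)

lemma up_shift_image:
  assumes "a \<in> D"
  shows "up kh a = up k ((`) h ` a)"
proof -
  from assms obtain F where F: "equiv {1..d} F" "a = {1..d} // F"
    using DE by metis
  define F' where "F' = {(i, i') \<in> {1..d} \<times> {1..d}. (inv_into UNIV h i, inv_into UNIV h i') \<in> F}"
  note F' = image_quotient(1,2) [OF F(1) C_permutes [OF h], folded F'_def]
  have "Up kh F = Up k F'"
    using pos_shift pos_in [OF k] by (auto simp: Up_def F'_def)
  then show ?thesis
    using F F' up_quotient [OF shift_carrier F(1)] up_quotient [OF k F'(1)] by simp
qed

text \<open>The sum is reindexed along the permutation of \<open>D\<close> by \<open>h\<close>.
  Because of the inverse in \<open>perm_act\<close>, the coordinate of \<open>t\<close> at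
  \<open>a\<close> reappears at the image of \<open>a\<close> under \<open>h\<close>.\<close>

lemma push_up_shift: "push (up kh) D t = push (up k) D (perm_act h t)"
proof
  fix v
  note inv = image_permutes_inverse [OF C_permutes [OF h]]
  have "(\<Sum>a\<in>D. if up kh a = v then t a else 0) = (\<Sum>a\<in>D. if up k a = v then perm_act h t a else 0)"
    by (rule sum.reindex_bij_witness [where i = "\<lambda>a. (`) (inv_into UNIV h) ` a" and j = "\<lambda>a. (`) h ` a"])
      (simp_all add: inv image_C_in_D h C_inv up_shift_image perm_act_def)
  then show "push (up kh) D t v = push (up k) D (perm_act h t) v"
    by (simp add: push_def)
qed

end

lemma perm_act_barycentric:
  assumes h: "h \<in> carrier C" and t: "t \<in> barycentric (refines {1..d}) D"
  shows "perm_act h t \<in> barycentric (refines {1..d}) D"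
proof -
  note inv = image_permutes_inverse [OF C_permutes [OF h]]
  have act: "perm_act h t a = t ((`) (inv_into UNIV h) ` a)" for a
    by (simp add: perm_act_def)
  have "sum (perm_act h t) D = sum t D"
    by (rule sum.reindex_bij_witness [where j = "\<lambda>a. (`) (inv_into UNIV h) ` a" and i = "\<lambda>a. (`) h ` a"])
      (simp_all add: inv image_C_in_D h C_inv act)
  moreover have "perm_act h t a = 0" if "a \<notin> D" for a
    using barycentricD(2) [OF t] image_C_in_D [OF h] inv that unfolding act by metis
  moreover have "refines {1..d} a b \<or> refines {1..d} b a" if "perm_act h t a \<noteq> 0" "perm_act h t b \<noteq> 0" for a b
    using barycentricD(3) [OF t that [unfolded act]] refines_image [OF C_permutes [OF h]] inv by metis
  ultimately show ?thesis
    using barycentricD(1,4) [OF t] by (simp add: barycentric_def act)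
qed

text \<open>The points \<open>lift k i j\<close> with \<open>i\<close> fixed have equal positions
  for \<open>k\<close>, hence also for \<open>k'\<close>. So the inverse of \<open>k' j\<close>
  composed with \<open>k j\<close> does not depend on the column \<open>j\<close>, and its value at
  the first column serves as \<open>h\<close>.\<close>

lemma fib_coset:
  assumes k: "k \<in> carrier K" and k': "k' \<in> carrier K" and eq: "fib k = fib k'"
  shows "\<exists>h\<in>carrier C. k = k' \<otimes>\<^bsub>K\<^esub> diagonal m h"
proof
  define h where "h = inv_into UNIV (k' 1) \<circ> k 1"
  have "Fib k = Fib k'"
    using eq quotient_eq_quotient_iff [OF equiv_Fib [OF k] equiv_Fib [OF k']] by (simp add: fib_def)
  then have pos_eq: "pos k' x = pos k' y" if "x \<in> A" "y \<in> A" "pos k x = pos k y" for x y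
    using that by (auto simp: Fib_def)
  note c = K_in [OF k] and c' = K_in [OF k']
  show h: "h \<in> carrier C"
    unfolding h_def by (rule C_comp [OF C_inv [OF c' [OF one_in_m]] c [OF one_in_m]])
  have k_eq: "k j i = k' j (h i)" if j: "j \<in> {1..m}" for i j
  proof (cases "i \<in> {1..d}")
    case True
    note lifts = lift_in [OF k True] pos_lift [OF k True] col_lift [OF k True]
    have pos': "pos k' (lift k i j) = inv_into UNIV (k' j) (k j i)" if "j \<in> {1..m}" for j
      unfolding pos_def lifts(3) [OF that] by (simp add: lift_def row_entry [OF C_in [OF c [OF that] True]])
    have "inv_into UNIV (k' j) (k j i) = inv_into UNIV (k' 1) (k 1 i)"
      using pos_eq [OF lifts(1) [OF j] lifts(1) [OF one_in_m]] lifts(2) j one_in_m pos' by simp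
    then show ?thesis
      using C_inverses(1) [OF c' [OF j]] by (metis comp_apply h_def)
  next
    case False
    then show ?thesis
      using permutes_not_in [OF C_permutes [OF c [OF j]]] permutes_not_in [OF C_permutes [OF c' [OF j]]]
        permutes_not_in [OF C_permutes [OF h]] by metis
  qed
  show "k = k' \<otimes>\<^bsub>K\<^esub> diagonal m h"
  proof
    fix j
    show "k j = (k' \<otimes>\<^bsub>K\<^esub> diagonal m h) j"
    proof (cases "j \<in> {1..m}")
      case True
      then show ?thesis
        unfolding K_mult_diagonal using k_eq by (simp add: ext)
    next
      case False
      then show ?thesis
        unfolding K_mult_diagonal using k PiE_arb [of k "{1..m}"] by (simp add: K_carrier)
    qed
  qed
qed

lemma finite_carrier_K: "finite (carrier K)"
proof -
  have "finite (carrier C)"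
    by (rule finite_subset [OF _ finite_permutations [of "{1..d}"]]) (simp_all add: subset_iff C_permutes)
  then show ?thesis
    unfolding K_carrier by (simp add: finite_PiE)
qed

lemma carrier_K_ne: "carrier K \<noteq> {}"
proof -
  have "id \<in> carrier C"
    by (simp add: C_iff permutes_id)
  then have "(\<lambda>j\<in>{1..m}. id) \<in> carrier K"
    by (simp add: K_carrier)
  then show ?thesis
    by blast
qed

text \<open>The ambient poset is that of all partitions, so that it contains \<open>fib k\<close>
  even when this is one of the two trivial partitions.\<close>

lemma interval_system:
  "interval_system (refines A) {Q. partition_on A Q} P (refines {1..d}) D (refines {1..m}) M
     K C (diagonal m) up dn fib perm_act"
proof (intro interval_system.intro interval_system_axioms.intro finite_poset_refines)
  show "P \<subseteq> {Q. partition_on A Q}"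
    by (auto simp: invariant_partitions_def)
  show "finite D"
    by (rule finite_subset [OF _ finitely_many_partition_on [of "{1..d}"]]) (auto simp: invariant_partitions_def)
  show "finite M"
    by (rule finite_subset [OF _ finitely_many_partition_on [of "{1..m}"]]) (auto simp: partition_poset_def)
  show "fib k \<in> {Q. partition_on A Q}" if "k \<in> carrier K" for k
    using partition_on_quotient [OF equiv_Fib [OF that]] by (simp add: fib_def)
  show "bij_betw (up k) D {x \<in> P. x \<noteq> fib k \<and> refines A (fib k) x}"
    "bij_betw (dn k) M {x \<in> P. x \<noteq> fib k \<and> refines A x (fib k)}" if "k \<in> carrier K" for k
    using inj_up [OF that] inj_dn [OF that] up_image [OF that] dn_image [OF that] by (simp_all add: bij_betw_def)
  show "refines A (up k a) (up k a') \<longleftrightarrow> refines {1..d} a a'" if "k \<in> carrier K" "a \<in> D" "a' \<in> D" for k a a'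
    using that by (rule up_refines_iff)
  show "refines A (dn k a) (dn k a') \<longleftrightarrow> refines {1..m} a a'" if "k \<in> carrier K" "a \<in> M" "a' \<in> M" for k a a'
    using that by (rule dn_refines_iff)
  show "\<exists>h\<in>carrier C. k = k' \<otimes>\<^bsub>K\<^esub> diagonal m h"
    if "k \<in> carrier K" "k' \<in> carrier K" "fib k = fib k'" for k k'
    using that by (rule fib_coset)
  show "fib (k \<otimes>\<^bsub>K\<^esub> diagonal m h) = fib k" if "k \<in> carrier K" "h \<in> carrier C" for k h
    by (simp add: fib_def Fib_shift [OF that])
  show "push (up (k \<otimes>\<^bsub>K\<^esub> diagonal m h)) D t = push (up k) D (perm_act h t)"
    if "k \<in> carrier K" "h \<in> carrier C" for k h t
    by (rule push_up_shift [OF that])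
  show "dn (k \<otimes>\<^bsub>K\<^esub> diagonal m h) b = dn k b" if "k \<in> carrier K" "h \<in> carrier C" for k h b
    by (simp add: dn_def Dn_shift [OF that])
  show "perm_act h t \<in> barycentric (refines {1..d}) D" if "h \<in> carrier C" "t \<in> barycentric (refines {1..d}) D" for h t
    using that by (rule perm_act_barycentric)
qed (simp_all add: finite_carrier_K)

text \<open>A class of either relation has exactly one point in each column. If \<open>x\<close> and
  \<open>y\<close> have equal positions for \<open>k'\<close>, then the point of the
  \<open>k\<close>-class of \<open>x\<close> in the column of \<open>y\<close> must be
  \<open>y\<close>.\<close>

lemma fib_antichain:
  assumes k: "k \<in> carrier K" and k': "k' \<in> carrier K" and ref: "refines A (fib k) (fib k')"
  shows "fib k = fib k'"
proof -
  have le: "Fib k \<subseteq> Fib k'"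
    using ref by (simp add: fib_def refines_quotient_iff equiv_Fib k k')
  have "(x, y) \<in> Fib k" if xy: "(x, y) \<in> Fib k'" for x y
  proof -
    have x: "x \<in> A" and y: "y \<in> A" and pos: "pos k' x = pos k' y"
      using xy by (auto simp: Fib_def)
    define z where "z = lift k (pos k x) (col y)"
    have z: "z \<in> A" "pos k z = pos k x" "col z = col y"
      unfolding z_def using lift_in [OF k pos_in [OF k x] col_in [OF y]] pos_lift [OF k pos_in [OF k x] col_in [OF y]]
        col_lift [OF k pos_in [OF k x] col_in [OF y]] by auto
    have "(x, z) \<in> Fib k"
      using x z by (simp add: Fib_def)
    then have "pos k' z = pos k' y"
      using le pos by (auto simp: Fib_def)
    then have "z = y"
      using pos_col_eqD [OF k' z(1) y] z by simp
    then show ?thesis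
      using x y z by (simp add: Fib_def)
  qed
  then have "Fib k = Fib k'"
    using le by auto
  then show ?thesis
    by (simp add: fib_def)
qed

text \<open>The meet is the quotient by the intersection of the two relations; the common lower
  bound \<open>w\<close> keeps it from being the partition into singletons.\<close>

lemma meets:
  assumes "x \<in> P" "y \<in> P" "w \<in> P" "refines A w x" "refines A w y"
  shows "\<exists>z\<in>P. refines A z x \<and> refines A z y \<and> (\<forall>w\<in>P. refines A w x \<and> refines A w y \<longrightarrow> refines A w z)"
proof -
  obtain E where E: "equiv A E" "x = A // E" "E \<noteq> A \<times> A"
    and E_inv: "\<And>g x y. g \<in> G \<Longrightarrow> x \<in> A \<Longrightarrow> y \<in> A \<Longrightarrow> (De g x, De g y) \<in> E \<longleftrightarrow> (x, y) \<in> E"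
    using PE [OF assms(1)] by metis
  obtain F where F: "equiv A F" "y = A // F"
    and F_inv: "\<And>g x y. g \<in> G \<Longrightarrow> x \<in> A \<Longrightarrow> y \<in> A \<Longrightarrow> (De g x, De g y) \<in> F \<longleftrightarrow> (x, y) \<in> F"
    using PE [OF assms(2)] by metis
  obtain W where W: "equiv A W" "w = A // W" "W \<noteq> Id_on A"
    using PE [OF assms(3)] by metis
  have EF: "equiv A (E \<inter> F)"
    using equivD(1-3) [OF E(1)] equivD(1-3) [OF F(1)]
    by (rule_tac equiv_intro) (auto intro: equivD(4) [OF E(1)] equivD(4) [OF F(1)])
  have "W \<subseteq> E \<inter> F" "Id_on A \<subseteq> W" "E \<inter> F \<subseteq> A \<times> A"
    using assms(4,5) E F W equivD(1) [OF E(1)] equivD(2) [OF W(1)] by (auto simp: refines_quotient_iff)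
  then have "E \<inter> F \<noteq> Id_on A" "E \<inter> F \<noteq> A \<times> A"
    using W(3) E(3) equivD(1) [OF E(1)] by blast+
  then have "A // (E \<inter> F) \<in> P"
    unfolding P_iff [OF EF] using E_inv F_inv by simp
  moreover have "refines A u (A // (E \<inter> F))" if "u \<in> P" "refines A u x" "refines A u y" for u
    using PE [OF that(1)] that(2,3) E F EF by (metis refines_quotient_iff le_inf_iff)
  ultimately show ?thesis
    using E F EF by (intro bexI [of _ "A // (E \<inter> F)"]) (auto simp: refines_quotient_iff)
qed

text \<open>With a single position any two points are related, with a single column no two distinct
  points are. So \<open>fib k\<close> is the top or the bottom partition and is comparable with
  everything.\<close>

lemma link_fib_trivial:
  assumes k: "k \<in> carrier K" and "d = 1 \<or> m = 1"
  shows "link (refines A) P (fib k) = P" and "Fib k = (if d = 1 then A \<times> A else Id_on A)"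
proof -
  show F: "Fib k = (if d = 1 then A \<times> A else Id_on A)"
  proof (cases "d = 1")
    case True
    then have "pos k x = 1" if "x \<in> A" for x
      using pos_in [OF k that] by simp
    then have "Fib k = A \<times> A"
      unfolding Fib_def by auto
    then show ?thesis
      using True by simp
  next
    case False
    then have "col x = 1" if "x \<in> A" for x
      using col_in [OF that] assms(2) by simp
    then have "(x, y) \<in> Fib k \<longleftrightarrow> (x, y) \<in> Id_on A" for x y
      using pos_col_eqD [OF k] by (auto simp: Fib_def)
    then show ?thesis
      using False by (simp add: set_eq_iff split_paired_all)
  qed
  have "z \<noteq> fib k \<and> (refines A z (fib k) \<or> refines A (fib k) z)" if "z \<in> P" for z
  proof -
    from that obtain E where E: "equiv A E" "z = A // E" "E \<noteq> A \<times> A" "E \<noteq> Id_on A"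
      using PE by metis
    then show ?thesis
      using F equivD(1,2) [OF E(1)] equiv_Fib [OF k]
      by (auto simp: fib_def quotient_eq_quotient_iff refines_quotient_iff split: if_splits)
  qed
  then show "link (refines A) P (fib k) = P"
    by (auto simp: link_def)
qed

end

section \<open>Complements of the orbit partition\<close>

context orbit_system
begin

definition "orbits = A // Col"

lemma Fib_neq:
  assumes k: "k \<in> carrier K"
  shows "d \<ge> 2 \<Longrightarrow> Fib k \<noteq> A \<times> A" and "m \<ge> 2 \<Longrightarrow> Fib k \<noteq> Id_on A"
proof -
  show "Fib k \<noteq> A \<times> A" if "d \<ge> 2"
  proof -
    have "2 \<in> {1..d}"
      using that by (simp add: atLeastAtMost_iff)
    then have "lift k 1 1 \<in> A" "lift k 2 1 \<in> A" "pos k (lift k 1 1) \<noteq> pos k (lift k 2 1)"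
      using lift_in [OF k _ one_in_m] pos_lift [OF k _ one_in_m] one_in_d by simp_all
    then show ?thesis
      by (auto simp: Fib_def)
  qed
  show "Fib k \<noteq> Id_on A" if "m \<ge> 2"
  proof -
    have "2 \<in> {1..m}"
      using that by (simp add: atLeastAtMost_iff)
    then have "lift k 1 1 \<in> A" "lift k 1 2 \<in> A" "pos k (lift k 1 1) = pos k (lift k 1 2)"
      "col (lift k 1 1) \<noteq> col (lift k 1 2)"
      using lift_in [OF k one_in_d] pos_lift [OF k one_in_d] col_lift [OF k one_in_d] one_in_m by simp_all
    then have "(lift k 1 1, lift k 1 2) \<in> Fib k" "lift k 1 1 \<noteq> lift k 1 2"
      by (auto simp: Fib_def)
    then show ?thesis
      by auto
  qed
qed

lemma Col_neq: "m \<ge> 2 \<Longrightarrow> Col \<noteq> A \<times> A" "d \<ge> 2 \<Longrightarrow> Col \<noteq> Id_on A"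
proof -
  show "Col \<noteq> A \<times> A" if "m \<ge> 2"
  proof -
    have "2 \<in> {1..m}"
      using that by (simp add: atLeastAtMost_iff)
    then have "entry 1 1 \<in> A" "entry 1 2 \<in> A" "col (entry 1 1) \<noteq> col (entry 1 2)"
      using entry_in [OF one_in_d] col_entry [OF one_in_d] one_in_m by simp_all
    then show ?thesis
      by (auto simp: Col_def)
  qed
  show "Col \<noteq> Id_on A" if "d \<ge> 2"
  proof -
    have "2 \<in> {1..d}"
      using that by (simp add: atLeastAtMost_iff)
    then have "entry 1 1 \<in> A" "entry 2 1 \<in> A" "col (entry 1 1) = col (entry 2 1)"
      "row (entry 1 1) \<noteq> row (entry 2 1)"
      using entry_in [OF _ one_in_m] col_entry [OF _ one_in_m] row_entry one_in_d by simp_all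
    then have "(entry 1 1, entry 2 1) \<in> Col" "entry 1 1 \<noteq> entry 2 1"
      by (auto simp: Col_def)
    then show ?thesis
      by auto
  qed
qed

lemma orbits_in_P:
  assumes "d \<ge> 2" "m \<ge> 2"
  shows "orbits \<in> P"
  unfolding orbits_def P_iff [OF equiv_Col] using Col_neq assms by (simp add: Col_def De_in col_De)

lemma fib_in_P:
  assumes k: "k \<in> carrier K" and dm: "d \<ge> 2" "m \<ge> 2"
  shows "fib k \<in> P"
proof -
  have "g (pos k x) = g (pos k y) \<longleftrightarrow> pos k x = pos k y" if "g \<in> G" for g x y
    by (rule inj_eq [OF permutes_inj [OF G_permutes [OF that]]])
  then show ?thesis
    unfolding fib_def P_iff [OF equiv_Fib [OF k]] using Fib_neq [OF k] dm
    by (simp add: Fib_def De_in pos_De [OF k])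
qed

text \<open>\<open>Fib k\<close> and \<open>Col\<close> are equality of one coordinate each. Points
  that agree in both are equal, and any two points are linked through the point with the position of
  one and the column of the other.\<close>

lemma fib_complement:
  assumes k: "k \<in> carrier K" and dm: "d \<ge> 2" "m \<ge> 2"
  shows "fib k \<in> complements (refines A) P orbits"
proof -
  have False if w: "w \<in> P" "refines A w (fib k)" "refines A w orbits" for w
  proof -
    from w(1) obtain E where E: "equiv A E" "w = A // E" "E \<noteq> Id_on A"
      using PE by metis
    then have "E \<subseteq> Fib k \<inter> Col"
      using w by (simp add: fib_def orbits_def refines_quotient_iff equiv_Fib [OF k] equiv_Col)
    moreover have "Fib k \<inter> Col \<subseteq> Id_on A"
      using pos_col_eqD [OF k] by (auto simp: Fib_def Col_def)
    moreover have "Id_on A \<subseteq> E"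
      using equivD(2) [OF E(1)] by auto
    ultimately show False
      using E(3) by auto
  qed
  moreover have False if w: "w \<in> P" "refines A (fib k) w" "refines A orbits w" for w
  proof -
    from w(1) obtain E where E: "equiv A E" "w = A // E" "E \<noteq> A \<times> A"
      using PE by metis
    then have sub: "Fib k \<subseteq> E" "Col \<subseteq> E"
      using w by (simp_all add: fib_def orbits_def refines_quotient_iff equiv_Fib [OF k] equiv_Col)
    have "(x, y) \<in> E" if x: "x \<in> A" and y: "y \<in> A" for x y
    proof -
      let ?z = "lift k (pos k x) (col y)"
      have "?z \<in> A" "pos k ?z = pos k x" "col ?z = col y"
        using lift_in [OF k pos_in [OF k x] col_in [OF y]] pos_lift [OF k pos_in [OF k x] col_in [OF y]]
          col_lift [OF k pos_in [OF k x] col_in [OF y]] by auto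
      then have "(x, ?z) \<in> Fib k" "(?z, y) \<in> Col"
        using x y by (simp_all add: Fib_def Col_def)
      then show ?thesis
        using sub equivD(4) [OF E(1)] by (metis subsetD)
    qed
    then show False
      using E(3) equivD(1) [OF E(1)] by auto
  qed
  ultimately show ?thesis
    unfolding complements_def using fib_in_P [OF k dm] by auto
qed

text \<open>
  If \<open>E\<close> has no nontrivial meet and no proper join with the orbit relation, then every class of
  \<open>E\<close> meets every orbit in exactly one point.
\<close>

lemma complement_is_fib:
  assumes dm: "d \<ge> 2" "m \<ge> 2" and z: "z \<in> complements (refines A) P orbits"
  shows "\<exists>k\<in>carrier K. z = fib k"
proof -
  have zP: "z \<in> P" and no_lower: "\<And>w. w \<in> P \<Longrightarrow> refines A w z \<Longrightarrow> \<not> refines A w orbits"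
    and no_upper: "\<And>w. w \<in> P \<Longrightarrow> refines A z w \<Longrightarrow> \<not> refines A orbits w"
    using z by (auto simp: complements_def)
  from zP obtain E where E: "equiv A E" "z = A // E"
    and inv: "\<And>g x y. g \<in> G \<Longrightarrow> x \<in> A \<Longrightarrow> y \<in> A \<Longrightarrow> (De g x, De g y) \<in> E \<longleftrightarrow> (x, y) \<in> E"
    using PE by metis
  note E_sub = equivD(1) [OF E(1)] and E_refl = equivD(2) [OF E(1)]
    and E_sym = equivD(3) [OF E(1)] and E_trans = equivD(4) [OF E(1)]
  \<comment> \<open>A larger intersection would give a proper common lower bound of \<open>z\<close>
    and \<open>orbits\<close>.\<close>
  have E_Col: "E \<inter> Col = Id_on A"
  proof (rule ccontr)
    assume ne: "E \<inter> Col \<noteq> Id_on A"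
    have eq: "equiv A (E \<inter> Col)"
    proof (rule equiv_intro, goal_cases)
      case (4 x y w)
      then show ?case
        using E_trans [of x y w] equivD(4) [OF equiv_Col, of x y w] by simp
    qed (use E_sub E_refl E_sym equivD(2,3) [OF equiv_Col] in auto)
    have "E \<inter> Col \<noteq> A \<times> A"
      using Col_neq(1) [OF dm(2)] equivD(1) [OF equiv_Col] by auto
    then have "A // (E \<inter> Col) \<in> P"
      unfolding P_iff [OF eq] using ne inv by (simp add: Col_def De_in col_De)
    then show False
      using no_lower [of "A // (E \<inter> Col)"] E by (simp add: orbits_def refines_quotient_iff eq equiv_Col)
  qed
  have unique: "x = y" if xy: "(x, y) \<in> E" "col x = col y" for x y
  proof -
    have "(x, y) \<in> E \<inter> Col"
      using xy E_sub by (auto simp: Col_def)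
    then show ?thesis
      unfolding E_Col by auto
  qed
  have De_comp: "De h (De g x) = De (h \<circ> g) x" if "g \<in> G" "x \<in> A" for g h x
    using that De_in [OF that] by (simp add: De_entry [of _ h] De_entry [of _ "h \<circ> g"] row_De col_De)
  have De_id: "De id x = x" if "x \<in> A" for x
    using that by (simp add: De_entry entry_row_col)
  \<comment> \<open>The join of \<open>E\<close> and \<open>Col\<close>: since \<open>E\<close> is
    invariant under \<open>G\<close>, a move inside a column followed by a step in \<open>E\<close>
    already gives a transitive relation.\<close>
  define J where "J = {(x, y) \<in> A \<times> A. \<exists>g\<in>G. (De g x, y) \<in> E}"
  have JI: "(x, y) \<in> J" if "x \<in> A" "y \<in> A" "g \<in> G" "(De g x, y) \<in> E" for x y g
    using that by (auto simp: J_def)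
  have J_refl: "(x, x) \<in> J" if "x \<in> A" for x
    using JI [OF that that G_one] De_id [OF that] E_refl [OF that] by simp
  have J_sym: "(y, x) \<in> J" if xy: "(x, y) \<in> J" for x y
  proof -
    from xy obtain g where g: "g \<in> G" "(De g x, y) \<in> E" and x: "x \<in> A" and y: "y \<in> A"
      by (auto simp: J_def)
    have "(De (inv_into UNIV g) (De g x), De (inv_into UNIV g) y) \<in> E"
      using inv [OF G_inv [OF g(1)] De_in [OF g(1) x] y] g(2) by simp
    then have "(De (inv_into UNIV g) y, x) \<in> E"
      using De_inverse(1) [OF g(1) x] E_sym by simp
    then show ?thesis
      by (rule JI [OF y x G_inv [OF g(1)]])
  qed
  have J_trans: "(x, w) \<in> J" if xy: "(x, y) \<in> J" and yw: "(y, w) \<in> J" for x y w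
  proof -
    from xy obtain g where g: "g \<in> G" "(De g x, y) \<in> E" and x: "x \<in> A" and y: "y \<in> A"
      by (auto simp: J_def)
    from yw obtain h where h: "h \<in> G" "(De h y, w) \<in> E" and w: "w \<in> A"
      by (auto simp: J_def)
    have "(De h (De g x), De h y) \<in> E"
      using inv [OF h(1) De_in [OF g(1) x] y] g(2) by simp
    then have "(De (h \<circ> g) x, w) \<in> E"
      using De_comp [OF g(1) x] h(2) E_trans by metis
    then show ?thesis
      by (rule JI [OF x w G_mult [OF h(1) g(1)]])
  qed
  have J_sub: "J \<subseteq> A \<times> A"
    by (auto simp: J_def)
  have J: "equiv A J"
    by (rule equiv_intro [OF J_sub J_refl J_sym J_trans])
  have EJ: "E \<subseteq> J"
  proof (rule subrelI)
    fix x y assume xy: "(x, y) \<in> E"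
    then have "x \<in> A" "y \<in> A"
      using E_sub by auto
    then show "(x, y) \<in> J"
      using JI [OF _ _ G_one] De_id xy by simp
  qed
  have Col_J: "Col \<subseteq> J"
  proof (rule subrelI)
    fix x y assume "(x, y) \<in> Col"
    then have xy: "x \<in> A" "y \<in> A" "col x = col y"
      by (auto simp: Col_def)
    from transitive row_in obtain g where g: "g \<in> G" "g (row x) = row y"
      by metis
    then have "De g x = y"
      using xy entry_row_col [OF xy(2)] by (simp add: De_entry)
    then show "(x, y) \<in> J"
      using JI [OF xy(1,2) g(1)] E_refl xy(2) by simp
  qed
  have De_J: "(De h x, De h y) \<in> J" if h: "h \<in> G" and xy: "(x, y) \<in> J" for h x y
  proof -
    have move: "(w, De h w) \<in> J" if "w \<in> A" for w
      by (rule JI [OF that De_in [OF h that] h E_refl [OF De_in [OF h that]]])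
    have "x \<in> A" "y \<in> A"
      using xy J_sub by auto
    then show ?thesis
      using J_trans [OF J_sym [OF move] J_trans [OF xy move]] by simp
  qed
  have J_full: "J = A \<times> A"
  proof (rule ccontr)
    assume ne: "J \<noteq> A \<times> A"
    have ne': "J \<noteq> Id_on A"
    proof
      assume "J = Id_on A"
      moreover have "Id_on A \<subseteq> Col"
        by (auto simp: Col_def)
      ultimately show False
        using Col_J Col_neq(2) [OF dm(1)] by auto
    qed
    have De_J_iff: "(De g x, De g y) \<in> J \<longleftrightarrow> (x, y) \<in> J" if g: "g \<in> G" and x: "x \<in> A" and y: "y \<in> A" for g x y
      using De_J [OF g, of x y] De_J [OF G_inv [OF g], of "De g x" "De g y"] De_inverse(1) [OF g] x y by auto
    have "A // J \<in> P"
      unfolding P_iff [OF J] using ne ne' De_J_iff by simp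
    then show False
      using no_upper [of "A // J"] EJ Col_J E J by (simp add: orbits_def refines_quotient_iff equiv_Col)
  qed
  \<comment> \<open>The row in which column \<open>j\<close> meets the class of entry
    \<open>i\<close> of the first column. Existence comes from \<open>J_full\<close>, uniqueness
    from \<open>E_Col\<close>. Starting from the first column selects the tuple of the coset whose
    first member is the identity.\<close>
  define \<kappa> where "\<kappa> j i = (SOME i'. i' \<in> {1..d} \<and> (entry i 1, entry i' j) \<in> E)" for j i
  have \<kappa>: "\<kappa> j i \<in> {1..d} \<and> (entry i 1, entry (\<kappa> j i) j) \<in> E" if i: "i \<in> {1..d}" and j: "j \<in> {1..m}" for i j
  proof -
    have x: "entry i j \<in> A" and y: "entry i 1 \<in> A"
      using entry_in i j one_in_m by auto
    then have "(entry i j, entry i 1) \<in> J"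
      using J_full by simp
    then obtain g where g: "g \<in> G" "(De g (entry i j), entry i 1) \<in> E"
      by (auto simp: J_def)
    moreover have "De g (entry i j) = entry (g i) j"
      using De_entry [OF x] row_entry [OF i] col_entry [OF i j] by simp
    ultimately have "g i \<in> {1..d} \<and> (entry i 1, entry (g i) j) \<in> E"
      using G_in [OF g(1) i] E_sym by simp
    then show ?thesis
      unfolding \<kappa>_def by (rule someI)
  qed
  have \<kappa>_unique: "i' = \<kappa> j i"
    if i: "i \<in> {1..d}" and j: "j \<in> {1..m}" and i': "i' \<in> {1..d}" and e: "(entry i 1, entry i' j) \<in> E" for i j i'
  proof -
    have "(entry i' j, entry (\<kappa> j i) j) \<in> E"
      using \<kappa> [OF i j] e E_trans E_sym by metis
    then have "entry i' j = entry (\<kappa> j i) j"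
      by (rule unique) (use col_entry \<kappa> [OF i j] i' j in simp)
    then show ?thesis
      using row_entry \<kappa> [OF i j] i' by metis
  qed
  \<comment> \<open>Extended by the identity, since a permutation of \<open>{1..d}\<close> fixes all
    other numbers.\<close>
  define k where "k = (\<lambda>j\<in>{1..m}. \<lambda>i. if i \<in> {1..d} then \<kappa> j i else i)"
  have kj: "k j i = \<kappa> j i" if "i \<in> {1..d}" "j \<in> {1..m}" for i j
    using that by (simp add: k_def)
  have kC: "k j \<in> carrier C" if j: "j \<in> {1..m}" for j
    unfolding C_iff
  proof
    have inj: "inj_on (k j) {1..d}"
    proof (rule inj_onI)
      fix i i' assume i: "i \<in> {1..d}" "i' \<in> {1..d}" "k j i = k j i'"
      then have "(entry i 1, entry i' 1) \<in> E"
        using \<kappa> [OF i(1) j] \<kappa> [OF i(2) j] kj [OF i(1) j] kj [OF i(2) j] E_trans E_sym by metis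
      then have "entry i 1 = entry i' 1"
        by (rule unique) (use col_entry one_in_m i in simp)
      then show "i = i'"
        using row_entry i by metis
    qed
    have "k j ` {1..d} \<subseteq> {1..d}"
      using \<kappa> kj j by auto
    then have "k j ` {1..d} = {1..d}"
      using inj by (simp add: endo_inj_surj)
    then show "k j permutes {1..d}"
      using inj j by (intro bij_imp_permutes) (simp_all add: bij_betw_def k_def)
    show "\<forall>g\<in>G. k j \<circ> g = g \<circ> k j"
    proof (intro ballI ext)
      fix g i assume g: "g \<in> G"
      show "(k j \<circ> g) i = (g \<circ> k j) i"
      proof (cases "i \<in> {1..d}")
        case True
        note gi = G_in [OF g True] and \<kappa>i = \<kappa> [OF True j]
        have "(De g (entry i 1), De g (entry (\<kappa> j i) j)) \<in> E"
          using inv [OF g] \<kappa>i entry_in True j one_in_m by simp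
        then have "(entry (g i) 1, entry (g (\<kappa> j i)) j) \<in> E"
          using \<kappa>i True j one_in_m by (simp add: De_entry entry_in row_entry col_entry)
        \<comment> \<open>Translation by \<open>g\<close> yields a second point of column
          \<open>j\<close> in the class of entry \<open>g i\<close> of the first column; uniqueness
          turns this into commutation with \<open>g\<close>.\<close>
        then have "g (\<kappa> j i) = \<kappa> j (g i)"
          using \<kappa>_unique [OF gi j] G_in [OF g] \<kappa>i by simp
        then show ?thesis
          using kj [OF True j] kj [OF gi j] by simp
      next
        case False
        then have "g i = i"
          using permutes_not_in [OF G_permutes [OF g]] by simp
        then show ?thesis
          using False j by (simp add: k_def)
      qed
    qed
  qed
  have k: "k \<in> carrier K"
    unfolding K_carrier
  proof (rule PiE_I)
    show "k j = undefined" if "j \<notin> {1..m}" for j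
      using that by (simp add: k_def)
  qed (rule kC)
  \<comment> \<open>By the choice of \<open>k\<close> each point is related to the point of the
    first column at its position. Within that column distinct points are unrelated, so
    \<open>E\<close> is equality of positions.\<close>
  have to_first: "(entry (pos k x) 1, x) \<in> E" if x: "x \<in> A" for x
  proof -
    have "entry (\<kappa> (col x) (pos k x)) (col x) = x"
      using lift_pos_col [OF k x] kj [OF pos_in [OF k x] col_in [OF x]] by (simp add: lift_def)
    then show ?thesis
      using \<kappa> [OF pos_in [OF k x] col_in [OF x]] by metis
  qed
  have "(x, y) \<in> E \<longleftrightarrow> pos k x = pos k y" if x: "x \<in> A" and y: "y \<in> A" for x y
  proof
    assume "(x, y) \<in> E"
    then have "(entry (pos k x) 1, entry (pos k y) 1) \<in> E"
      using to_first [OF x] to_first [OF y] E_trans E_sym by metis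
    then have "entry (pos k x) 1 = entry (pos k y) 1"
      by (rule unique) (use col_entry one_in_m pos_in [OF k x] pos_in [OF k y] in simp)
    then show "pos k x = pos k y"
      using row_entry pos_in [OF k x] pos_in [OF k y] by metis
  next
    assume "pos k x = pos k y"
    then show "(x, y) \<in> E"
      using to_first [OF x] to_first [OF y] E_trans E_sym by metis
  qed
  then have "E = Fib k"
    using E_sub by (auto simp: Fib_def)
  then show ?thesis
    using k E(2) by (auto simp: fib_def)
qed

lemma complements_orbits:
  assumes "d \<ge> 2" "m \<ge> 2"
  shows "complements (refines A) P orbits = fib ` carrier K"
  using fib_complement complement_is_fib assms by (auto simp: image_iff)

end

section \<open>The homotopy type of the fixed points\<close>

theorem proposition1p7:
  fixes n d :: nat and G :: "(nat \<Rightarrow> nat) set"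
  defines "C \<equiv> centralizer_group (sym_group d) G"
  assumes "n \<ge> 2" and "d \<ge> 1" and "d dvd n"
    and "subgroup G (sym_group d)"
    and "\<forall>i\<in>{1..d}. \<forall>j\<in>{1..d}. \<exists>\<sigma>\<in>G. \<sigma> i = j"
  shows "fixed_points (diagonal_embedding d n ` G) perm_act (partition_complex n)
    homotopy_equivalent_space
      induced_space (power_group C (n div d)) C (diagonal (n div d))
        susp_join_act (susp_join_base d (n div d)) (susp_join d (n div d) G)"
proof -
  define m where "m = n div d"
  have nm: "n = d * m"
    using assms(4) by (simp add: m_def)
  then have m1: "m \<ge> 1"
    using assms(2) by (cases m) auto
  interpret orbit_system n d m G
    by (rule orbit_system.intro [OF nm assms(3) m1 assms(5,6)])
  interpret sys: interval_system "refines {1..n}" "{Q. partition_on {1..n} Q}" P "refines {1..d}" D "refines {1..m}" M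
      "power_group C m" C "diagonal m" up dn fib perm_act
    unfolding C_def by (rule interval_system)
  have lhs: "fixed_points (diagonal_embedding d n ` G) perm_act (partition_complex n) = realization (refines {1..n}) P"
    by (rule fixed_points_partition_complex) (use De_permutes in auto)
  have "fixed_points G perm_act (partition_complex d) = realization (refines {1..d}) D"
    by (rule fixed_points_partition_complex) (rule G_permutes)
  then have rhs: "susp_join d m G = join_space (suspension_sphere d m) sys.J"
    by (simp add: susp_join_def partition_complex_def)
  have act: "susp_join_act = (\<lambda>h. map_join_pt id (map_join_pt (perm_act h) id))"
    by (simp add: susp_join_act_def fun_eq_iff)
  have fP: "finite P"
    by (rule sys.finite_P)
  have ne: "carrier (power_group C m) \<noteq> {}"
    unfolding C_def by (rule carrier_K_ne)
  have anti: "fib k = fib k'"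
    if "k \<in> carrier (power_group C m)" "k' \<in> carrier (power_group C m)" "refines {1..n} (fib k) (fib k')" for k k'
    using that unfolding C_def by (rule fib_antichain)
  show ?thesis
  proof (cases "d = 1 \<or> m = 1")
    case True
    \<comment> \<open>All \<open>fib k\<close> are the same trivial partition, whose link is the
      whole poset, so in this case there is even a homeomorphism.\<close>
    have "link (refines {1..n}) P (fib k) = P" "fib k = fib k'"
      if "k \<in> carrier (power_group C m)" "k' \<in> carrier (power_group C m)" for k k'
      using link_fib_trivial [OF _ True] that unfolding C_def fib_def by simp_all
    then have "induced_space (power_group C m) C (diagonal m) susp_join_act {}
        (join_space (discrete_topology {}) sys.J) homeomorphic_space realization (refines {1..n}) P"
      unfolding act by (intro sys.induced_space_trivial_suspension [OF ne])
    moreover have "suspension_sphere d m = discrete_topology {}" "susp_join_base d m = {}"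
      using True by (auto simp: suspension_sphere_def susp_join_base_def)
    ultimately show ?thesis
      unfolding lhs m_def [symmetric] rhs
      by (metis homeomorphic_imp_homotopy_equivalent_space homeomorphic_space_sym)
  next
    case False
    then have dm: "d \<ge> 2" "m \<ge> 2"
      using assms(3) m1 by auto
    have sphere: "suspension_sphere d m = sphere0" and base: "susp_join_base d m = {Join_Left 1}"
      using False by (auto simp: suspension_sphere_def susp_join_base_def sphere0_def)
    let ?F = "fib ` carrier (power_group C m)"
    have co: "complements (refines {1..n}) P orbits = ?F"
      unfolding C_def by (rule complements_orbits [OF dm])
    have orb: "orbits \<in> P"
      by (rule orbits_in_P [OF dm])
    \<comment> \<open>Every element is a common bound of itself with itself, so
      \<open>orbits\<close> is not its own complement; hence the part to be collapsed is not
      empty.\<close>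
    have "orbits \<notin> ?F"
      using orb refines_refl [OF partition_on_quotient [OF equiv_Col]]
      unfolding co [symmetric] complements_def orbits_def by auto
    moreover have sub: "?F \<subseteq> P"
      unfolding co [symmetric] complements_def by auto
    ultimately have "?F \<subset> P"
      using orb by auto
    then have "induced_space (power_group C m) C (diagonal m) susp_join_act {Join_Left 1} (join_space sphere0 sys.J)
        homeomorphic_space collapsed_realization (refines {1..n}) P ?F"
      unfolding act using anti by (intro sys.induced_space_suspension [OF ne])
    moreover have "realization (refines {1..n}) P homotopy_equivalent_space
        collapsed_realization (refines {1..n}) P ?F"
    proof (rule realization_homotopy_equivalent_collapsed [OF fP sub])
      show "x = y" if "x \<in> ?F" "y \<in> ?F" "refines {1..n} x y" for x y
        using that anti by auto
      have "finite_poset (refines {1..n}) P"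
        by (rule finite_poset_subset [OF finite_poset_refines sys.PP']) simp
      then show "contractible_space (realization (refines {1..n}) (P - ?F))"
        unfolding co [symmetric] by (rule contractible_without_complements [OF _ orb meets])
    qed
    ultimately show ?thesis
      unfolding lhs m_def [symmetric] rhs sphere base
      by (meson homeomorphic_imp_homotopy_equivalent_space homotopy_equivalent_space_sym homotopy_eqv_trans)
  qed
qed

end
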